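(* Suppose $\phi$ is a $C^{2}$ function defined on an open subset $\Omega\subset\mathbb{R}^{d-1}$, with Hessian matrix $H_\phi$, and let $\lambda$ be the affine surface area measure on the graph $\Gamma=\{(x,\phi(x)):x\in\Omega\}$, given by $$d\lambda=|\det H_\phi(x)|^{\frac{1}{d+1}}\,dx .$$ Define $\gamma:\Omega\to\mathbb{R}^d$ by $\gamma(x)=(x,\phi(x))$. There is a positive constant $C$, depending only on $d$ and the generic multiplicities of the maps $\operatorname{grad}\phi$ and $$\Psi:\Omega^d\to(\mathbb{R}^d)^{d-1},\qquad \Psi(x_1,\dots,x_d)=\big(\gamma(x_1)-\gamma(x_2),\dots,\gamma(x_1)-\gamma(x_d)\big),$$ such that if $q=\frac{4(d-1)}{d+1}$, then the Fourier restriction estimate $$\|\hat f\|_{L^{q,\infty}(\lambda)}\le C\,\|f\|_{4/3}$$ holds for $f\in L^{4/3}(\mathbb{R}^d)$.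
   Context: A mapping $\Phi$ into $\mathbb{R}^n$ has generic multiplicity bounded by $l$ if $\operatorname{card}(\Phi^{-1}(x))\le l$ for almost all $x\in\mathbb{R}^n$; for $\Psi$ the target $(\mathbb{R}^d)^{d-1}$ is identified with $\mathbb{R}^{d(d-1)}$. The measure $\lambda$ on $\Gamma$ is the image under $\gamma$ of the measure $|\det H_\phi(x)|^{1/(d+1)}\,dx$ on $\Omega$, where $dx$ is Lebesgue measure on $\mathbb{R}^{d-1}$. Here $\hat f$ is the Fourier transform of $f$ on $\mathbb{R}^d$, $\|f\|_{4/3}$ is the norm of $f$ in $L^{4/3}(\mathbb{R}^d)$, and $L^{q,\infty}(\lambda)$ is the weak-$L^q$ (Lorentz) space with respect to $\lambda$.
   Formalization: The formal theorem assumes d ≥ 3: for d = 2 the estimate fails (φ(x)=x²/2 on (−1,1) would force the Fourier transform of λ into L⁴(ℝ²), which is false by a logarithmic divergence), and for d = 1 one has q = 0 and the weak space is undefined. *)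

theory Defs
  imports "HOL-Analysis.Analysis"
begin

text \<open>
  With \<^term>\<open>d = CARD('n) + 1\<close>, the space \<open>R^(d-1)\<close> is \<open>real^'n\<close> and \<open>R^d\<close> is the
  Euclidean space \<open>(real^'n) \<times> real\<close>, in which graphs of functions on \<open>real^'n\<close> live.
\<close>

definition grad :: "('a::real_inner \<Rightarrow> real) \<Rightarrow> 'a \<Rightarrow> 'a" where
  "grad \<phi> x = (THE D. GDERIV \<phi> x :> D)"

definition hessian :: "(real^'n \<Rightarrow> real) \<Rightarrow> real^'n \<Rightarrow> real^'n^'n" where
  "hessian \<phi> x = jacobian (grad \<phi>) (at x)"

text \<open>Only meaningful for open \<open>\<Omega>\<close>, where derivatives within \<open>\<Omega>\<close> are the full derivatives.\<close>

definition C2_on :: "(real^'n) set \<Rightarrow> (real^'n \<Rightarrow> real) \<Rightarrow> bool" where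
  "C2_on \<Omega> \<phi> \<longleftrightarrow> \<phi> differentiable_on \<Omega> \<and> grad \<phi> differentiable_on \<Omega> \<and>
     continuous_on \<Omega> (hessian \<phi>)"

text \<open>Finiteness of the fibres is required explicitly, because \<^const>\<open>card\<close> is 0 on infinite sets.\<close>

definition generic_multiplicity_le ::
    "'a set \<Rightarrow> ('a \<Rightarrow> 'b::euclidean_space) \<Rightarrow> nat \<Rightarrow> bool" where
  "generic_multiplicity_le S \<Phi> l \<longleftrightarrow>
     (AE y in lborel. finite {x \<in> S. \<Phi> x = y} \<and> card {x \<in> S. \<Phi> x = y} \<le> l)"

definition graph_map :: "('a \<Rightarrow> real) \<Rightarrow> 'a \<Rightarrow> 'a \<times> real" where
  "graph_map \<phi> x = (x, \<phi> x)"

text \<open>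
  A \<open>d\<close>-tuple of points is a pair of its first entry and the vector of its \<open>d - 1\<close> other entries.
\<close>

definition tuples :: "'a set \<Rightarrow> ('a \<times> ('a^'n)) set" where
  "tuples \<Omega> = {(x, y). x \<in> \<Omega> \<and> (\<forall>i. y $ i \<in> \<Omega>)}"

definition Psi :: "(real^'n \<Rightarrow> real) \<Rightarrow> (real^'n) \<times> ((real^'n)^'n) \<Rightarrow> ((real^'n) \<times> real)^'n" where
  "Psi \<phi> = (\<lambda>(x, y). \<chi> i. graph_map \<phi> x - graph_map \<phi> (y $ i))"

text \<open>The exponent is \<open>1 / (d + 1)\<close>.\<close>

definition affine_surface_measure ::
    "(real^'n) set \<Rightarrow> (real^'n \<Rightarrow> real) \<Rightarrow> ((real^'n) \<times> real) measure" where
  "affine_surface_measure \<Omega> \<phi> =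
     distr
       (density (restrict_space lborel \<Omega>)
          (\<lambda>x. ennreal (\<bar>det (hessian \<phi> x)\<bar> powr (1 / (real CARD('n) + 2)))))
       (restrict_space borel (graph_map \<phi> ` \<Omega>))
       (graph_map \<phi>)"

definition Lp :: "real \<Rightarrow> ('a::euclidean_space \<Rightarrow> complex) set" where
  "Lp p = {f \<in> borel_measurable lebesgue. integrable lebesgue (\<lambda>x. norm (f x) powr p)}"

definition Lp_norm :: "real \<Rightarrow> ('a::euclidean_space \<Rightarrow> complex) \<Rightarrow> real" where
  "Lp_norm p f = (LINT x|lebesgue. norm (f x) powr p) powr (1 / p)"

definition ennreal_powr :: "ennreal \<Rightarrow> real \<Rightarrow> ennreal" where
  "ennreal_powr x a = (if x = \<infinity> then \<infinity> else ennreal (enn2real x powr a))"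

definition weak_norm :: "'a measure \<Rightarrow> real \<Rightarrow> ('a \<Rightarrow> complex) \<Rightarrow> ennreal" where
  "weak_norm M q g =
     (SUP t\<in>{0<..}. ennreal t * ennreal_powr (emeasure M {x \<in> space M. norm (g x) > t}) (1 / q))"

text \<open>The Fourier integral; meaningful only for \<open>f \<in> Lp 1\<close>.\<close>

definition fourier :: "('a::euclidean_space \<Rightarrow> complex) \<Rightarrow> 'a \<Rightarrow> complex" where
  "fourier f \<xi> = (LINT x|lebesgue. cis (- (\<xi> \<bullet> x)) * f x)"

text \<open>
  For \<open>f \<in> Lp p\<close> with \<open>p > 1\<close> the Fourier integral need not converge, and a measure \<open>M\<close> carried by
  a null set does not see the almost everywhere defined transform of \<open>f\<close>. As usual in restriction
  theory, the transform of \<open>f\<close> as an element of weak \<open>L^q(M)\<close> is the extension by continuity from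
  the dense subspace \<open>Lp 1 \<inter> Lp p\<close>: it is the \<open>M\<close>-a.e. unique \<open>g\<close> to which the transforms of
  every approximating sequence converge.
\<close>

definition fourier_extension ::
    "'a::euclidean_space measure \<Rightarrow> real \<Rightarrow> real \<Rightarrow> ('a \<Rightarrow> complex) \<Rightarrow> ('a \<Rightarrow> complex) \<Rightarrow> bool" where
  "fourier_extension M p q f g \<longleftrightarrow>
     g \<in> borel_measurable M \<and>
     (\<forall>F. (\<forall>n. F n \<in> Lp 1 \<inter> Lp p) \<longrightarrow>
          (\<lambda>n. Lp_norm p (\<lambda>x. F n x - f x)) \<longlonglongrightarrow> 0 \<longrightarrow>
          (\<lambda>n. weak_norm M q (\<lambda>\<xi>. fourier (F n) \<xi> - g \<xi>)) \<longlonglongrightarrow> 0)"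

end

theory Submission
  imports Defs "HOL-Probability.Characteristic_Functions"
begin

text \<open>
  Write \<open>n = d - 1\<close>, \<open>h = |det H|\<close> and \<open>w = h^(1/(n+2))\<close> for the density of the affine surface measure
  \<open>\<lambda>\<close>, so that \<open>w^(n+2) = h\<close> is the Jacobian of the gradient map. By duality, the bound for the level
  set \<open>E = {t < |fourier f|}\<close> follows from Hoelder's inequality once the Fourier transform of a
  density on \<open>E\<close> that is at most 1 in modulus is bounded in \<open>L^4\<close> by a power of \<open>\<lambda>(E)\<close>. Since
  \<open>4 = 2 * 2\<close>, this is an \<open>L^2\<close> bound for the autocorrelation of the density, which is
  dominated by the law of \<open>\<gamma>(x) - \<gamma>(y)\<close> under \<open>\<lambda> \<times> \<lambda>\<close> on \<open>E \<times> E\<close>. The heart of the matter is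
  therefore the energy estimate, for functions \<open>f \<ge> 0\<close> on \<open>R^d\<close>,
  \<open>(\<integral>\<integral> over E \<times> E of f(\<gamma>(x) - \<gamma>(y)) w(x) w(y) dx dy)^(2n) \<le> C \<lambda>(E)^(3n-2) (\<integral> f^2)^n\<close>.

  The energy estimate uses the two multiplicity hypotheses through two changes of variables. The
  Jacobian of \<open>\<Psi>\<close> at \<open>(x, y_1, ..., y_n)\<close> is \<open>det (grad \<phi>(y_i) - grad \<phi>(x))_i\<close>, so with
  \<open>N(x) = \<integral> \<Prod>_i f(\<gamma>(x) - \<gamma>(y_i))^2 |det (grad \<phi>(y_i) - grad \<phi>(x))_i| dy\<close>, integrated over \<open>E^n\<close>, one
  has \<open>\<integral> N \<le> l2 (\<integral> f^2)^n\<close> (\<open>nn_integral_Psi\<close>). For fixed \<open>x\<close>, an affine normalisation of the vectors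
  \<open>\<psi>(y) = grad \<phi>(y) - grad \<phi>(x)\<close> bounds \<open>N(x)\<close> from below: among the matrices \<open>L\<close> of determinant 1
  choose one minimising \<open>\<Sum>_i \<integral> \<kappa> |(L \<psi>)_i|\<close>, where \<open>\<kappa>(y) = f(\<gamma>(x) - \<gamma>(y))^2\<close>. The first-order conditions say
  that \<open>\<integral> \<kappa> sgn((L \<psi>)_i) (L \<psi>)_j = 0\<close> for \<open>i \<noteq> j\<close>, and expanding a determinant then gives
  \<open>\<Prod>_i \<integral> \<kappa> |(L \<psi>)_i| \<le> N(x)\<close> (\<open>unimodular_normalisation\<close>). With \<open>g = \<Sum>_i |(L \<psi>)_i|\<close>, Cauchy-Schwarz
  bounds the square of \<open>T(x) = \<integral> f(\<gamma>(x) - \<gamma>(y)) w(y) dy\<close>, taken over the points \<open>y\<close> of \<open>E\<close> with \<open>w(y) \<ge> w(x)\<close>, by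
  \<open>\<integral> \<kappa> g\<close> times \<open>\<integral> w^2 / g\<close>. The last integral is controlled by the multiplicity of the gradient,
  because \<open>g < t\<close> confines \<open>grad \<phi>(y)\<close> to a parallelepiped of volume at most \<open>(2t)^n\<close>
  (\<open>weight_integral_bound\<close>). The outcome is \<open>w(x) T(x)^(2n) \<le> C \<lambda>(E)^(n-1) N(x)\<close> (\<open>fibre_bound\<close>), to be
  integrated in \<open>x\<close>; the points with \<open>w(y) \<le> w(x)\<close> are covered by exchanging \<open>x\<close> and \<open>y\<close>.

  In place of Plancherel's theorem, the \<open>L^2\<close> norm of a Fourier transform is computed with a
  Gaussian weight, which turns it into a pairing of the measure with its own Gaussian smoothing;
  the energy estimate bounds this pairing uniformly in the Gaussian (\<open>fourier_L2_bound\<close>). The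
  passage from integrable functions to \<open>L^(4/3)\<close> is the usual extension by continuity: a rapidly
  converging sequence of truncations has transforms that converge almost everywhere, and
  Fatou's lemma carries the weak-type bound to the limit.
\<close>

section \<open>Lebesgue measure in coordinates\<close>

text \<open>
  A linear map that permutes coordinates carries boxes to boxes of the same volume. This justifies
  renaming the index type of \<open>real^'n\<close> and regrouping the coordinates of products.
\<close>

lemma lborel_distr_basis_bij:
  fixes T :: "'a::euclidean_space \<Rightarrow> 'b::euclidean_space"
  assumes T: "linear T" and B: "bij_betw T Basis Basis"
  shows "distr lborel lborel T = lborel"
proof (rule lborel_eqI[symmetric])
  have TB: "T ` Basis = Basis" and inj: "inj_on T Basis"
    using B by (auto simp: bij_betw_def)
  have [measurable]: "T \<in> borel \<rightarrow>\<^sub>M borel"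
    by (intro borel_measurable_continuous_onI linear_continuous_on) (simp add: T linear_linear)
  have inner: "T x \<bullet> T b = x \<bullet> b" if "b \<in> Basis" for x b
  proof -
    have "T x = T (\<Sum>c\<in>Basis. (x \<bullet> c) *\<^sub>R c)"
      by (simp add: euclidean_representation)
    also have "\<dots> = (\<Sum>c\<in>Basis. (x \<bullet> c) *\<^sub>R T c)"
      using T by (simp add: linear_sum linear_cmul)
    finally have "T x \<bullet> T b = (\<Sum>c\<in>Basis. (x \<bullet> c) * (T c \<bullet> T b))"
      by (simp add: inner_sum_left)
    also have "\<dots> = (\<Sum>c\<in>Basis. if c = b then x \<bullet> c else 0)"
      using TB inj that
      by (intro sum.cong refl) (metis (mono_tags, lifting) imageI inj_on_def inner_Basis mult_cancel_left1 mult_zero_right)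
    finally show ?thesis using that by simp
  qed
  fix l u :: 'b assume lu: "\<And>b. b \<in> Basis \<Longrightarrow> l \<bullet> b \<le> u \<bullet> b"
  let ?p = "\<lambda>v. \<Sum>b\<in>Basis. (v \<bullet> T b) *\<^sub>R b"
  have p: "?p v \<bullet> b = v \<bullet> T b" if "b \<in> Basis" for v b
    using that by (simp add: inner_sum_left inner_Basis if_distrib cong: if_cong)
  have "x \<in> T -` box l u \<longleftrightarrow> x \<in> box (?p l) (?p u)" for x
  proof -
    have "x \<in> T -` box l u \<longleftrightarrow> (\<forall>b\<in>T ` Basis. l \<bullet> b < T x \<bullet> b \<and> T x \<bullet> b < u \<bullet> b)"
      by (simp add: box_def TB)
    then show ?thesis
      by (simp add: mem_box inner p)
  qed
  then have "T -` box l u = box (?p l) (?p u)" by blast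
  then have "emeasure (distr lborel lborel T) (box l u) = emeasure lborel (box (?p l) (?p u))"
    by (simp add: emeasure_distr)
  also have "\<dots> = ennreal (\<Prod>b\<in>Basis. (u - l) \<bullet> T b)"
    using lu TB by (auto simp: emeasure_lborel_box_eq inner_diff_left)
  also have "(\<Prod>b\<in>Basis. (u - l) \<bullet> T b) = (\<Prod>b\<in>Basis. (u - l) \<bullet> b)"
    using B by (rule prod.reindex_bij_betw)
  finally show "emeasure (distr lborel lborel T) (box l u) = ennreal (\<Prod>b\<in>Basis. (u - l) \<bullet> b)" .
qed simp

lemma borel_measurable_vec_nth[measurable]: "(\<lambda>x::'a::euclidean_space^'n. x $ i) \<in> borel_measurable borel"
  by (intro borel_measurable_continuous_onI continuous_intros)

lemma borel_measurable_vec_lambda[measurable (raw)]: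
  fixes f :: "'n::finite \<Rightarrow> 'b \<Rightarrow> 'a::euclidean_space"
  assumes [measurable]: "\<And>i. f i \<in> borel_measurable M"
  shows "(\<lambda>x. \<chi> i. f i x) \<in> borel_measurable M"
proof (subst borel_measurable_euclidean_space, intro ballI)
  fix b :: "'a^'n" assume "b \<in> Basis"
  show "(\<lambda>x. (\<chi> i. f i x) \<bullet> b) \<in> borel_measurable M"
    unfolding inner_vec_def by simp
qed

lemma borel_measurable_det[measurable (raw)]:
  fixes A :: "'b \<Rightarrow> real^'n^'n"
  assumes [measurable]: "A \<in> borel_measurable M"
  shows "(\<lambda>x. det (A x)) \<in> borel_measurable M"
proof -
  have [measurable]: "(\<lambda>x. A x $ i $ j) \<in> borel_measurable M" for i j
    by (rule measurable_compose[OF _ borel_measurable_vec_nth])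
       (rule measurable_compose[OF assms borel_measurable_vec_nth])
  show ?thesis unfolding det_def by measurable
qed

lemma continuous_on_det:
  fixes A :: "'b::topological_space \<Rightarrow> real^'n^'n"
  assumes "continuous_on S A"
  shows "continuous_on S (\<lambda>x. det (A x))"
  unfolding det_def by (intro continuous_intros assms)

lemma Basis_vec_image: "Basis = (\<lambda>(i, b). axis i b) ` (UNIV \<times> Basis)"
  unfolding Basis_vec_def by auto

lemma lborel_eq_distr_PiM:
  "lborel = distr (\<Pi>\<^sub>M i\<in>(UNIV::'n::finite set). (lborel :: 'a::euclidean_space measure)) borel (\<lambda>f. \<chi> i. f i)"
proof (rule lborel_eqI)
  interpret product_sigma_finite "\<lambda>_::'n. lborel :: 'a measure" ..
  fix l u :: "'a^'n" assume lu: "\<And>b. b \<in> Basis \<Longrightarrow> l \<bullet> b \<le> u \<bullet> b"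
  have lu': "l $ i \<bullet> b \<le> u $ i \<bullet> b" if "b \<in> Basis" for i b
    using lu[of "axis i b"] that by (simp add: inner_axis axis_in_Basis_iff)
  let ?P = "\<Pi>\<^sub>M i\<in>(UNIV::'n set). (lborel :: 'a measure)"
  have *: "(\<lambda>f. \<chi> i. f i) -` box l u \<inter> space ?P = (\<Pi>\<^sub>E i\<in>UNIV. box (l $ i) (u $ i))"
    by (auto simp: box_def space_PiM PiE_iff Basis_vec_def inner_axis)
  have "emeasure (distr ?P borel (\<lambda>f. \<chi> i. f i)) (box l u) = (\<Prod>i\<in>UNIV. emeasure lborel (box (l $ i) (u $ i)))"
    by (subst emeasure_distr, measurable) (simp add: * emeasure_PiM)
  also have "\<dots> = ennreal (\<Prod>i\<in>UNIV. \<Prod>b\<in>Basis. (u $ i - l $ i) \<bullet> b)"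
    using lu' by (simp add: emeasure_lborel_box_eq prod_ennreal prod_nonneg inner_diff_left)
  also have "(\<Prod>i\<in>UNIV. \<Prod>b\<in>Basis. (u $ i - l $ i) \<bullet> b) = (\<Prod>b\<in>Basis. (u - l) \<bullet> b)"
  proof -
    have "bij_betw (\<lambda>(i, b). axis i b) (UNIV \<times> Basis) (Basis :: ('a^'n) set)"
      unfolding bij_betw_def inj_on_def Basis_vec_image
      by (auto simp: axis_eq_axis)
    then have "(\<Prod>b\<in>Basis. (u - l) \<bullet> b) = (\<Prod>x\<in>UNIV \<times> Basis. (u - l) \<bullet> (case x of (i, b) \<Rightarrow> axis i b))"
      by (rule prod.reindex_bij_betw[symmetric])
    then show ?thesis
      by (simp add: prod.cartesian_product inner_axis case_prod_unfold)
  qed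
  finally show "emeasure (distr ?P borel (\<lambda>f. \<chi> i. f i)) (box l u) = ennreal (\<Prod>b\<in>Basis. (u - l) \<bullet> b)" .
qed simp

lemma nn_integral_prod_vec:
  fixes F :: "'n::finite \<Rightarrow> 'a::euclidean_space \<Rightarrow> ennreal"
  assumes [measurable]: "\<And>i. F i \<in> borel_measurable borel"
  shows "(\<integral>\<^sup>+y. (\<Prod>i\<in>UNIV. F i (y $ i)) \<partial>lborel) = (\<Prod>i\<in>UNIV. \<integral>\<^sup>+x. F i x \<partial>lborel)"
proof -
  interpret product_sigma_finite "\<lambda>_::'n. lborel :: 'a measure" ..
  show ?thesis
    by (subst lborel_eq_distr_PiM, subst nn_integral_distr, measurable)
       (simp add: product_nn_integral_prod)
qed

lemma
  fixes F :: "'n::finite \<Rightarrow> 'a::euclidean_space \<Rightarrow> real"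
  assumes int: "\<And>i. integrable lborel (F i)"
  shows integrable_prod_vec: "integrable lborel (\<lambda>y. \<Prod>i\<in>UNIV. F i (y $ i))"
    and integral_prod_vec: "(LINT y|lborel. (\<Prod>i\<in>UNIV. F i (y $ i))) = (\<Prod>i\<in>UNIV. LINT x|lborel. F i x)"
proof -
  interpret product_sigma_finite "\<lambda>_::'n. lborel :: 'a measure" ..
  have [measurable]: "F i \<in> borel_measurable borel" for i
    using borel_measurable_integrable[OF int] by simp
  show "integrable lborel (\<lambda>y. \<Prod>i\<in>UNIV. F i (y $ i))"
    by (subst lborel_eq_distr_PiM, subst integrable_distr_eq, measurable)
       (simp add: product_integrable_prod int)
  show "(LINT y|lborel. (\<Prod>i\<in>UNIV. F i (y $ i))) = (\<Prod>i\<in>UNIV. LINT x|lborel. F i x)"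
    by (subst lborel_eq_distr_PiM, subst integral_distr, measurable)
       (simp add: product_integral_prod int)
qed

text \<open>
  The regrouping \<open>(R^n)^n \<times> R^n = (R^n \<times> R)^n\<close> of the target space of \<^const>\<open>Psi\<close>: the first factor holds
  the differences of the base points, the second the differences of the heights.
\<close>

lemma lborel_eq_distr_zip:
  "lborel = distr lborel lborel
     (\<lambda>p :: ('a::euclidean_space^'n::finite) \<times> (real^'n). \<chi> i. (fst p $ i, snd p $ i))"
proof (rule lborel_distr_basis_bij[symmetric])
  let ?T = "\<lambda>p :: ('a^'n) \<times> (real^'n). \<chi> i. (fst p $ i, snd p $ i)"
  show "linear ?T"
    by (rule linearI) (simp_all add: vec_eq_iff)
  have 1: "?T (axis i u, 0) = axis i (u, 0)" "?T (0, axis i v) = axis i (0, v)" for i u v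
    by (simp_all add: vec_eq_iff axis_def zero_prod_def)
  have "inj ?T"
    by (rule injI) (auto simp: vec_eq_iff prod_eq_iff)
  moreover have "?T ` Basis = Basis"
  proof -
    have "?T ` Basis = (\<lambda>u. ?T (u, 0)) ` Basis \<union> (\<lambda>v. ?T (0, v)) ` Basis"
      unfolding Basis_prod_def image_Un image_image ..
    also have "\<dots> = (\<lambda>(i, u). axis i (u, 0)) ` (UNIV \<times> Basis) \<union> (\<lambda>(i, v). axis i (0, v)) ` (UNIV \<times> Basis)"
      unfolding Basis_vec_image image_image case_prod_unfold 1 ..
    also have "\<dots> = (\<lambda>(i, b). axis i b) ` (UNIV \<times> (((\<lambda>u. (u, 0)) ` Basis) \<union> ((\<lambda>v. (0, v)) ` Basis)))"
      by (auto simp: image_iff)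
    also have "\<dots> = Basis"
      unfolding Basis_vec_image Basis_prod_def ..
    finally show ?thesis .
  qed
  ultimately show "bij_betw ?T Basis Basis"
    by (auto simp: bij_betw_def intro: inj_on_subset)
qed

section \<open>Change of variables with multiplicity\<close>

lemma nn_integral_det_inj:
  fixes g :: "real^'m::{finite,wellorder} \<Rightarrow> real^'m::_" and A :: "real^'m::_ \<Rightarrow> real^'m::_^'m::_"
  assumes S: "S \<in> sets borel" "bounded S"
    and der: "\<And>x. x \<in> S \<Longrightarrow> (g has_derivative (\<lambda>v. A x *v v)) (at x)"
    and inj: "inj_on g S"
    and meas: "(\<lambda>x. indicator S x * \<bar>det (A x)\<bar>) \<in> borel_measurable borel"
    and bd: "\<And>x. x \<in> S \<Longrightarrow> \<bar>det (A x)\<bar> \<le> K"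
  shows "g ` S \<in> sets lebesgue"
    and "emeasure lebesgue (g ` S) = (\<integral>\<^sup>+x. ennreal (indicator S x * \<bar>det (A x)\<bar>) \<partial>lborel)"
proof -
  let ?h = "\<lambda>x. \<bar>det (A x)\<bar>"
  note meas[measurable] S(1)[measurable]
  have fin: "emeasure lborel S < \<infinity>"
    using S(2) by (rule emeasure_bounded_finite)
  have int: "integrable lborel (\<lambda>x. indicator S x * ?h x)"
  proof (rule Bochner_Integration.integrable_bound[of _ "\<lambda>x. indicator S x * K"])
    show "integrable lborel (\<lambda>x. indicator S x * K)"
      using S(1) fin by (simp add: less_top)
    show "AE x in lborel. norm (indicator S x * ?h x) \<le> norm (indicator S x * K)"
      using bd by (intro AE_I2) (auto simp: indicator_def intro: order_trans[OF _ abs_ge_self])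
  qed measurable
  have hi: "((\<lambda>x. indicator S x * ?h x) has_integral (LINT x|lborel. indicator S x * ?h x)) UNIV"
    using has_integral_integral_lborel[OF int] .
  then have "((\<lambda>x. if x \<in> S then ?h x else 0) has_integral (LINT x|lborel. indicator S x * ?h x)) UNIV"
    by (rule has_integral_eq[rotated]) (simp add: indicator_def)
  then have hS: "(?h has_integral (LINT x|lborel. indicator S x * ?h x)) S"
    by (simp only: has_integral_restrict_UNIV)
  have m: "matrix (\<lambda>v. A x *v v) = A x" for x
    by (simp add: matrix_of_matrix_vector_mul)
  have Sl: "S \<in> sets lebesgue" using S(1) by simp
  have *: "g ` S \<in> lmeasurable \<and> measure lebesgue (g ` S) = (LINT x|lborel. indicator S x * ?h x)"
    by (subst has_measure_differentiable_image[OF Sl _ inj, where f'="\<lambda>x v. A x *v v"])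
       (use der hS in \<open>auto simp: m intro: has_derivative_at_withinI\<close>)
  then show "g ` S \<in> sets lebesgue" by (simp add: fmeasurableD)
  have "emeasure lebesgue (g ` S) = ennreal (LINT x|lborel. indicator S x * ?h x)"
    using * by (simp only: emeasure_eq_measure2)
  also have "\<dots> = (\<integral>\<^sup>+x. ennreal (indicator S x * ?h x) \<partial>lborel)"
    by (rule nn_integral_eq_integral[OF int, symmetric]) simp
  finally show "emeasure lebesgue (g ` S) = (\<integral>\<^sup>+x. ennreal (indicator S x * ?h x) \<partial>lborel)" .
qed

text \<open>
  By the inverse function theorem every point where the Jacobian does not vanish has a ball on
  which the map is injective; Lindelof's theorem leaves countably many such balls, which are then
  made disjoint. Boundedness of the pieces and of the Jacobian on them secures integrability.
\<close>

lemma countable_injective_cover: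
  fixes g :: "real^'n \<Rightarrow> real^'n" and A :: "real^'n \<Rightarrow> real^'n^'n"
  assumes S: "open S"
    and der: "\<And>x. x \<in> S \<Longrightarrow> (g has_derivative (\<lambda>v. A x *v v)) (at x)"
    and cont: "continuous_on S A"
  obtains D :: "nat \<Rightarrow> (real^'n) set" where
    "\<And>k. D k \<in> sets borel" "\<And>k. bounded (D k)" "\<And>k. inj_on g (D k)" "\<And>k. D k \<subseteq> S"
    "\<And>k. \<exists>K. \<forall>x\<in>D k. \<bar>det (A x)\<bar> \<le> K"
    "disjoint_family D" "(\<Union>k. D k) = {x \<in> S. det (A x) \<noteq> 0}"
proof -
  have cd: "continuous_on S (\<lambda>x. det (A x))" using cont by (rule continuous_on_det)
  define S0 where "S0 = {x \<in> S. det (A x) \<noteq> 0}"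
  have S0: "open S0"
  proof -
    have "open (S \<inter> (\<lambda>x. det (A x)) -` (- {0}))"
      using cd S by (simp add: continuous_on_open_vimage open_Compl Int_commute)
    moreover have "S \<inter> (\<lambda>x. det (A x)) -` (- {0}) = S0" by (auto simp: S0_def)
    ultimately show ?thesis by simp
  qed
  have "\<exists>r>0. cball a r \<subseteq> S0 \<and> inj_on g (ball a r)" if a: "a \<in> S0" for a
  proof -
    have inv: "invertible (A a)" using a by (simp add: S0_def invertible_det_nz)
    have aS: "a \<in> S" using a by (simp add: S0_def)
    obtain B where B: "B ** A a = mat 1" using inv by (auto simp: invertible_def)
    obtain r where r: "r > 0" "ball a r \<subseteq> S" "inj_on g (ball a r)"
    proof (rule has_derivative_locally_injective[OF aS S, where f=g and f'="\<lambda>x v. A x *v v" and g'="\<lambda>v. B *v v"])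
      show "bounded_linear (\<lambda>v. B *v v)" by (simp add: matrix_vector_mul_bounded_linear)
      show "(\<lambda>v. B *v v) \<circ> (\<lambda>v. A a *v v) = id"
        by (simp add: fun_eq_iff matrix_vector_mul_assoc B)
      fix e :: real assume e: "e > 0"
      have "isCont A a" using cont S aS by (simp add: continuous_on_eq_continuous_at)
      moreover have "0 < e / 2 / (of_nat CARD('n) * of_nat CARD('n) + 1)" using e by (intro divide_pos_pos add_nonneg_pos) auto
      ultimately obtain d where d: "d > 0" "\<And>x. dist x a < d \<Longrightarrow> dist (A x) (A a) < e / 2 / (of_nat CARD('n) * of_nat CARD('n) + 1)"
        unfolding continuous_at_eps_delta by metis
      show "\<exists>d>0. \<forall>x. dist a x < d \<longrightarrow> onorm (\<lambda>v. A x *v v - A a *v v) < e"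
      proof (intro exI[of _ d] conjI allI impI d(1))
        fix x assume x: "dist a x < d"
        let ?c = "e / 2 / (of_nat CARD('n) * of_nat CARD('n) + 1)"
        have nn: "norm (A x - A a) < ?c" using d(2)[of x] x unfolding dist_norm[symmetric] by (simp only: dist_commute)
        have "onorm (\<lambda>v. (A x - A a) *v v) \<le> of_nat CARD('n) * of_nat CARD('n) * ?c"
        proof (rule onorm_le_matrix_component)
          fix i j
          have "\<bar>(A x - A a) $ i $ j\<bar> \<le> norm ((A x - A a) $ i)" by (rule component_le_norm_cart)
          also have "\<dots> \<le> norm (A x - A a)" by (rule Finite_Cartesian_Product.norm_nth_le)
          finally show "\<bar>(A x - A a) $ i $ j\<bar> \<le> ?c" using nn by simp
        qed
        also have "\<dots> = (e / 2) * (of_nat CARD('n) * of_nat CARD('n) / (of_nat CARD('n) * of_nat CARD('n) + 1))"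
          by simp
        also have "\<dots> \<le> (e / 2) * 1"
          using e by (intro mult_left_mono) (auto simp: divide_le_eq_1 add_nonneg_pos)
        also have "\<dots> < e" using e by simp
        finally show "onorm (\<lambda>v. A x *v v - A a *v v) < e" by (simp add: matrix_vector_mult_diff_rdistrib)
      qed
    qed (use der in auto)
    obtain r' where r': "r' > 0" "cball a r' \<subseteq> S0" using S0 a unfolding open_contains_cball by blast
    have "inj_on g (ball a (min r r'))" using r(3) by (rule inj_on_subset) auto
    moreover have "cball a (min r r') \<subseteq> S0" using r'(2) by (rule order_trans[rotated]) auto
    ultimately show ?thesis using r(1) r'(1) by (intro exI[of _ "min r r'"]) auto
  qed
  then obtain r where r: "\<And>a. a \<in> S0 \<Longrightarrow> r a > 0" "\<And>a. a \<in> S0 \<Longrightarrow> cball a (r a) \<subseteq> S0"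
      "\<And>a. a \<in> S0 \<Longrightarrow> inj_on g (ball a (r a))"
    by metis
  obtain F' where F': "F' \<subseteq> (\<lambda>a. ball a (r a)) ` S0" "countable F'" "\<Union>F' = \<Union>((\<lambda>a. ball a (r a)) ` S0)"
    by (rule Lindelof[of "(\<lambda>a. ball a (r a)) ` S0"]) auto
  have U: "\<Union>F' = S0"
  proof -
    have "ball a (r a) \<subseteq> S0" if "a \<in> S0" for a using r(2)[OF that] ball_subset_cball by blast
    moreover have "a \<in> ball a (r a)" if "a \<in> S0" for a using r(1)[OF that] by simp
    ultimately show ?thesis unfolding F'(3) by (intro equalityI UN_least) (auto intro!: UN_I)
  qed
  define B where "B = from_nat_into (insert {} F')"
  have rB: "range B = insert {} F'" unfolding B_def using F'(2) by (intro range_from_nat_into) auto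
  have B: "B k = {} \<or> (\<exists>a\<in>S0. B k = ball a (r a))" for k
  proof -
    have "B k \<in> insert {} F'" using rB by (metis rangeI)
    then show ?thesis using F'(1) by (auto dest!: subsetD)
  qed
  show ?thesis
  proof (rule that[of "disjointed B"])
    have sub: "disjointed B k \<subseteq> B k" for k by (rule disjointed_subset)
    have BS: "B k \<subseteq> S0" for k
    proof -
      have "B k \<in> insert {} F'" using rB by (metis rangeI)
      then show ?thesis using U by auto
    qed
    have "B k \<in> sets borel" for k using B[of k] by auto
    then have "range B \<subseteq> sets borel" by (intro image_subsetI)
    from sets.range_disjointed_sets[OF this] show "disjointed B k \<in> sets borel" for k
      by (rule subsetD) simp
    have "bounded (B k)" for k using B[of k] by auto
    then show "bounded (disjointed B k)" for k by (rule bounded_subset[OF _ sub])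
    have "inj_on g (B k)" for k using B[of k] r(3) by auto
    then show "inj_on g (disjointed B k)" for k by (rule inj_on_subset[OF _ sub])
    show "disjointed B k \<subseteq> S" for k using order_trans[OF sub BS] unfolding S0_def by (rule order_trans) auto
    show "\<exists>K. \<forall>x\<in>disjointed B k. \<bar>det (A x)\<bar> \<le> K" for k
    proof (cases "B k = {}")
      case False
      with B[of k] obtain a where a: "a \<in> S0" "B k = ball a (r a)" by auto
      have "cball a (r a) \<subseteq> S" using r(2)[OF a(1)] unfolding S0_def by (rule order_trans) auto
      then have "compact ((\<lambda>x. det (A x)) ` cball a (r a))"
        by (intro compact_continuous_image continuous_on_subset[OF cd]) auto
      from compact_imp_bounded[OF this] obtain K where K: "\<forall>x\<in>cball a (r a). \<bar>det (A x)\<bar> \<le> K"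
        unfolding bounded_iff by auto
      have "disjointed B k \<subseteq> cball a (r a)" using sub[of k] a(2) by auto
      then show ?thesis using K by blast
    qed (use sub[of k] in auto)
    show "disjoint_family (disjointed B)" by (rule disjoint_family_disjointed)
    show "(\<Union>k. disjointed B k) = {x \<in> S. det (A x) \<noteq> 0}"
      using rB U unfolding UN_disjointed_eq S0_def[symmetric] by simp
  qed
qed

text \<open>
  Each of the disjoint pieces whose image meets \<open>z\<close> contributes its own preimage of \<open>z\<close>.
\<close>

lemma sum_image_indicator_le_card:
  assumes fin: "finite {x \<in> S. g x = z}" and D: "\<And>k. D k \<subseteq> S" "disjoint_family D"
  shows "(\<Sum>k. indicator (g ` (D k \<inter> g -` Z)) z :: ennreal) \<le> of_nat (card {x \<in> S. g x = z}) * indicator Z z"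
proof (cases "z \<in> Z")
  case False
  then have "indicator (g ` (D k \<inter> g -` Z)) z = (0::ennreal)" for k by (auto simp: indicator_def)
  then show ?thesis by simp
next
  case True
  have "(\<Sum>k<N. indicator (g ` (D k \<inter> g -` Z)) z :: ennreal) \<le> of_nat (card {x \<in> S. g x = z})" for N
  proof -
    define I where "I = {k\<in>{..<N}. z \<in> g ` (D k \<inter> g -` Z)}"
    have "(\<Sum>k<N. indicator (g ` (D k \<inter> g -` Z)) z :: ennreal) = of_nat (card I)"
    proof -
      have "(\<Sum>k<N. indicator (g ` (D k \<inter> g -` Z)) z :: ennreal) = (\<Sum>k<N. if k \<in> I then 1 else 0)"
        by (intro sum.cong refl) (simp add: I_def indicator_def)
      also have "\<dots> = of_nat (card ({..<N} \<inter> I))"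
        by (subst sum.If_cases) auto
      also have "{..<N} \<inter> I = I" by (auto simp: I_def)
      finally show ?thesis .
    qed
    also have "card I \<le> card {x \<in> S. g x = z}"
    proof -
      have "\<forall>k\<in>I. \<exists>x. x \<in> D k \<and> g x = z" by (auto simp: I_def)
      then obtain c where c: "\<And>k. k \<in> I \<Longrightarrow> c k \<in> D k \<and> g (c k) = z" by metis
      have "inj_on c I"
        proof (rule inj_onI, rule ccontr)
        fix i j assume ij: "i \<in> I" "j \<in> I" "c i = c j" "i \<noteq> j"
        then have "D i \<inter> D j = {}" using D(2) by (simp add: disjoint_family_on_def)
        then show False using c[OF ij(1)] c[OF ij(2)] ij(3) by auto
      qed
      moreover have "c ` I \<subseteq> {x \<in> S. g x = z}" using c D(1) by (auto dest!: subsetD)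
      ultimately show ?thesis using fin by (intro card_inj_on_le)
    qed
    then have "(of_nat (card I) :: ennreal) \<le> of_nat (card {x \<in> S. g x = z})" by simp
    finally show ?thesis .
  qed
  then show ?thesis using True by (auto intro!: suminf_le_const summableI)
qed

text \<open>
  Both sides are integrals of \<open>F\<close>, against the image of the Jacobian measure and against \<open>l\<close> times
  Lebesgue measure, so it suffices to compare these measures on sets. There the left-hand side is
  the sum over the injective pieces of the volumes of their images, which overlap at most
  \<open>l\<close> times almost everywhere.
\<close>

lemma nn_integral_det_multiplicity_wellorder:
  fixes g :: "real^'m::{finite,wellorder} \<Rightarrow> real^'m::_" and A :: "real^'m::_ \<Rightarrow> real^'m::_^'m::_"
  assumes S: "open S"
    and der: "\<And>x. x \<in> S \<Longrightarrow> (g has_derivative (\<lambda>v. A x *v v)) (at x)"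
    and cont: "continuous_on S A"
    and mult: "generic_multiplicity_le S g l"
    and F: "F \<in> borel_measurable borel"
  shows "(\<integral>\<^sup>+x. F (g x) * ennreal \<bar>det (A x)\<bar> * indicator S x \<partial>lborel) \<le> of_nat l * (\<integral>\<^sup>+z. F z \<partial>lborel)"
proof -
  have "\<exists>D :: nat \<Rightarrow> (real^'m::_) set. (\<forall>k. D k \<in> sets borel) \<and> (\<forall>k. bounded (D k)) \<and> (\<forall>k. inj_on g (D k)) \<and>
    (\<forall>k. D k \<subseteq> S) \<and> (\<forall>k. \<exists>K. \<forall>x\<in>D k. \<bar>det (A x)\<bar> \<le> K) \<and>
    disjoint_family D \<and> (\<Union>k. D k) = {x \<in> S. det (A x) \<noteq> 0}"
    by (rule countable_injective_cover[OF S der cont]) blast+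
  then obtain D :: "nat \<Rightarrow> (real^'m::_) set" where D: "\<And>k. D k \<in> sets borel" "\<And>k. bounded (D k)"
    "\<And>k. inj_on g (D k)" "\<And>k. D k \<subseteq> S"
    "\<And>k. \<exists>K. \<forall>x\<in>D k. \<bar>det (A x)\<bar> \<le> K"
    "disjoint_family D" "(\<Union>k. D k) = {x \<in> S. det (A x) \<noteq> 0}"
    by (elim exE conjE) auto
  note D(1)[measurable] F[measurable]
  have [measurable]: "S \<in> sets borel" using S by simp
  have cd: "continuous_on S (\<lambda>x. \<bar>det (A x)\<bar>)" by (intro continuous_intros continuous_on_det cont)
  define h where "h x = indicator S x *\<^sub>R \<bar>det (A x)\<bar>" for x
  have h[measurable]: "h \<in> borel_measurable borel"
    unfolding h_def using cd by (intro borel_measurable_continuous_on_indicator) auto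
  have h0: "h x \<ge> 0" for x by (simp add: h_def)
  define g0 where "g0 x = indicator S x *\<^sub>R g x" for x
  have "continuous_on S g" using der by (meson has_derivative_at_withinI has_derivative_continuous_on)
  then have g0[measurable]: "g0 \<in> borel_measurable borel"
    unfolding g0_def by (intro borel_measurable_continuous_on_indicator) auto
  have g0S: "g0 x = g x" if "x \<in> S" for x using that by (simp add: g0_def)
  let ?M = "distr (density lborel h) borel g0"
  let ?L = "scale_measure (of_nat l) lborel"
  have "?M \<le> ?L"
  proof (subst le_measure, simp, intro ballI)
    fix Z :: "(real^'m::_) set" assume "Z \<in> sets ?M"
    then have [measurable]: "Z \<in> sets borel" by simp
    show "emeasure ?M Z \<le> emeasure ?L Z"
    proof -
      let ?D = "\<lambda>k. D k \<inter> g0 -` Z"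
      have gZ[measurable]: "g0 -` Z \<in> sets borel"
        using measurable_sets[OF g0 \<open>Z \<in> sets borel\<close>] by simp
      have Db[measurable]: "?D k \<in> sets borel" for k by measurable
      have Deq: "?D k = D k \<inter> g -` Z" for k using D(4)[of k] g0S by auto
      have img: "g ` ?D k \<in> sets lebesgue"
        "emeasure lebesgue (g ` ?D k) = (\<integral>\<^sup>+x. ennreal (h x) * indicator (?D k) x \<partial>lborel)" for k
      proof -
        obtain K where K: "\<forall>x\<in>D k. \<bar>det (A x)\<bar> \<le> K" using D(5) by blast
        have e: "indicator (?D k) x * \<bar>det (A x)\<bar> = indicator (?D k) x * h x" for x
          using D(4)[of k] by (auto simp: indicator_def h_def)
        have m: "(\<lambda>x. indicator (?D k) x * \<bar>det (A x)\<bar>) \<in> borel_measurable borel"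
          unfolding e by measurable
        have b: "bounded (?D k)" using D(2) by (rule bounded_subset) auto
        have i: "inj_on g (?D k)" using D(3) by (rule inj_on_subset) auto
        have d: "\<And>x. x \<in> ?D k \<Longrightarrow> (g has_derivative (\<lambda>v. A x *v v)) (at x)" using der D(4) by blast
        have kk: "\<And>x. x \<in> ?D k \<Longrightarrow> \<bar>det (A x)\<bar> \<le> K" using K by auto
        show "g ` ?D k \<in> sets lebesgue" by (rule nn_integral_det_inj(1)[OF Db b d i m kk])
        have "emeasure lebesgue (g ` ?D k) = (\<integral>\<^sup>+x. ennreal (indicator (?D k) x * \<bar>det (A x)\<bar>) \<partial>lborel)"
          by (rule nn_integral_det_inj(2)[OF Db b d i m kk])
        also have "\<dots> = (\<integral>\<^sup>+x. ennreal (h x) * indicator (?D k) x \<partial>lborel)"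
          by (rule nn_integral_cong) (use e in \<open>simp add: indicator_def\<close>)
        finally show "emeasure lebesgue (g ` ?D k) = (\<integral>\<^sup>+x. ennreal (h x) * indicator (?D k) x \<partial>lborel)" .
      qed
      have "emeasure ?M Z = (\<integral>\<^sup>+x. ennreal (h x) * indicator (g0 -` Z) x \<partial>lborel)"
        using gZ by (simp add: emeasure_distr emeasure_density)
      also have "\<dots> = (\<integral>\<^sup>+x. (\<Sum>k. ennreal (h x) * indicator (?D k) x) \<partial>lborel)"
      proof (rule nn_integral_cong)
        fix x
        have "disjoint_family ?D" using D(6) unfolding disjoint_family_on_def by blast
        then have "(\<Sum>k. ennreal (h x) * indicator (?D k) x) = ennreal (h x) * indicator (\<Union>k. ?D k) x"
          by (simp only: ennreal_suminf_cmult suminf_indicator)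
        also have "\<dots> = ennreal (h x) * indicator (g0 -` Z) x"
        proof -
          have "(\<Union>k. ?D k) = {x \<in> S. det (A x) \<noteq> 0} \<inter> g0 -` Z" using D(7) by blast
          then show ?thesis by (auto simp: h_def indicator_def)
        qed
        finally show "ennreal (h x) * indicator (g0 -` Z) x = (\<Sum>k. ennreal (h x) * indicator (?D k) x)" ..
      qed
      also have "\<dots> = (\<Sum>k. \<integral>\<^sup>+x. ennreal (h x) * indicator (?D k) x \<partial>lborel)"
        by (rule nn_integral_suminf) measurable
      also have "\<dots> = (\<Sum>k. \<integral>\<^sup>+z. indicator (g ` ?D k) z \<partial>lebesgue)"
        by (simp add: img)
      also have "\<dots> = (\<integral>\<^sup>+z. (\<Sum>k. indicator (g ` ?D k) z) \<partial>lebesgue)"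
        by (rule nn_integral_suminf[symmetric]) (use img(1) in auto)
      also have "\<dots> \<le> (\<integral>\<^sup>+z. of_nat l * indicator Z z \<partial>lebesgue)"
      proof (rule nn_integral_mono_AE)
        have "AE z in lebesgue. finite {x \<in> S. g x = z} \<and> card {x \<in> S. g x = z} \<le> l"
          using mult unfolding generic_multiplicity_le_def by (rule AE_completion)
        then show "AE z in lebesgue. (\<Sum>k. indicator (g ` ?D k) z) \<le> (of_nat l * indicator Z z :: ennreal)"
        proof eventually_elim
          case (elim z)
          have "(\<Sum>k. indicator (g ` ?D k) z :: ennreal) \<le> of_nat (card {x \<in> S. g x = z}) * indicator Z z"
            unfolding Deq using elim D(4,6) by (intro sum_image_indicator_le_card) auto
          also have "\<dots> \<le> of_nat l * indicator Z z" using elim by (intro mult_right_mono) auto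
          finally show ?case .
        qed
      qed
      also have "\<dots> = emeasure ?L Z"
        by (subst nn_integral_cmult_indicator) auto
      finally show ?thesis .
    qed
  qed
  then have "nn_integral ?M F \<le> nn_integral ?L F"
    by (intro nn_integral_mono_measure) auto
  moreover have "nn_integral ?M F = (\<integral>\<^sup>+x. F (g x) * ennreal \<bar>det (A x)\<bar> * indicator S x \<partial>lborel)"
  proof -
    have "nn_integral ?M F = (\<integral>\<^sup>+x. ennreal (h x) * F (g0 x) \<partial>lborel)"
      by (subst nn_integral_distr, measurable) (subst nn_integral_density, measurable)
    also have "\<dots> = (\<integral>\<^sup>+x. F (g x) * ennreal \<bar>det (A x)\<bar> * indicator S x \<partial>lborel)"
      by (intro nn_integral_cong) (simp add: h_def g0_def indicator_def mult_ac)
    finally show ?thesis .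
  qed
  moreover have "nn_integral ?L F = of_nat l * (\<integral>\<^sup>+z. F z \<partial>lborel)"
    by (simp add: nn_integral_scale_measure)
  ultimately show ?thesis by simp
qed

text \<open>
  A well-ordered index type with as many elements as \<open>'a\<close>, since the change of variables formula for
  \<open>real^'m\<close> presupposes an ordered index type.
\<close>

typedef ('a::finite) idx = "{..<CARD('a)}"
  by (rule exI[of _ 0]) simp

instantiation idx :: (finite) "{finite, wellorder}"
begin

definition "x \<le> y \<longleftrightarrow> Rep_idx x \<le> Rep_idx y"
definition "x < y \<longleftrightarrow> Rep_idx x < Rep_idx y"

instance
proof
  show "finite (UNIV :: 'a idx set)"
    unfolding type_definition.univ[OF type_definition_idx] by simp
  show "P a" if "\<And>x. (\<And>y. y < x \<Longrightarrow> P y) \<Longrightarrow> P x" for P and a :: "'a idx"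
    by (induction a rule: measure_induct_rule[where f=Rep_idx]) (use that in \<open>simp add: less_idx_def\<close>)
qed (auto simp: less_eq_idx_def less_idx_def Rep_idx_inject)

end

lemma card_idx: "CARD('a::finite idx) = CARD('a)"
  by (simp add: type_definition.card[OF type_definition_idx])

text \<open>
  Conjugation by a bijection of the index types matches the permutations in the two expansions
  and preserves their signs.
\<close>

lemma det_reindex:
  fixes b :: "'m::finite \<Rightarrow> 'n::finite" and A :: "real^'n^'n"
  assumes b: "bij b"
  shows "det (\<chi> i j. A $ b i $ b j :: real^'m^'m) = det A"
proof -
  let ?q = "\<lambda>p. b \<circ> p \<circ> inv b"
  have bi[simp]: "inv b (b i) = i" "b (inv b k) = k" for i k
    using b by (simp_all add: bij_is_inj bij_is_surj surj_f_inv_f)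
  have q: "bij_betw ?q {p. p permutes (UNIV :: 'm set)} {p. p permutes (UNIV :: 'n set)}"
  proof (rule bij_betw_byWitness[where f'="\<lambda>p. inv b \<circ> p \<circ> b"])
    show "?q ` {p. p permutes UNIV} \<subseteq> {p. p permutes UNIV}"
      using b by (auto intro!: bij_imp_permutes bij_comp bij_imp_bij_inv dest: permutes_bij)
    show "(\<lambda>p. inv b \<circ> p \<circ> b) ` {p. p permutes UNIV} \<subseteq> {p. p permutes UNIV}"
      using b by (auto intro!: bij_imp_permutes bij_comp bij_imp_bij_inv dest: permutes_bij)
  qed (auto simp: fun_eq_iff)
  have sign: "sign (?q p) = sign p" if "p permutes UNIV" for p
  proof -
    have "map_permutation UNIV b p = ?q p"
      using b by (simp add: map_permutation_def restrict_id_def fun_eq_iff bij_is_surj)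
    then show ?thesis
      using sign_map_permutation[of b UNIV p] that b by (simp add: bij_is_inj)
  qed
  have "det A = (\<Sum>p | p permutes UNIV. of_int (sign (?q p)) * (\<Prod>i\<in>UNIV. A $ i $ ?q p i))"
    unfolding det_def by (rule sum.reindex_bij_betw[OF q, symmetric])
  also have "\<dots> = (\<Sum>p | p permutes UNIV. of_int (sign p) * (\<Prod>i\<in>UNIV. A $ b i $ b (p i)))"
  proof (intro sum.cong refl)
    fix p :: "'m \<Rightarrow> 'm" assume "p \<in> {p. p permutes UNIV}"
    moreover have "(\<Prod>i\<in>UNIV. A $ i $ ?q p i) = (\<Prod>i\<in>UNIV. A $ b i $ ?q p (b i))"
      using b by (rule prod.reindex_bij_betw[symmetric])
    ultimately show "of_int (sign (?q p)) * (\<Prod>i\<in>UNIV. A $ i $ ?q p i) = of_int (sign p) * (\<Prod>i\<in>UNIV. A $ b i $ b (p i))"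
      using sign by simp
  qed
  also have "\<dots> = det (\<chi> i j. A $ b i $ b j :: real^'m^'m)"
    by (simp add: det_def)
  finally show ?thesis ..
qed

lemma measurable_det_integrand:
  fixes g :: "real^'n \<Rightarrow> real^'n" and A :: "real^'n \<Rightarrow> real^'n^'n"
  assumes S: "open S" and g: "continuous_on S g" and A: "continuous_on S A"
    and F[measurable]: "F \<in> borel_measurable borel"
  shows "(\<lambda>x. F (g x) * ennreal \<bar>det (A x)\<bar> * indicator S x) \<in> borel_measurable borel"
proof -
  have [measurable]: "S \<in> sets borel" using S by simp
  have [measurable]: "(\<lambda>x. indicator S x *\<^sub>R g x) \<in> borel_measurable borel"
    using g by (intro borel_measurable_continuous_on_indicator) auto
  have [measurable]: "(\<lambda>x. indicator S x *\<^sub>R \<bar>det (A x)\<bar>) \<in> borel_measurable borel"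
    by (intro borel_measurable_continuous_on_indicator continuous_intros continuous_on_det A) auto
  have "(\<lambda>x. F (indicator S x *\<^sub>R g x) * ennreal (indicator S x *\<^sub>R \<bar>det (A x)\<bar>)) \<in> borel_measurable borel"
    by measurable
  also have "(\<lambda>x. F (indicator S x *\<^sub>R g x) * ennreal (indicator S x *\<^sub>R \<bar>det (A x)\<bar>))
      = (\<lambda>x. F (g x) * ennreal \<bar>det (A x)\<bar> * indicator S x)"
    by (auto simp: fun_eq_iff indicator_def)
  finally show ?thesis .
qed

text \<open>
  The change of variables for an arbitrary finite index type: the variables are renamed by a
  bijection with an index type that carries a well-order.
\<close>

lemma nn_integral_det_multiplicity:
  fixes g :: "real^'n \<Rightarrow> real^'n" and A :: "real^'n \<Rightarrow> real^'n^'n"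
  assumes S: "open S"
    and der: "\<And>x. x \<in> S \<Longrightarrow> (g has_derivative (\<lambda>v. A x *v v)) (at x)"
    and cont: "continuous_on S A"
    and mult: "generic_multiplicity_le S g l"
    and F[measurable]: "F \<in> borel_measurable borel"
  shows "(\<integral>\<^sup>+x. F (g x) * ennreal \<bar>det (A x)\<bar> * indicator S x \<partial>lborel) \<le> of_nat l * (\<integral>\<^sup>+z. F z \<partial>lborel)"
proof -
  obtain b :: "'n idx \<Rightarrow> 'n" where b: "bij b"
    using finite_same_card_bij[of "UNIV :: 'n idx set" "UNIV :: 'n set"] by (auto simp: card_idx)
  have bi[simp]: "inv b (b i) = i" "b (inv b k) = k" for i k
    using b by (simp_all add: bij_is_inj bij_is_surj surj_f_inv_f)
  define P :: "real^'n \<Rightarrow> real^'n idx" where "P x = (\<chi> i. x $ b i)" for x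
  define R :: "real^'n idx \<Rightarrow> real^'n" where "R y = (\<chi> k. y $ inv b k)" for y
  have PR[simp]: "P (R y) = y" "R (P x) = x" for x y by (simp_all add: P_def R_def vec_eq_iff)
  have lin: "linear P" "linear R"
    by (auto intro!: linearI simp: P_def R_def vec_eq_iff)
  have blin: "bounded_linear P" "bounded_linear R" using lin by (simp_all add: linear_conv_bounded_linear)
  have Rb: "bij_betw R Basis Basis"
  proof (rule bij_betw_byWitness[where f'=P])
    show "R ` Basis \<subseteq> Basis"
    proof
      fix v assume "v \<in> R ` Basis"
      then obtain i where "v = R (axis i 1)" by (auto simp: Basis_vec_def)
      moreover have "R (axis i 1) = axis (b i) 1" by (auto simp: R_def axis_def vec_eq_iff)
      ultimately show "v \<in> Basis" by (simp add: axis_in_Basis_iff)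
    qed
    show "P ` Basis \<subseteq> Basis"
    proof
      fix v assume "v \<in> P ` Basis"
      then obtain i where "v = P (axis i 1)" by (auto simp: Basis_vec_def)
      moreover have "P (axis i 1) = axis (inv b i) 1" by (auto simp: P_def axis_def vec_eq_iff)
      ultimately show "v \<in> Basis" by (simp add: axis_in_Basis_iff)
    qed
  qed auto
  have R: "distr lborel lborel R = lborel"
    using lin(2) Rb by (rule lborel_distr_basis_bij)
  have Rm[measurable]: "R \<in> borel \<rightarrow>\<^sub>M borel"
    by (intro borel_measurable_continuous_onI linear_continuous_on blin)
  define S' where "S' = R -` S"
  define g' where "g' = P \<circ> g \<circ> R"
  define A' :: "real^'n idx \<Rightarrow> real^'n idx^'n idx" where "A' y = (\<chi> i j. A (R y) $ b i $ b j)" for y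
  have contR: "continuous_on U R" for U by (intro linear_continuous_on blin)
  have cg: "continuous_on S g"
    using der by (meson has_derivative_at_withinI has_derivative_continuous_on)
  have "(\<integral>\<^sup>+x. F (g x) * ennreal \<bar>det (A x)\<bar> * indicator S x \<partial>lborel)
      = (\<integral>\<^sup>+y. F (g (R y)) * ennreal \<bar>det (A (R y))\<bar> * indicator S (R y) \<partial>lborel)"
    by (subst R[symmetric], subst nn_integral_distr)
       (auto intro: measurable_det_integrand[OF S cg cont F])
  also have "\<dots> = (\<integral>\<^sup>+y. (F \<circ> R) (g' y) * ennreal \<bar>det (A' y)\<bar> * indicator S' y \<partial>lborel)"
    unfolding A'_def det_reindex[OF b] by (simp add: g'_def S'_def indicator_def)
  also have "\<dots> \<le> of_nat l * (\<integral>\<^sup>+z. (F \<circ> R) z \<partial>lborel)"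
  proof (rule nn_integral_det_multiplicity_wellorder)
    show "open S'" unfolding S'_def using S contR by (rule open_vimage)
    show "continuous_on S' A'"
      unfolding A'_def
      by (intro continuous_intros continuous_on_compose2[OF cont contR]) (auto simp: S'_def)
    fix y assume y: "y \<in> S'"
    have "(g' has_derivative (\<lambda>v. P (A (R y) *v R v))) (at y)"
      unfolding g'_def comp_assoc[symmetric]
      apply (rule diff_chain_at[where g="P \<circ> g" and f=R and g'="\<lambda>v. P (A (R y) *v v)" and f'=R, unfolded comp_def[of "\<lambda>v. P (A (R y) *v v)"]])
      subgoal by (rule bounded_linear_imp_has_derivative[OF blin(2)])
      subgoal
        apply (rule diff_chain_at[where g=P and f=g and g'=P and f'="\<lambda>v. A (R y) *v v", unfolded comp_def[of P "\<lambda>v. A (R y) *v v"]])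
        subgoal using y by (intro der) (simp add: S'_def)
        subgoal by (rule bounded_linear_imp_has_derivative[OF blin(1)])
        done
      done
    also have "(\<lambda>v. P (A (R y) *v R v)) = (\<lambda>v. A' y *v v)"
    proof
      fix v
      have "(\<Sum>k\<in>UNIV. A (R y) $ b i $ k * v $ inv b k) = (\<Sum>j\<in>UNIV. A (R y) $ b i $ b j * v $ inv b (b j))" for i
        using b by (rule sum.reindex_bij_betw[symmetric])
      then show "P (A (R y) *v R v) = A' y *v v"
        by (simp add: P_def A'_def matrix_vector_mult_def R_def vec_eq_iff)
    qed
    finally show "(g' has_derivative (\<lambda>v. A' y *v v)) (at y)" .
  next
    have "AE z in distr lborel lborel R. finite {x \<in> S. g x = z} \<and> card {x \<in> S. g x = z} \<le> l"
      using mult unfolding R generic_multiplicity_le_def .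
    then have "AE z in lborel. finite {x \<in> S. g x = R z} \<and> card {x \<in> S. g x = R z} \<le> l"
      by (rule AE_distrD[rotated]) measurable
    moreover have "{y \<in> S'. g' y = z} = P ` {x \<in> S. g x = R z}" for z
      by (force simp: S'_def g'_def image_iff)
    ultimately show "generic_multiplicity_le S' g' l"
      unfolding generic_multiplicity_le_def
    proof (elim eventually_mono)
      fix z assume z: "finite {x \<in> S. g x = R z} \<and> card {x \<in> S. g x = R z} \<le> l"
        and e: "\<And>z. {y \<in> S'. g' y = z} = P ` {x \<in> S. g x = R z}"
      then show "finite {y \<in> S'. g' y = z} \<and> card {y \<in> S'. g' y = z} \<le> l"
        unfolding e using card_image_le[of "{x \<in> S. g x = R z}" P] by auto
    qed
  qed measurable
  also have "(\<integral>\<^sup>+z. (F \<circ> R) z \<partial>lborel) = (\<integral>\<^sup>+z. F z \<partial>lborel)"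
  proof -
    have "(\<integral>\<^sup>+z. F z \<partial>lborel) = (\<integral>\<^sup>+z. F z \<partial>distr lborel lborel R)" by (simp add: R)
    also have "\<dots> = (\<integral>\<^sup>+z. (F \<circ> R) z \<partial>lborel)" by (subst nn_integral_distr) (simp_all add: o_def)
    finally show ?thesis ..
  qed
  finally show ?thesis .
qed

text \<open>
  A unimodular affine map is an instance of the change of variables with multiplicity one.
\<close>

lemma emeasure_unimodular_sublevel:
  fixes L :: "real^'n^'n"
  assumes L: "det L = 1" and t: "t \<ge> 0"
  shows "emeasure lborel {x. \<forall>i. \<bar>(L *v (x - c)) $ i\<bar> \<le> t} \<le> ennreal ((2 * t) ^ CARD('n))"
proof -
  let ?Q = "cbox (\<chi> i. - t) (\<chi> i. t) :: (real^'n) set"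
  let ?g = "\<lambda>x. L *v (x - c)"
  have inj: "inj ?g"
  proof (rule injI)
    fix x y assume "L *v (x - c) = L *v (y - c)"
    moreover have "inj ((*v) L)"
      using L by (simp add: inj_matrix_vector_mult invertible_det_nz)
    ultimately have "x - c = y - c" by (simp add: inj_eq)
    then show "x = y" by simp
  qed
  have m: "?g \<in> borel_measurable borel"
    by (intro borel_measurable_continuous_onI linear_continuous_on_compose[OF _ matrix_vector_mul_linear] continuous_intros)
  have s: "{x. \<forall>i. \<bar>(L *v (x - c)) $ i\<bar> \<le> t} = ?g -` ?Q"
    by (auto simp: mem_box_cart abs_le_iff minus_le_iff)
  have "?g -` ?Q \<in> sets borel" using measurable_sets[OF m, of ?Q] by simp
  then have "emeasure lborel {x. \<forall>i. \<bar>(L *v (x - c)) $ i\<bar> \<le> t}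
      = (\<integral>\<^sup>+x. indicator ?Q (?g x) * ennreal \<bar>det L\<bar> * indicator UNIV x \<partial>lborel)"
  proof -
    assume *: "?g -` ?Q \<in> sets borel"
    have "emeasure lborel (?g -` ?Q) = (\<integral>\<^sup>+x. indicator (?g -` ?Q) x \<partial>lborel)"
      using * by (intro nn_integral_indicator[symmetric]) simp
    then show ?thesis unfolding s by (simp add: L indicator_def)
  qed
  also have "\<dots> \<le> of_nat 1 * (\<integral>\<^sup>+z. indicator ?Q z \<partial>lborel)"
  proof (rule nn_integral_det_multiplicity[where A="\<lambda>_. L"])
    show "(?g has_derivative (\<lambda>v. L *v v)) (at x)" for x
      by (auto intro!: derivative_eq_intros bounded_linear.has_derivative[OF matrix_vector_mul_bounded_linear])
    have "finite {x \<in> UNIV. ?g x = y} \<and> card {x \<in> UNIV. ?g x = y} \<le> 1" for y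
    proof (cases "\<exists>x. ?g x = y")
      case True
      then obtain x where "?g x = y" by blast
      then have "{x \<in> UNIV. ?g x = y} = {x}" using injD[OF inj] by auto
      then show ?thesis by simp
    qed auto
    then show "generic_multiplicity_le UNIV ?g 1"
      unfolding generic_multiplicity_le_def by simp
  qed auto
  also have "\<dots> = ennreal ((2 * t) ^ CARD('n))"
  proof -
    have b: "((\<chi> i. t) :: real^'n) \<bullet> b = t" "((\<chi> i. - t) :: real^'n) \<bullet> b = - t" if "b \<in> Basis" for b
      using that by (auto simp: Basis_vec_def inner_axis)
    have "(\<integral>\<^sup>+z. indicator ?Q z \<partial>lborel) = emeasure lborel ?Q" by simp
    also have "\<dots> = ennreal (\<Prod>b\<in>(Basis::(real^'n) set). 2 * t)"
      using t by (subst emeasure_lborel_cbox) (auto simp: b inner_diff_left intro!: prod.cong)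
    finally show ?thesis by simp
  qed
  finally show ?thesis .
qed

section \<open>Unimodular normalisation\<close>

lemma matrix_vector_nth: "(L *v x) $ i = (L $ i) \<bullet> (x::real^'n)"
  by (simp add: matrix_vector_mult_def inner_vec_def)

text \<open>
  The difference quotients of \<open>s \<mapsto> \<integral> |a + s b|\<close> at \<open>0\<close> converge by dominated convergence, because almost
  everywhere \<open>a\<close> has a sign wherever \<open>b\<close> does not vanish. The two choices of \<open>e = 1\<close> and \<open>e = -1\<close>
  give the one-sided derivatives, so that at a minimum the derivative is zero.
\<close>

lemma integral_abs_one_sided_derivative:
  fixes a b :: "'a \<Rightarrow> real"
  assumes a: "integrable M a" and b: "integrable M b" and nz: "AE y in M. b y \<noteq> 0 \<longrightarrow> a y \<noteq> 0"
    and e: "\<bar>e\<bar> = (1::real)"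
    and min: "\<And>s. (LINT y|M. \<bar>a y\<bar>) \<le> (LINT y|M. \<bar>a y + s * b y\<bar>)"
  shows "0 \<le> e * (LINT y|M. sgn (a y) * b y)"
proof -
  have [measurable]: "a \<in> borel_measurable M" "b \<in> borel_measurable M" using a b by auto
  define s :: "nat \<Rightarrow> real" where "s k = inverse (real (Suc k))" for k
  have s: "s k > 0" for k by (simp add: s_def)
  have lim: "(\<lambda>k. LINT y|M. (\<bar>a y + (e * s k) * b y\<bar> - \<bar>a y\<bar>) / s k) \<longlonglongrightarrow> (LINT y|M. e * (sgn (a y) * b y))"
  proof (rule integral_dominated_convergence[where w="\<lambda>y. \<bar>b y\<bar>"])
    show "AE y in M. (\<lambda>k. (\<bar>a y + e * s k * b y\<bar> - \<bar>a y\<bar>) / s k) \<longlonglongrightarrow> e * (sgn (a y) * b y)"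
      using nz
    proof eventually_elim
      case (elim y)
      show ?case
      proof (cases "b y = 0")
        case False
        then have ay: "a y \<noteq> 0" using elim by simp
        have "(\<lambda>k. s k * \<bar>b y\<bar>) \<longlonglongrightarrow> 0 * \<bar>b y\<bar>"
          unfolding s_def by (intro tendsto_intros LIMSEQ_inverse_real_of_nat)
        then have "eventually (\<lambda>k. s k * \<bar>b y\<bar> < \<bar>a y\<bar>) sequentially"
          using ay by (intro order_tendstoD(2)) auto
        then have "eventually (\<lambda>k. (\<bar>a y + e * s k * b y\<bar> - \<bar>a y\<bar>) / s k = e * (sgn (a y) * b y)) sequentially"
        proof eventually_elim
          case (elim k)
          have "\<bar>e * s k * b y\<bar> = s k * \<bar>b y\<bar>" using e s[of k] by (simp add: abs_mult)
          with elim have "\<bar>e * s k * b y\<bar> < \<bar>a y\<bar>" by simp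
          then have "\<bar>a y + e * s k * b y\<bar> - \<bar>a y\<bar> = sgn (a y) * (e * s k * b y)"
            by (cases "a y > 0") (auto simp: sgn_if)
          then show ?case using s[of k] by simp
        qed
        then show ?thesis by (rule tendsto_eventually)
      qed simp
    qed
    show "AE y in M. norm ((\<bar>a y + e * s k * b y\<bar> - \<bar>a y\<bar>) / s k) \<le> \<bar>b y\<bar>" for k
    proof (rule AE_I2)
      fix y
      have "\<bar>\<bar>a y + e * s k * b y\<bar> - \<bar>a y\<bar>\<bar> \<le> \<bar>e * s k * b y\<bar>" by simp
      also have "\<dots> = s k * \<bar>b y\<bar>" using e s[of k] by (simp add: abs_mult)
      finally show "norm ((\<bar>a y + e * s k * b y\<bar> - \<bar>a y\<bar>) / s k) \<le> \<bar>b y\<bar>"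
        using s[of k] by (simp add: abs_divide divide_le_eq mult.commute)
    qed
  qed (use b in auto)
  have "0 \<le> (LINT y|M. (\<bar>a y + (e * s k) * b y\<bar> - \<bar>a y\<bar>) / s k)" for k
  proof -
    have "(LINT y|M. (\<bar>a y + (e * s k) * b y\<bar> - \<bar>a y\<bar>) / s k)
       = ((LINT y|M. \<bar>a y + (e * s k) * b y\<bar>) - (LINT y|M. \<bar>a y\<bar>)) / s k"
      using a b by (subst integral_divide_zero, subst Bochner_Integration.integral_diff) auto
    then show ?thesis using min[of "e * s k"] s[of k] by simp
  qed
  with lim have "0 \<le> (LINT y|M. e * (sgn (a y) * b y))"
    by (intro LIMSEQ_le_const) auto
  then show ?thesis by simp
qed

text \<open>
  If the matrix of integrals is diagonal, the product of its diagonal entries is its determinant.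
  Expanding the determinant and applying Fubini to each product turns it into the integral of the
  determinant with the \<open>i\<close>-th row evaluated at the \<open>i\<close>-th variable.
\<close>

lemma prod_le_integral_det:
  fixes F :: "'n::finite \<Rightarrow> 'n \<Rightarrow> 'a::euclidean_space \<Rightarrow> real"
  assumes int: "\<And>i j. integrable lborel (F i j)"
    and off: "\<And>i j. i \<noteq> j \<Longrightarrow> (LINT y|lborel. F i j y) = 0"
    and nn: "\<And>i. 0 \<le> (LINT y|lborel. F i i y)"
  shows "ennreal (\<Prod>i\<in>UNIV. LINT y|lborel. F i i y)
     \<le> (\<integral>\<^sup>+y. ennreal \<bar>det (\<chi> i j. F i j (y $ i))\<bar> \<partial>lborel)"
proof -
  let ?M = "\<chi> i j. LINT y|lborel. F i j y"
  have int': "integrable lborel (\<lambda>y::'a^'n. of_int (sign p) * (\<Prod>i\<in>UNIV. F i (p i) (y $ i)))" for p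
    by (intro integrable_mult_right integrable_prod_vec int)
  have "(\<Prod>i\<in>UNIV. LINT y|lborel. F i i y) = det ?M"
    by (subst det_diagonal) (simp_all add: off)
  also have "\<dots> = (\<Sum>p | p permutes UNIV. of_int (sign p) * (\<Prod>i\<in>UNIV. LINT y|lborel. F i (p i) y))"
    by (simp add: det_def)
  also have "\<dots> = (\<Sum>p | p permutes UNIV. LINT y|lborel. of_int (sign p) * (\<Prod>i\<in>UNIV. F i (p i) (y $ i)))"
    by (simp add: integral_prod_vec[OF int])
  also have "\<dots> = (LINT y|lborel. (\<Sum>p | p permutes UNIV. of_int (sign p) * (\<Prod>i\<in>UNIV. F i (p i) (y $ i))))"
    using int' by (subst Bochner_Integration.integral_sum) auto
  also have "\<dots> = (LINT y|lborel. det (\<chi> i j. F i j (y $ i)))"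
    by (simp add: det_def)
  finally have eq: "(\<Prod>i\<in>UNIV. LINT y|lborel. F i i y) = (LINT y|lborel. det (\<chi> i j. F i j (y $ i)))" .
  have intd: "integrable lborel (\<lambda>y. det (\<chi> i j. F i j (y $ i)))"
    unfolding det_def using int' by simp
  have "ennreal (\<Prod>i\<in>UNIV. LINT y|lborel. F i i y) \<le> ennreal (LINT y|lborel. \<bar>det (\<chi> i j. F i j (y $ i))\<bar>)"
    unfolding eq by (intro ennreal_leI integral_mono intd integrable_abs) auto
  also have "\<dots> = (\<integral>\<^sup>+y. ennreal \<bar>det (\<chi> i j. F i j (y $ i))\<bar> \<partial>lborel)"
    by (rule nn_integral_eq_integral[symmetric]) (auto intro: integrable_abs intd)
  finally show ?thesis .
qed

text \<open>
  Homogeneity and compactness of the sphere make the sum coercive, so that the minimum over the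
  closed set of unimodular matrices is attained.
\<close>

lemma unimodular_minimiser:
  fixes J :: "real^'n \<Rightarrow> real"
  assumes cont: "continuous_on UNIV J" and pos: "\<And>l. l \<noteq> 0 \<Longrightarrow> 0 < J l"
    and hom: "\<And>c l. J (c *\<^sub>R l) = \<bar>c\<bar> * J l"
  obtains L :: "real^'n^'n" where "det L = 1"
    "\<And>L'. det L' = 1 \<Longrightarrow> (\<Sum>i\<in>UNIV. J (L $ i)) \<le> (\<Sum>i\<in>UNIV. J (L' $ i))"
proof -
  let ?\<Phi> = "\<lambda>L::real^'n^'n. \<Sum>i\<in>UNIV. J (L $ i)"
  obtain c where c: "c > 0" "\<And>l. c * norm l \<le> J l"
  proof -
    have ne: "sphere (0::real^'n) 1 \<noteq> {}" by simp
    obtain u where u: "u \<in> sphere 0 1" "\<And>v. v \<in> sphere 0 1 \<Longrightarrow> J u \<le> J v"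
      using continuous_attains_inf[OF compact_sphere ne continuous_on_subset[OF cont]] by auto
    show thesis
    proof (rule that[of "J u"])
      show "J u > 0" using u(1) by (intro pos) auto
      fix l :: "real^'n"
      show "J u * norm l \<le> J l"
      proof (cases "l = 0")
        case False
        have "J u \<le> J ((1 / norm l) *\<^sub>R l)" using False by (intro u(2)) simp
        also have "\<dots> = J l / norm l" by (simp add: hom)
        finally show ?thesis using False by (simp add: field_simps)
      qed (use hom[of 0 0] in simp)
    qed
  qed
  have coerc: "c * norm L \<le> ?\<Phi> L" for L :: "real^'n^'n"
  proof -
    have "norm L \<le> (\<Sum>i\<in>UNIV. norm (L $ i))" unfolding norm_vec_def by (rule L2_set_le_sum) simp
    then have "c * norm L \<le> c * (\<Sum>i\<in>UNIV. norm (L $ i))" using c(1) by simp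
    also have "\<dots> \<le> ?\<Phi> L" unfolding sum_distrib_left by (intro sum_mono c(2))
    finally show ?thesis .
  qed
  \<comment> \<open>Outside of this ball the sum exceeds its value at the identity matrix.\<close>
  let ?K = "{L::real^'n^'n. det L = 1} \<inter> cball 0 (?\<Phi> (mat 1) / c)"
  have "closed {L::real^'n^'n. det L = 1}"
    by (intro closed_Collect_eq continuous_on_det continuous_intros)
  then have K: "compact ?K" by (intro closed_Int_compact) auto
  have m1: "mat 1 \<in> ?K" using coerc[of "mat 1"] c(1) by (simp add: field_simps)
  have "continuous_on ?K ?\<Phi>"
    by (intro continuous_intros continuous_on_compose2[OF cont]) auto
  with K m1 obtain L where L: "L \<in> ?K" "\<And>L'. L' \<in> ?K \<Longrightarrow> ?\<Phi> L \<le> ?\<Phi> L'"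
    using continuous_attains_inf[of ?K ?\<Phi>] by blast
  show thesis
  proof (rule that[of L])
    show "det L = 1" using L(1) by simp
    fix L' :: "real^'n^'n" assume d: "det L' = 1"
    show "?\<Phi> L \<le> ?\<Phi> L'"
    proof (cases "L' \<in> ?K")
      case False
      then have "?\<Phi> (mat 1) / c < norm L'" using d by simp
      then have "?\<Phi> (mat 1) < c * norm L'" using c(1) by (simp add: field_simps)
      with coerc[of L'] L(2)[OF m1] show ?thesis by simp
    qed (use L(2) in auto)
  qed
qed

text \<open>
  The minimiser \<open>L0\<close> of \<open>\<Sum>_i \<integral> \<kappa> |(L \<psi>)_i|\<close> can be perturbed by adding a multiple of one row to another,
  which does not change the determinant. Hence the integrals of \<open>\<kappa> sgn((L0 \<psi>)_i) (L0 \<psi>)_j\<close> vanish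
  for \<open>i \<noteq> j\<close> and \<open>prod_le_integral_det\<close> applies. Nondegeneracy of \<open>\<psi>\<close> on hyperplanes provides both
  the coercivity and the differentiability. Finally the rows of \<open>L0\<close> are rescaled, preserving the
  determinant, to make all the integrals equal to their geometric mean \<open>m\<close>.
\<close>

lemma unimodular_normalisation:
  fixes \<psi> :: "'a::euclidean_space \<Rightarrow> real^'n" and \<kappa> :: "'a \<Rightarrow> real"
  assumes \<kappa>0: "\<And>y. 0 \<le> \<kappa> y" and \<kappa>[measurable]: "\<kappa> \<in> borel_measurable borel"
    and \<psi>[measurable]: "\<psi> \<in> borel_measurable borel"
    and int: "integrable lborel (\<lambda>y. \<kappa> y * norm (\<psi> y))"
    and nondeg: "\<And>l. l \<noteq> 0 \<Longrightarrow> AE y in lborel. \<kappa> y \<noteq> 0 \<longrightarrow> l \<bullet> \<psi> y \<noteq> 0"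
    and pos: "\<not> (AE y in lborel. \<kappa> y = 0)"
  obtains L m where "det L = 1" "m > 0"
    "\<And>i. integrable lborel (\<lambda>y. \<kappa> y * \<bar>(L *v \<psi> y) $ i\<bar>)"
    "\<And>i. (LINT y|lborel. \<kappa> y * \<bar>(L *v \<psi> y) $ i\<bar>) = m"
    "ennreal (m ^ CARD('n)) \<le> (\<integral>\<^sup>+y. (\<Prod>i\<in>UNIV. ennreal (\<kappa> (y $ i))) * ennreal \<bar>det (\<chi> i. \<psi> (y $ i))\<bar> \<partial>lborel)"
proof -
  have intl: "integrable lborel (\<lambda>y. \<kappa> y * (l \<bullet> \<psi> y))" for l
  proof (rule Bochner_Integration.integrable_bound[OF integrable_mult_right[OF int, of "norm l"]])
    show "AE y in lborel. norm (\<kappa> y * (l \<bullet> \<psi> y)) \<le> norm (norm l * (\<kappa> y * norm (\<psi> y)))"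
    proof (rule AE_I2)
      fix y
      have "\<kappa> y * \<bar>l \<bullet> \<psi> y\<bar> \<le> \<kappa> y * (norm l * norm (\<psi> y))"
        by (intro mult_left_mono Cauchy_Schwarz_ineq2 \<kappa>0)
      then show "norm (\<kappa> y * (l \<bullet> \<psi> y)) \<le> norm (norm l * (\<kappa> y * norm (\<psi> y)))"
        using \<kappa>0[of y] by (simp add: abs_mult mult_ac)
    qed
  qed measurable
  define J where "J l = (LINT y|lborel. \<bar>\<kappa> y * (l \<bullet> \<psi> y)\<bar>)" for l
  have J0: "0 \<le> J l" for l unfolding J_def by simp
  have hom: "J (c *\<^sub>R l) = \<bar>c\<bar> * J l" for c l
  proof -
    have "J (c *\<^sub>R l) = (LINT y|lborel. \<bar>c\<bar> * \<bar>\<kappa> y * (l \<bullet> \<psi> y)\<bar>)"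
      unfolding J_def by (intro Bochner_Integration.integral_cong refl) (simp add: abs_mult)
    then show ?thesis by (simp add: J_def)
  qed
  have tri: "J (l + l') \<le> J l + J l'" for l l'
    unfolding J_def
    by (subst Bochner_Integration.integral_add[symmetric])
       (auto intro!: integral_mono integrable_abs intl simp: inner_add_left distrib_left)
  define C where "C = (LINT y|lborel. \<kappa> y * norm (\<psi> y))"
  have bound: "J l \<le> C * norm l" for l
  proof -
    have "J l \<le> (LINT y|lborel. (\<kappa> y * norm (\<psi> y)) * norm l)"
      unfolding J_def
    proof (rule integral_mono)
      fix y
      have "\<kappa> y * \<bar>l \<bullet> \<psi> y\<bar> \<le> \<kappa> y * (norm l * norm (\<psi> y))"
        by (intro mult_left_mono Cauchy_Schwarz_ineq2 \<kappa>0)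
      then show "\<bar>\<kappa> y * (l \<bullet> \<psi> y)\<bar> \<le> (\<kappa> y * norm (\<psi> y)) * norm l"
        using \<kappa>0[of y] by (simp add: abs_mult mult_ac)
    qed (use intl int in auto)
    then show ?thesis by (simp add: C_def)
  qed
  have C0: "0 \<le> C" unfolding C_def using \<kappa>0 by simp
  have cont: "continuous_on UNIV J"
  proof (rule continuous_onI)
    fix l :: "real^'n" and e :: real assume e: "e > 0"
    show "\<exists>d>0. \<forall>l'\<in>UNIV. dist l' l < d \<longrightarrow> dist (J l') (J l) \<le> e"
    proof (intro exI[of _ "e / (C + 1)"] conjI ballI impI)
      show "0 < e / (C + 1)" using e C0 by simp
      fix l' assume d: "dist l' l < e / (C + 1)"
      have "J l' \<le> J l + J (l' - l)" using tri[of l "l' - l"] by simp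
      moreover have "J l \<le> J l' + J (l - l')" using tri[of l' "l - l'"] by simp
      moreover have "J (l' - l) = J (l - l')" using hom[of "-1" "l - l'"] by simp
      ultimately have "\<bar>J l' - J l\<bar> \<le> C * norm (l' - l)" using bound[of "l' - l"] by linarith
      also have "\<dots> \<le> (C + 1) * norm (l' - l)" by (intro mult_right_mono) auto
      also have "\<dots> \<le> (C + 1) * (e / (C + 1))" using d C0 by (intro mult_left_mono) (auto simp: dist_norm)
      also have "\<dots> = e" using C0 by simp
      finally show "dist (J l') (J l) \<le> e" by (simp add: dist_real_def)
    qed
  qed
  have posJ: "0 < J l" if "l \<noteq> 0" for l
  proof (rule ccontr)
    assume "\<not> 0 < J l"
    then have "J l = 0" using J0[of l] by simp
    then have "AE y in lborel. \<bar>\<kappa> y * (l \<bullet> \<psi> y)\<bar> = 0"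
      unfolding J_def by (subst (asm) integral_nonneg_eq_0_iff_AE) (auto intro: intl)
    with nondeg[OF that] have "AE y in lborel. \<kappa> y = 0" by eventually_elim auto
    with pos show False by simp
  qed
  obtain L0 :: "real^'n^'n" where L0: "det L0 = 1"
    "\<And>L'. det L' = 1 \<Longrightarrow> (\<Sum>i\<in>UNIV. J (L0 $ i)) \<le> (\<Sum>i\<in>UNIV. J (L' $ i))"
    using unimodular_minimiser[OF cont posJ hom] by blast
  have row: "L0 $ i \<noteq> 0" for i
  proof
    assume "L0 $ i = 0"
    then have "det L0 = 0" by (intro det_zero_row[of i]) (simp add: row_def vec_eq_iff)
    then show False using L0(1) by simp
  qed
  define F where "F i j y = \<kappa> y * sgn (L0 $ i \<bullet> \<psi> y) * (L0 $ j \<bullet> \<psi> y)" for i j y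
  have [measurable]: "F i j \<in> borel_measurable borel" for i j
    unfolding F_def[abs_def] by measurable
  have Fint: "integrable lborel (F i j)" for i j
    by (rule Bochner_Integration.integrable_bound[OF intl[of "L0 $ j"]])
       (auto simp: F_def abs_mult sgn_if)
  have F': "F i j y = sgn (\<kappa> y * (L0 $ i \<bullet> \<psi> y)) * (\<kappa> y * (L0 $ j \<bullet> \<psi> y))" for i j y
    using \<kappa>0[of y] by (cases "\<kappa> y = 0") (simp_all add: F_def sgn_mult)
  have off: "(LINT y|lborel. F i j y) = 0" if ij: "i \<noteq> j" for i j
  proof -
    have "0 \<le> e * (LINT y|lborel. sgn (\<kappa> y * (L0 $ i \<bullet> \<psi> y)) * (\<kappa> y * (L0 $ j \<bullet> \<psi> y)))" if e: "\<bar>e\<bar> = 1" for e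
    proof (rule integral_abs_one_sided_derivative[OF intl intl _ e])
      show "AE y in lborel. \<kappa> y * (L0 $ j \<bullet> \<psi> y) \<noteq> 0 \<longrightarrow> \<kappa> y * (L0 $ i \<bullet> \<psi> y) \<noteq> 0"
        using nondeg[OF row[of i]] by eventually_elim auto
      fix s
      \<comment> \<open>The competitor: a row operation of determinant 1.\<close>
      let ?L' = "\<chi> k. if k = i then row i L0 + s *s row j L0 else row k L0"
      have r: "row k L0 = L0 $ k" for k by (simp add: row_def vec_eq_iff)
      have "det ?L' = 1" using det_row_operation[OF ij, of L0 s] L0(1) by simp
      then have "(\<Sum>k\<in>UNIV. J (L0 $ k)) \<le> (\<Sum>k\<in>UNIV. J (?L' $ k))" by (rule L0(2))
      also have "(\<Sum>k\<in>UNIV. J (?L' $ k)) = J (L0 $ i + s *\<^sub>R (L0 $ j)) + (\<Sum>k\<in>UNIV - {i}. J (L0 $ k))"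
        by (subst sum.remove[of _ i]) (auto simp: r scalar_mult_eq_scaleR intro!: sum.cong)
      also have "(\<Sum>k\<in>UNIV. J (L0 $ k)) = J (L0 $ i) + (\<Sum>k\<in>UNIV - {i}. J (L0 $ k))"
        by (subst sum.remove[of _ i]) auto
      finally have "J (L0 $ i) \<le> J (L0 $ i + s *\<^sub>R (L0 $ j))" by simp
      then show "(LINT y|lborel. \<bar>\<kappa> y * (L0 $ i \<bullet> \<psi> y)\<bar>)
          \<le> (LINT y|lborel. \<bar>\<kappa> y * (L0 $ i \<bullet> \<psi> y) + s * (\<kappa> y * (L0 $ j \<bullet> \<psi> y))\<bar>)"
        by (simp add: J_def inner_add_left distrib_left mult_ac)
    qed
    from this[of 1] this[of "-1"] show ?thesis by (simp add: F')
  qed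
  have diag: "(LINT y|lborel. F i i y) = J (L0 $ i)" for i
    unfolding J_def F' by (intro Bochner_Integration.integral_cong refl) (simp add: sgn_mult_self_eq abs_sgn mult.commute)
  define P where "P = (\<Prod>i\<in>UNIV. J (L0 $ i))"
  have Jp: "J (L0 $ i) > 0" for i using posJ row by blast
  have P: "P > 0" unfolding P_def by (intro prod_pos) (use Jp in auto)
  define m where "m = root CARD('n) P"
  have m: "m > 0" "m ^ CARD('n) = P" using P by (simp_all add: m_def)
  define L :: "real^'n^'n" where "L = (\<chi> i. (m / J (L0 $ i)) *s (L0 $ i))"
  have Li: "L $ i = (m / J (L0 $ i)) *\<^sub>R (L0 $ i)" for i
    by (simp add: L_def scalar_mult_eq_scaleR)
  have detL: "det L = 1"
  proof -
    have "det L = (\<Prod>i\<in>UNIV. m / J (L0 $ i)) * det (\<chi> i. L0 $ i)"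
      unfolding L_def by (rule det_rows_mul)
    also have "(\<chi> i. L0 $ i) = L0" by (simp add: vec_eq_iff)
    also have "(\<Prod>i\<in>UNIV. m / J (L0 $ i)) = m ^ CARD('n) / P"
      by (simp add: prod_dividef P_def)
    finally show ?thesis using L0(1) m(2) P by simp
  qed
  show thesis
  proof (rule that[of L m])
    show "det L = 1" "m > 0" by fact+
    have eq: "\<kappa> y * \<bar>(L *v \<psi> y) $ i\<bar> = \<bar>\<kappa> y * (L $ i \<bullet> \<psi> y)\<bar>" for i y
      using \<kappa>0[of y] by (simp add: matrix_vector_nth abs_mult)
    show "integrable lborel (\<lambda>y. \<kappa> y * \<bar>(L *v \<psi> y) $ i\<bar>)" for i
      unfolding eq by (intro integrable_abs intl)
    have "J (L $ i) = m" for i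
      unfolding Li hom using Jp[of i] m(1) by simp
    then show "(LINT y|lborel. \<kappa> y * \<bar>(L *v \<psi> y) $ i\<bar>) = m" for i
      unfolding eq J_def .
    have "ennreal (m ^ CARD('n)) = ennreal (\<Prod>i\<in>UNIV. LINT y|lborel. F i i y)"
      by (simp add: m(2) P_def diag)
    also have "\<dots> \<le> (\<integral>\<^sup>+y. ennreal \<bar>det (\<chi> i j. F i j (y $ i))\<bar> \<partial>lborel)"
      using Jp by (intro prod_le_integral_det Fint off) (auto simp: diag less_imp_le)
    also have "\<dots> \<le> (\<integral>\<^sup>+y. (\<Prod>i\<in>UNIV. ennreal (\<kappa> (y $ i))) * ennreal \<bar>det (\<chi> i. \<psi> (y $ i))\<bar> \<partial>lborel)"
    proof (rule nn_integral_mono)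
      fix y :: "'a^'n"
      let ?A = "(\<chi> i. \<psi> (y $ i)) ** transpose L0"
      let ?c = "\<lambda>i. \<kappa> (y $ i) * sgn (L0 $ i \<bullet> \<psi> (y $ i))"
      have "(\<chi> i j. F i j (y $ i)) = (\<chi> i. ?c i *s (?A $ i))"
        by (simp add: vec_eq_iff F_def matrix_matrix_mult_def transpose_def inner_vec_def sum_distrib_left mult_ac)
      then have "det (\<chi> i j. F i j (y $ i)) = (\<Prod>i\<in>UNIV. ?c i) * det (\<chi> i. ?A $ i)"
        by (simp only: det_rows_mul)
      also have "(\<chi> i. ?A $ i) = ?A" by (simp add: vec_eq_iff)
      also have "det ?A = det (\<chi> i. \<psi> (y $ i))" by (simp add: det_mul L0(1))
      finally have "\<bar>det (\<chi> i j. F i j (y $ i))\<bar> = (\<Prod>i\<in>UNIV. \<bar>?c i\<bar>) * \<bar>det (\<chi> i. \<psi> (y $ i))\<bar>"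
        by (simp add: abs_mult abs_prod)
      also have "\<dots> \<le> (\<Prod>i\<in>UNIV. \<kappa> (y $ i)) * \<bar>det (\<chi> i. \<psi> (y $ i))\<bar>"
        using \<kappa>0 by (intro mult_right_mono prod_mono) (auto simp: abs_mult sgn_if)
      finally show "ennreal \<bar>det (\<chi> i j. F i j (y $ i))\<bar>
          \<le> (\<Prod>i\<in>UNIV. ennreal (\<kappa> (y $ i))) * ennreal \<bar>det (\<chi> i. \<psi> (y $ i))\<bar>"
        using \<kappa>0 by (simp add: prod_ennreal prod_nonneg flip: ennreal_mult)
    qed
    finally show "ennreal (m ^ CARD('n)) \<le> (\<integral>\<^sup>+y. (\<Prod>i\<in>UNIV. ennreal (\<kappa> (y $ i))) * ennreal \<bar>det (\<chi> i. \<psi> (y $ i))\<bar> \<partial>lborel)" .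
  qed
qed

section \<open>Sublevel sets, dyadic sums and powers of integrals\<close>

lemma dyadic_bracket_below:
  fixes g r :: real
  assumes "0 < g" "g \<le> r"
  obtains j where "g \<le> r * (1/2) ^ j" "r * (1/2) ^ Suc j < g"
proof -
  have ex: "\<exists>j. r * (1/2) ^ Suc j < g"
  proof -
    have "0 < g / r" using assms by simp
    then obtain j where "(1/2) ^ j < g / r" using real_arch_pow_inv[of "g / r" "1/2"] by auto
    moreover have "(1/2::real) ^ Suc j \<le> (1/2) ^ j" by simp
    ultimately have "(1/2) ^ Suc j < g / r" by linarith
    then have "r * (1/2) ^ Suc j < g" using assms by (simp add: field_simps)
    then show ?thesis ..
  qed
  define j where "j = (LEAST j. r * (1/2) ^ Suc j < g)"
  have "r * (1/2) ^ Suc j < g" unfolding j_def using ex by (rule LeastI_ex)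
  moreover have "g \<le> r * (1/2) ^ j"
  proof (cases j)
    case 0
    then show ?thesis using assms by simp
  next
    case (Suc k)
    then have "k < j" by simp
    then have "\<not> (r * (1/2) ^ Suc k < g)" unfolding j_def by (rule not_less_Least)
    then show ?thesis using Suc by simp
  qed
  ultimately show thesis using that by blast
qed

lemma dyadic_bracket_above:
  fixes g r :: real
  assumes "0 < r" "r < g"
  obtains j where "r * 2 ^ j < g" "g \<le> r * 2 ^ Suc j"
proof -
  have ex: "\<exists>j. g \<le> r * 2 ^ Suc j"
  proof -
    obtain j where "g / r < 2 ^ j" using real_arch_pow[of 2 "g / r"] by auto
    moreover have "(2::real) ^ j \<le> 2 ^ Suc j" by simp
    ultimately have "g / r \<le> 2 ^ Suc j" by linarith
    then have "g \<le> r * 2 ^ Suc j" using assms by (simp add: field_simps)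
    then show ?thesis ..
  qed
  define j where "j = (LEAST j. g \<le> r * 2 ^ Suc j)"
  have "g \<le> r * 2 ^ Suc j" unfolding j_def using ex by (rule LeastI_ex)
  moreover have "r * 2 ^ j < g"
  proof (cases j)
    case 0
    then show ?thesis using assms by simp
  next
    case (Suc k)
    then have "k < j" by simp
    then have "\<not> (g \<le> r * 2 ^ Suc k)" unfolding j_def by (rule not_less_Least)
    then show ?thesis using Suc by simp
  qed
  ultimately show thesis using that by blast
qed

lemma ennreal_le_suminf: "(f :: nat \<Rightarrow> ennreal) j \<le> (\<Sum>i. f i)"
  using sum_le_suminf[of f "{j}"] by (simp add: summableI)

lemma nn_integral_dyadic_sum:
  assumes [measurable]: "\<And>j. A j \<in> sets M"
    and a: "\<And>j. 0 \<le> a j" and le: "\<And>j. ennreal (a j) * emeasure M (A j) \<le> ennreal (K * (1/2) ^ j)" and K: "0 \<le> K"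
  shows "(\<integral>\<^sup>+x. (\<Sum>j. ennreal (a j) * indicator (A j) x) \<partial>M) \<le> ennreal (2 * K)"
proof -
  have "(\<integral>\<^sup>+x. (\<Sum>j. ennreal (a j) * indicator (A j) x) \<partial>M) = (\<Sum>j. ennreal (a j) * emeasure M (A j))"
    by (subst nn_integral_suminf) (simp_all add: nn_integral_cmult_indicator)
  also have "\<dots> \<le> (\<Sum>j. ennreal (K * (1/2) ^ j))"
    by (intro suminf_le le summableI)
  also have "\<dots> = ennreal (2 * K)"
  proof (rule suminf_ennreal_eq)
    have "(\<lambda>j. K * (1/2) ^ j) sums (K * (1 / (1 - 1/2)))"
      by (intro sums_mult geometric_sums) simp
    then show "(\<lambda>j. K * (1/2) ^ j) sums (2 * K)" by (simp add: mult.commute)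
  qed (use K in simp)
  finally show ?thesis .
qed

text \<open>
  Dyadic decomposition of the values of \<open>g\<close>: on the layer \<open>g \<approx> 2^(-j) r\<close> the integrand is about \<open>2^j / r\<close> and
  the measure at most \<open>c (2^(-j) r)^n\<close>, which is summable as soon as \<open>n > 1\<close>. This is the place
  where the dimension \<open>d \<ge> 3\<close> enters.
\<close>

lemma nn_integral_inverse_near:
  fixes g :: "'a \<Rightarrow> real"
  assumes g[measurable]: "g \<in> borel_measurable M" and g0: "\<And>x. 0 \<le> g x"
    and sub: "\<And>t. 0 < t \<Longrightarrow> emeasure M {x \<in> space M. g x \<le> t} \<le> ennreal (c * t ^ n)"
    and n: "2 \<le> n" and r: "0 < r" and c: "0 \<le> c"
  shows "(\<integral>\<^sup>+x. ennreal (if g x \<le> r then 1 / g x else 0) \<partial>M) \<le> ennreal (4 * c * r ^ (n - 1))"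
proof -
  let ?A = "\<lambda>j. {x \<in> space M. g x \<le> r * (1/2) ^ j}"
  let ?a = "\<lambda>j::nat. 2 ^ Suc j / r"
  have "(\<integral>\<^sup>+x. ennreal (if g x \<le> r then 1 / g x else 0) \<partial>M)
      \<le> (\<integral>\<^sup>+x. (\<Sum>j. ennreal (?a j) * indicator (?A j) x) \<partial>M)"
  proof (rule nn_integral_mono)
    fix x assume x: "x \<in> space M"
    show "ennreal (if g x \<le> r then 1 / g x else 0) \<le> (\<Sum>j. ennreal (?a j) * indicator (?A j) x)"
    proof (cases "0 < g x \<and> g x \<le> r")
      case True
      then obtain j where j: "g x \<le> r * (1/2) ^ j" "r * (1/2) ^ Suc j < g x"
        using dyadic_bracket_below by blast
      have "r / 2 ^ Suc j \<le> g x" using j(2) by (simp add: power_divide)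
      then have "1 / g x \<le> ?a j" using True r by (simp add: field_simps)
      then have "ennreal (if g x \<le> r then 1 / g x else 0) \<le> ennreal (?a j) * indicator (?A j) x"
        using True j(1) x by (simp add: ennreal_leI)
      also have "\<dots> \<le> (\<Sum>j. ennreal (?a j) * indicator (?A j) x)" by (rule ennreal_le_suminf)
      finally show ?thesis .
    next
      case False
      then have "(if g x \<le> r then 1 / g x else 0) = 0" using g0[of x] by (auto simp: not_less)
      then show ?thesis by simp
    qed
  qed
  also have "\<dots> \<le> ennreal (2 * (2 * c * r ^ (n - 1)))"
  proof (rule nn_integral_dyadic_sum)
    fix j
    have "ennreal (?a j) * emeasure M (?A j) \<le> ennreal (?a j) * ennreal (c * (r * (1/2) ^ j) ^ n)"
      using r by (intro mult_left_mono sub) auto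
    also have "\<dots> = ennreal (?a j * (c * (r * (1/2) ^ j) ^ n))"
      using r c by (intro ennreal_mult[symmetric]) auto
    also have "\<dots> \<le> ennreal (2 * c * r ^ (n - 1) * (1/2) ^ j)"
    proof (rule ennreal_leI)
      obtain m where m: "n = Suc (Suc m)" using n by (metis add_2_eq_Suc le_Suc_ex)
      define q :: real where "q = (1/2) ^ j"
      have q: "2 ^ j * q = 1" by (simp add: q_def power_one_over)
      have "?a j * (c * (r * q) ^ n) = 2 * c * r ^ Suc m * (2 ^ j * q) * (q * q ^ m)"
        using r unfolding m by (simp add: power_mult_distrib)
      also have "\<dots> = 2 * c * r ^ Suc m * q * q ^ m"
        unfolding q by simp
      also have "\<dots> \<le> 2 * c * r ^ Suc m * q * 1"
        using r c by (intro mult_left_mono power_le_one) (auto simp: q_def power_le_one)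
      finally show "?a j * (c * (r * (1/2) ^ j) ^ n) \<le> 2 * c * r ^ (n - 1) * (1/2) ^ j"
        unfolding q_def[symmetric] by (simp add: m)
    qed
    finally show "ennreal (?a j) * emeasure M (?A j) \<le> ennreal (2 * c * r ^ (n - 1) * (1/2) ^ j)" .
  qed (use r c in auto)
  finally show ?thesis by (simp add: mult_ac)
qed

lemma nn_integral_inverse_far:
  fixes g :: "'a \<Rightarrow> real"
  assumes g[measurable]: "g \<in> borel_measurable M"
    and sub: "\<And>t. 0 < t \<Longrightarrow> emeasure M {x \<in> space M. g x \<le> t} \<le> ennreal (c * t ^ n)"
    and r: "0 < r" and c: "0 \<le> c"
  shows "(\<integral>\<^sup>+x. ennreal (if g x \<le> r then 0 else 1 / g x ^ Suc n) \<partial>M) \<le> ennreal (2 ^ Suc n * c / r)"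
proof -
  let ?A = "\<lambda>j. {x \<in> space M. g x \<le> r * 2 ^ Suc j}"
  let ?a = "\<lambda>j::nat. 1 / (r * 2 ^ j) ^ Suc n"
  have "(\<integral>\<^sup>+x. ennreal (if g x \<le> r then 0 else 1 / g x ^ Suc n) \<partial>M)
      \<le> (\<integral>\<^sup>+x. (\<Sum>j. ennreal (?a j) * indicator (?A j) x) \<partial>M)"
  proof (rule nn_integral_mono)
    fix x assume x: "x \<in> space M"
    show "ennreal (if g x \<le> r then 0 else 1 / g x ^ Suc n) \<le> (\<Sum>j. ennreal (?a j) * indicator (?A j) x)"
    proof (cases "g x \<le> r")
      case False
      then have "r < g x" by simp
      then obtain j where j: "r * 2 ^ j < g x" "g x \<le> r * 2 ^ Suc j"
        using dyadic_bracket_above[OF r] by blast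
      have "(r * 2 ^ j) ^ Suc n \<le> g x ^ Suc n" using j(1) r by (intro power_mono) auto
      then have "1 / g x ^ Suc n \<le> ?a j" using r by (intro frac_le) auto
      then have "ennreal (if g x \<le> r then 0 else 1 / g x ^ Suc n) \<le> ennreal (?a j) * indicator (?A j) x"
        using False j(2) x by (simp add: ennreal_leI)
      also have "\<dots> \<le> (\<Sum>j. ennreal (?a j) * indicator (?A j) x)" by (rule ennreal_le_suminf)
      finally show ?thesis .
    qed simp
  qed
  also have "\<dots> \<le> ennreal (2 * (2 ^ n * c / r))"
  proof (rule nn_integral_dyadic_sum)
    fix j
    have "ennreal (?a j) * emeasure M (?A j) \<le> ennreal (?a j) * ennreal (c * (r * 2 ^ Suc j) ^ n)"
      using r by (intro mult_left_mono sub) auto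
    also have "\<dots> = ennreal (?a j * (c * (r * 2 ^ Suc j) ^ n))"
      using r c by (intro ennreal_mult[symmetric]) auto
    also have "?a j * (c * (r * 2 ^ Suc j) ^ n) = 2 ^ n * c / r * (1/2) ^ j"
    proof -
      define R where "R = r * 2 ^ j"
      have R: "R \<noteq> 0" "1 / R = 1 / r * (1/2) ^ j" using r by (simp_all add: R_def power_one_over)
      have "r * 2 ^ Suc j = 2 * R" by (simp add: R_def)
      then have "?a j * (c * (r * 2 ^ Suc j) ^ n) = 1 / R ^ Suc n * (c * (2 * R) ^ n)" by (simp only: R_def)
      also have "\<dots> = 2 ^ n * c * (1 / R)" using R(1) by (simp add: power_mult_distrib)
      finally show ?thesis unfolding R(2) by simp
    qed
    finally show "ennreal (?a j) * emeasure M (?A j) \<le> ennreal (2 ^ n * c / r * (1/2) ^ j)" by simp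
  qed (use r c in auto)
  finally show ?thesis by (simp add: mult_ac)
qed

lemma power_tangent:
  fixes t b :: real
  assumes "0 \<le> t" "0 \<le> b"
  shows "real (Suc p) * b ^ p * t \<le> t ^ Suc p + real p * b ^ Suc p"
proof (cases "b = 0")
  case True
  then show ?thesis using assms by (cases p) auto
next
  case False
  then have b: "b > 0" using assms by simp
  have "1 + real (Suc p) * (t / b - 1) \<le> (1 + (t / b - 1)) ^ Suc p"
    using assms b by (intro Bernoulli_inequality) (simp add: field_simps)
  then have "b ^ Suc p * (1 + real (Suc p) * (t / b - 1)) \<le> b ^ Suc p * (t / b) ^ Suc p"
    using b by (intro mult_left_mono) auto
  also have "b ^ Suc p * (t / b) ^ Suc p = t ^ Suc p" using b by (simp add: power_divide)
  also have "b ^ Suc p * (1 + real (Suc p) * (t / b - 1)) = real (Suc p) * b ^ p * t - real p * b ^ Suc p"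
    using b by (simp add: field_simps)
  finally show ?thesis by simp
qed

text \<open>
  Jensen's inequality for a power, from the tangent line of \<open>t \<mapsto> t^(p+1)\<close> at the mean value of \<open>T\<close>.
\<close>

lemma nn_integral_power_le:
  assumes T[measurable]: "T \<in> borel_measurable M" and fin: "(\<integral>\<^sup>+x. T x \<partial>M) < \<infinity>"
    and a: "emeasure M (space M) = ennreal a" "0 < a"
  shows "(\<integral>\<^sup>+x. T x \<partial>M) ^ Suc p \<le> ennreal (a ^ p) * (\<integral>\<^sup>+x. T x ^ Suc p \<partial>M)"
proof -
  define I where "I = enn2real (\<integral>\<^sup>+x. T x \<partial>M)"
  have I: "(\<integral>\<^sup>+x. T x \<partial>M) = ennreal I" "0 \<le> I" using fin by (simp_all add: I_def less_top)
  define b where "b = I / a"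
  have b: "0 \<le> b" using I(2) a(2) by (simp add: b_def)
  show ?thesis
  proof (cases "(\<integral>\<^sup>+x. T x ^ Suc p \<partial>M) = \<infinity>")
    case True
    then show ?thesis using a(2) by (simp add: ennreal_mult_top)
  next
    case False
    define X where "X = enn2real (\<integral>\<^sup>+x. T x ^ Suc p \<partial>M)"
    have X: "(\<integral>\<^sup>+x. T x ^ Suc p \<partial>M) = ennreal X" "0 \<le> X" using False by (simp_all add: X_def less_top)
    have "ennreal (real (Suc p) * b ^ p) * T x \<le> T x ^ Suc p + ennreal (real p * b ^ Suc p)" for x
    proof (cases "T x")
      case (real t)
      then show ?thesis using power_tangent[of t b p] b
        by (simp add: ennreal_power flip: ennreal_mult ennreal_plus)
    next
      case top
      then show ?thesis by simp
    qed
    then have "(\<integral>\<^sup>+x. ennreal (real (Suc p) * b ^ p) * T x \<partial>M) \<le> (\<integral>\<^sup>+x. T x ^ Suc p + ennreal (real p * b ^ Suc p) \<partial>M)"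
      by (rule nn_integral_mono)
    also have "(\<integral>\<^sup>+x. ennreal (real (Suc p) * b ^ p) * T x \<partial>M) = ennreal (real (Suc p) * b ^ p * I)"
      using b I(2) by (simp add: nn_integral_cmult I(1) flip: ennreal_mult)
    also have "(\<integral>\<^sup>+x. T x ^ Suc p + ennreal (real p * b ^ Suc p) \<partial>M) = ennreal (X + real p * b ^ Suc p * a)"
      using X b a by (subst nn_integral_add) (simp_all flip: ennreal_mult ennreal_plus)
    finally have "real (Suc p) * b ^ p * I \<le> X + real p * b ^ Suc p * a"
      using b X(2) a(2) by (subst (asm) ennreal_le_iff) auto
    moreover have "real p * b ^ Suc p * a = real p * (b ^ p * I)" using a(2) by (simp add: b_def)
    moreover have "real (Suc p) * b ^ p * I = b ^ p * I + real p * (b ^ p * I)" by (simp add: algebra_simps)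
    ultimately have "b ^ p * I \<le> X" by linarith
    then have "a ^ p * (b ^ p * I) \<le> a ^ p * X" using a(2) by (intro mult_left_mono) auto
    moreover have "a ^ p * (b ^ p * I) = I ^ Suc p" using a(2) by (simp add: b_def power_divide)
    ultimately have "ennreal (I ^ Suc p) \<le> ennreal (a ^ p * X)" by (simp add: ennreal_leI)
    then show ?thesis using I(2) X(2) a(2) unfolding I(1) X(1) by (simp add: ennreal_power ennreal_mult del: power_Suc)
  qed
qed

section \<open>The hypersurface and its two changes of variables\<close>

lemma borel_measurable_vec_nth'[measurable (raw)]:
  fixes f :: "'b \<Rightarrow> 'a::euclidean_space^'n"
  assumes [measurable]: "f \<in> borel_measurable M"
  shows "(\<lambda>x. f x $ i) \<in> borel_measurable M"
  by (rule measurable_compose[OF assms borel_measurable_vec_nth])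

lemma abs_det_minus:
  fixes a b :: "'n \<Rightarrow> real^'n"
  shows "\<bar>det (\<chi> i. a i - b i)\<bar> = \<bar>det (\<chi> i. b i - a i)\<bar>"
proof -
  have "det (\<chi> i. (- 1) *s (b i - a i)) = (\<Prod>i\<in>(UNIV::'n set). - 1) * det (\<chi> i. b i - a i)"
    by (rule det_rows_mul)
  moreover have "(\<chi> i. (- 1) *s (b i - a i)) = (\<chi> i. a i - b i)"
    by (simp add: vec_eq_iff)
  ultimately show ?thesis by (simp add: abs_mult power_abs)
qed

lemma nn_integral_lborel_reflect:
  fixes F :: "'a::euclidean_space \<Rightarrow> ennreal"
  assumes [measurable]: "F \<in> borel_measurable borel"
  shows "(\<integral>\<^sup>+z. F (t - z) \<partial>lborel) = (\<integral>\<^sup>+y. F y \<partial>lborel)"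
proof -
  have "lborel = density (distr lborel borel (\<lambda>x. t + (- 1) *\<^sub>R x)) (\<lambda>_. ennreal (\<bar>- 1\<bar> ^ DIM('a)))"
    by (rule lborel_affine) simp
  then have "lborel = distr lborel borel (\<lambda>x. t - x)"
    by (simp add: density_1)
  then have "(\<integral>\<^sup>+y. F y \<partial>lborel) = (\<integral>\<^sup>+y. F y \<partial>distr lborel borel (\<lambda>x. t - x))" by simp
  also have "\<dots> = (\<integral>\<^sup>+z. F (t - z) \<partial>lborel)"
    by (rule nn_integral_distr) measurable
  finally show ?thesis ..
qed

lemma zip_measurable:
  "(\<lambda>p :: ('a::euclidean_space^'n::finite) \<times> (real^'n). \<chi> i. (fst p $ i, snd p $ i)) \<in> borel_measurable borel"
  by (intro borel_measurable_continuous_onI continuous_intros)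

lemma has_derivative_vec_lambda_real:
  fixes f :: "'n::finite \<Rightarrow> 'a::euclidean_space \<Rightarrow> real"
  assumes "\<And>i. (f i has_derivative f' i) (at x)"
  shows "((\<lambda>x. \<chi> i. f i x) has_derivative (\<lambda>v. \<chi> i. f' i v)) (at x)"
  by (subst has_derivative_componentwise_within) (auto simp: Basis_vec_def inner_axis assms)

text \<open>
  The objects of the theorem are extended by zero outside of the open set, which makes them Borel
  functions on the whole space: \<open>G\<close> is the gradient, \<open>ph\<close> the height, \<open>w\<close> the density of the affine
  surface measure and \<open>\<gamma>\<close> the graph map.
\<close>

locale hypersurface =
  fixes \<Omega> :: "(real^'n) set" and \<phi> :: "real^'n \<Rightarrow> real" and l1 l2 :: nat
  assumes open_Omega: "open \<Omega>" and C2: "C2_on \<Omega> \<phi>"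
    and mult_grad: "generic_multiplicity_le \<Omega> (grad \<phi>) l1"
    and mult_Psi: "generic_multiplicity_le (tuples \<Omega>) (Psi \<phi>) l2"
begin

definition G :: "real^'n \<Rightarrow> real^'n" where "G x = indicator \<Omega> x *\<^sub>R grad \<phi> x"
definition ph :: "real^'n \<Rightarrow> real" where "ph x = indicator \<Omega> x * \<phi> x"
definition w :: "real^'n \<Rightarrow> real" where
  "w x = indicator \<Omega> x * \<bar>det (hessian \<phi> x)\<bar> powr (1 / (real CARD('n) + 2))"
definition \<gamma> :: "real^'n \<Rightarrow> (real^'n) \<times> real" where "\<gamma> x = (x, ph x)"

lemma Omega_borel[measurable]: "\<Omega> \<in> sets borel"
  using open_Omega by simp

lemma has_derivative_phi:
  assumes x: "x \<in> \<Omega>"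
  shows "(\<phi> has_derivative (\<lambda>v. v \<bullet> grad \<phi> x)) (at x)"
proof -
  have "\<phi> differentiable (at x within \<Omega>)" using C2 x by (simp add: C2_on_def differentiable_on_def)
  then have "\<phi> differentiable (at x)" unfolding at_within_open[OF x open_Omega] .
  then obtain f' where f': "(\<phi> has_derivative f') (at x)" by (auto simp: differentiable_def)
  then have lin: "linear f'" by (simp add: has_derivative_linear)
  have rep: "f' = (\<lambda>v. v \<bullet> adjoint f' 1)"
  proof
    fix v
    show "f' v = v \<bullet> adjoint f' 1" using adjoint_works[OF lin, of v 1] by simp
  qed
  then have "(\<phi> has_derivative (\<lambda>v. v \<bullet> adjoint f' 1)) (at x)" by (subst rep[symmetric]) (rule f')
  then have D: "GDERIV \<phi> x :> adjoint f' 1" unfolding gderiv_def .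
  moreover have "D = adjoint f' 1" if "GDERIV \<phi> x :> D" for D
  proof -
    have "(\<lambda>v. v \<bullet> D) = (\<lambda>v. v \<bullet> adjoint f' 1)"
      using that D unfolding gderiv_def by (rule has_derivative_unique)
    then have "\<forall>v. v \<bullet> D = v \<bullet> adjoint f' 1" by (intro allI) (rule fun_cong)
    then show ?thesis by (simp only: vector_eq_ldot)
  qed
  ultimately have "grad \<phi> x = adjoint f' 1" unfolding grad_def by (rule the_equality)
  then show ?thesis using D unfolding gderiv_def by simp
qed

lemma has_derivative_grad:
  assumes x: "x \<in> \<Omega>"
  shows "(grad \<phi> has_derivative (\<lambda>v. hessian \<phi> x *v v)) (at x)"
proof -
  have "grad \<phi> differentiable (at x within \<Omega>)" using C2 x by (simp add: C2_on_def differentiable_on_def)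
  then have "grad \<phi> differentiable (at x)" unfolding at_within_open[OF x open_Omega] .
  then show ?thesis unfolding jacobian_works hessian_def .
qed

lemma continuous_on_phi: "continuous_on \<Omega> \<phi>"
  by (rule has_derivative_continuous_on[OF has_derivative_at_withinI[OF has_derivative_phi]])

lemma continuous_on_grad: "continuous_on \<Omega> (grad \<phi>)"
  by (rule has_derivative_continuous_on[OF has_derivative_at_withinI[OF has_derivative_grad]])

lemma continuous_on_hessian: "continuous_on \<Omega> (hessian \<phi>)"
  using C2 by (simp add: C2_on_def)

lemma G_measurable[measurable]: "G \<in> borel_measurable borel"
  unfolding G_def[abs_def] by (intro borel_measurable_continuous_on_indicator continuous_on_grad) auto

lemma ph_measurable[measurable]: "ph \<in> borel_measurable borel"
  using borel_measurable_continuous_on_indicator[OF _ continuous_on_phi] by (simp add: ph_def[abs_def])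

lemma w_measurable[measurable]: "w \<in> borel_measurable borel"
proof -
  have [measurable]: "(\<lambda>x. indicator \<Omega> x *\<^sub>R \<bar>det (hessian \<phi> x)\<bar>) \<in> borel_measurable borel"
    by (intro borel_measurable_continuous_on_indicator continuous_intros continuous_on_det continuous_on_hessian) auto
  have "(\<lambda>x. (indicator \<Omega> x *\<^sub>R \<bar>det (hessian \<phi> x)\<bar>) powr (1 / (real CARD('n) + 2))) \<in> borel_measurable borel"
    by measurable
  also have "(\<lambda>x. (indicator \<Omega> x *\<^sub>R \<bar>det (hessian \<phi> x)\<bar>) powr (1 / (real CARD('n) + 2))) = w"
    by (auto simp: fun_eq_iff w_def indicator_def)
  finally show ?thesis .
qed

lemma gamma_measurable[measurable]: "\<gamma> \<in> borel_measurable borel"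
  unfolding \<gamma>_def[abs_def] by measurable

lemma w_nonneg: "0 \<le> w x" by (simp add: w_def)

text \<open>
  The exponent of the affine surface measure is the one for which \<open>n + 2\<close> copies of its density
  make up the Jacobian of the gradient map.
\<close>

lemma w_power: "w x ^ (CARD('n) + 2) = indicator \<Omega> x * \<bar>det (hessian \<phi> x)\<bar>"
proof (cases "x \<in> \<Omega> \<and> det (hessian \<phi> x) \<noteq> 0")
  case True
  then have "0 < w x" by (simp add: w_def)
  then have "w x ^ (CARD('n) + 2) = w x powr real (CARD('n) + 2)"
    by (rule powr_realpow[symmetric])
  also have "\<dots> = (\<bar>det (hessian \<phi> x)\<bar> powr (1 / (real CARD('n) + 2))) powr real (CARD('n) + 2)"
    using True by (simp add: w_def)
  also have "\<dots> = \<bar>det (hessian \<phi> x)\<bar>"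
  proof -
    have "1 / (real CARD('n) + 2) * real (CARD('n) + 2) = 1" by simp
    then show ?thesis unfolding powr_powr by (simp only:) (use True in simp)
  qed
  finally show ?thesis using True by simp
qed (auto simp: w_def)

lemma nn_integral_grad:
  assumes F[measurable]: "F \<in> borel_measurable borel"
  shows "(\<integral>\<^sup>+x. F (G x) * ennreal (w x ^ (CARD('n) + 2)) \<partial>lborel) \<le> of_nat l1 * (\<integral>\<^sup>+z. F z \<partial>lborel)"
proof -
  have "(\<integral>\<^sup>+x. F (G x) * ennreal (w x ^ (CARD('n) + 2)) \<partial>lborel)
      = (\<integral>\<^sup>+x. F (grad \<phi> x) * ennreal \<bar>det (hessian \<phi> x)\<bar> * indicator \<Omega> x \<partial>lborel)"
    unfolding w_power by (intro nn_integral_cong) (simp add: G_def indicator_def)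
  also have "\<dots> \<le> of_nat l1 * (\<integral>\<^sup>+z. F z \<partial>lborel)"
    by (rule nn_integral_det_multiplicity[OF open_Omega has_derivative_grad continuous_on_hessian mult_grad F])
  finally show ?thesis .
qed

text \<open>
  Where \<open>w\<close> is positive, the gradient map pulls null sets back to null sets; in particular the
  gradient avoids almost surely any given hyperplane.
\<close>

lemma AE_grad_hyperplane:
  assumes l: "l \<noteq> 0"
  shows "AE y in lborel. 0 < w y \<longrightarrow> l \<bullet> (G y - c) \<noteq> 0"
proof -
  let ?Z = "{z. l \<bullet> z = l \<bullet> c}"
  have Zb[measurable]: "?Z \<in> sets borel" by (intro borel_closed closed_hyperplane)
  have "negligible ?Z" using l by (intro negligible_hyperplane) auto
  then have "emeasure lebesgue ?Z = 0" by (simp add: negligible_iff_null_sets null_setsD1)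
  then have Z0: "emeasure lborel ?Z = 0" using Zb by simp
  have "(\<integral>\<^sup>+x. indicator ?Z (G x) * ennreal (w x ^ (CARD('n) + 2)) \<partial>lborel) \<le> of_nat l1 * (\<integral>\<^sup>+z. indicator ?Z z \<partial>lborel)"
    by (rule nn_integral_grad) measurable
  also have "\<dots> = 0" using Z0 by simp
  finally have "(\<integral>\<^sup>+x. indicator ?Z (G x) * ennreal (w x ^ (CARD('n) + 2)) \<partial>lborel) = 0" by simp
  then have "AE x in lborel. indicator ?Z (G x) * ennreal (w x ^ (CARD('n) + 2)) = 0"
    by (subst (asm) nn_integral_0_iff_AE) measurable
  then show ?thesis
    by eventually_elim (auto simp: indicator_def inner_diff_right split: if_splits)
qed

text \<open>
  The change of variables \<^const>\<open>Psi\<close>, done in two steps. For fixed \<open>x\<close> the substitution \<open>y_i = x - z_i\<close>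
  is a reflection. For fixed \<open>z\<close> the map \<open>x \<mapsto> (\<phi>(x) - \<phi>(x - z_i))_i\<close> of \<open>R^n\<close> to itself has the Jacobian
  determinant on the left-hand side, and for almost every \<open>z\<close> its fibres are, by Fubini, in
  bijection with fibres of \<^const>\<open>Psi\<close>, so that its generic multiplicity is at most \<open>l2\<close>.
\<close>

lemma nn_integral_Psi:
  fixes f :: "(real^'n) \<times> real \<Rightarrow> ennreal"
  assumes f[measurable]: "f \<in> borel_measurable borel"
  shows "(\<integral>\<^sup>+x. (\<integral>\<^sup>+y. indicator \<Omega> x * (\<Prod>i\<in>UNIV. indicator \<Omega> (y $ i) * f (\<gamma> x - \<gamma> (y $ i)))
           * ennreal \<bar>det (\<chi> i. G (y $ i) - G x)\<bar> \<partial>lborel) \<partial>lborel)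
       \<le> of_nat l2 * (\<integral>\<^sup>+p. f p \<partial>lborel) ^ CARD('n)"
proof -
  define K :: "real^'n \<Rightarrow> (real^'n)^'n \<Rightarrow> ennreal" where
    "K x y = indicator \<Omega> x * (\<Prod>i\<in>UNIV. indicator \<Omega> (y $ i) * f (\<gamma> x - \<gamma> (y $ i)))
           * ennreal \<bar>det (\<chi> i. G (y $ i) - G x)\<bar>" for x y
  have K1[measurable]: "(\<lambda>p. K (fst p) (snd p)) \<in> borel_measurable (borel \<Otimes>\<^sub>M borel)"
    unfolding K_def by measurable
  have Km[measurable (raw)]: "(\<lambda>x. K (a x) (b x)) \<in> borel_measurable M"
    if [measurable]: "a \<in> borel_measurable M" "b \<in> borel_measurable M" for a b and M :: "'z measure"
  proof -
    have "(\<lambda>x. (a x, b x)) \<in> M \<rightarrow>\<^sub>M (borel \<Otimes>\<^sub>M borel)" by measurable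
    from measurable_compose[OF this K1] show ?thesis by simp
  qed
  define Y :: "real^'n \<Rightarrow> (real^'n)^'n \<Rightarrow> (real^'n)^'n" where "Y x z = (\<chi> i. x) - z" for x z
  have Ynth: "Y x z $ i = x - z $ i" for x z i by (simp add: Y_def)
  define S where "S z = {x \<in> \<Omega>. \<forall>i. x - z $ i \<in> \<Omega>}" for z :: "(real^'n)^'n"
  define \<Theta> where "\<Theta> z x = (\<chi> i. \<phi> x - \<phi> (x - z $ i))" for z :: "(real^'n)^'n" and x
  define A :: "(real^'n)^'n \<Rightarrow> real^'n \<Rightarrow> real^'n^'n" where
    "A z x = (\<chi> i. grad \<phi> x - grad \<phi> (x - z $ i))" for z x
  define F where "F z t = (\<Prod>i\<in>UNIV. f (z $ i, t $ i))" for z :: "(real^'n)^'n" and t :: "real^'n"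
  have F1[measurable]: "(\<lambda>p. F (fst p) (snd p)) \<in> borel_measurable (borel \<Otimes>\<^sub>M borel)"
    unfolding F_def by measurable
  have openS: "open (S z)" for z
  proof -
    have "S z = \<Omega> \<inter> (\<Inter>i\<in>UNIV. (\<lambda>x. x - z $ i) -` \<Omega>)" by (auto simp: S_def)
    also have "open \<dots>"
      by (intro open_Int open_INT ballI open_vimage open_Omega continuous_intros) auto
    finally show ?thesis .
  qed
  have Keq: "K x (Y x z) = F z (\<Theta> z x) * ennreal \<bar>det (A z x)\<bar> * indicator (S z) x" for x z
  proof (cases "x \<in> S z")
    case True
    then have x: "x \<in> \<Omega>" "\<And>i. x - z $ i \<in> \<Omega>" by (auto simp: S_def)
    have "\<bar>det (\<chi> i. G (Y x z $ i) - G x)\<bar> = \<bar>det (A z x)\<bar>"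
      unfolding A_def by (subst abs_det_minus) (simp add: Ynth G_def x)
    then show ?thesis using x True
      by (simp add: K_def F_def \<Theta>_def Ynth \<gamma>_def ph_def)
  next
    case False
    then have "x \<notin> \<Omega> \<or> (\<exists>i. x - z $ i \<notin> \<Omega>)" by (auto simp: S_def)
    then have "indicator \<Omega> x * (\<Prod>i\<in>UNIV. indicator \<Omega> (Y x z $ i) * f (\<gamma> x - \<gamma> (Y x z $ i))) = 0"
    proof
      assume "\<exists>i. x - z $ i \<notin> \<Omega>"
      then obtain i where "x - z $ i \<notin> \<Omega>" ..
      then have "indicator \<Omega> (Y x z $ i) * f (\<gamma> x - \<gamma> (Y x z $ i)) = 0" by (simp add: Ynth)
      then have "(\<Prod>i\<in>UNIV. indicator \<Omega> (Y x z $ i) * f (\<gamma> x - \<gamma> (Y x z $ i))) = 0"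
        by (intro prod_zero) auto
      then show ?thesis by simp
    qed simp
    then show ?thesis using False by (simp add: K_def)
  qed
  have mult: "AE z in lborel. generic_multiplicity_le (S z) (\<Theta> z) l2"
  proof -
    let ?T = "\<lambda>p :: ((real^'n)^'n) \<times> (real^'n). \<chi> i. (fst p $ i, snd p $ i)"
    have "AE v in distr lborel lborel ?T. finite {x \<in> tuples \<Omega>. Psi \<phi> x = v} \<and> card {x \<in> tuples \<Omega>. Psi \<phi> x = v} \<le> l2"
      using mult_Psi unfolding generic_multiplicity_le_def lborel_eq_distr_zip[symmetric] .
    then have "AE p in lborel. finite {x \<in> tuples \<Omega>. Psi \<phi> x = ?T p} \<and> card {x \<in> tuples \<Omega>. Psi \<phi> x = ?T p} \<le> l2"
      by (rule AE_distrD[rotated]) (simp add: zip_measurable)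
    then have "AE z in lborel. AE t in lborel. finite {x \<in> tuples \<Omega>. Psi \<phi> x = ?T (z, t)} \<and> card {x \<in> tuples \<Omega>. Psi \<phi> x = ?T (z, t)} \<le> l2"
      unfolding lborel_prod[symmetric] by (rule lborel_pair.AE_pair)
    then show ?thesis
    proof eventually_elim
      case (elim z)
      then show ?case unfolding generic_multiplicity_le_def
      proof eventually_elim
        case (elim t)
        let ?U = "{x \<in> tuples \<Omega>. Psi \<phi> x = ?T (z, t)}"
        have "{x \<in> S z. \<Theta> z x = t} \<subseteq> fst ` ?U"
        proof
          fix x assume x: "x \<in> {x \<in> S z. \<Theta> z x = t}"
          have "(x, Y x z) \<in> tuples \<Omega>" using x by (auto simp: tuples_def S_def Ynth)
          moreover have "Psi \<phi> (x, Y x z) = ?T (z, t)"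
            using x by (auto simp: Psi_def Ynth graph_map_def \<Theta>_def)
          ultimately show "x \<in> fst ` ?U" by force
        qed
        moreover have fin: "finite (fst ` ?U)" and "card (fst ` ?U) \<le> l2"
          using elim card_image_le[of ?U fst] by auto
        ultimately show ?case using card_mono[OF fin] finite_subset[OF _ fin] by (meson order_trans)
      qed
    qed
  qed
  have "(\<integral>\<^sup>+x. (\<integral>\<^sup>+y. K x y \<partial>lborel) \<partial>lborel) = (\<integral>\<^sup>+x. (\<integral>\<^sup>+z. K x (Y x z) \<partial>lborel) \<partial>lborel)"
    unfolding Y_def by (intro nn_integral_cong nn_integral_lborel_reflect[symmetric]) measurable
  also have "\<dots> = (\<integral>\<^sup>+z. (\<integral>\<^sup>+x. K x (Y x z) \<partial>lborel) \<partial>lborel)"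
    by (rule lborel_pair.Fubini'[symmetric]) (simp add: case_prod_unfold Y_def, measurable)
  also have "\<dots> \<le> (\<integral>\<^sup>+z. of_nat l2 * (\<integral>\<^sup>+t. F z t \<partial>lborel) \<partial>lborel)"
  proof (rule nn_integral_mono_AE)
    show "AE z in lborel. (\<integral>\<^sup>+x. K x (Y x z) \<partial>lborel) \<le> of_nat l2 * (\<integral>\<^sup>+t. F z t \<partial>lborel)"
      using mult
    proof eventually_elim
      case (elim z)
      show ?case unfolding Keq
      proof (rule nn_integral_det_multiplicity[OF openS _ _ elim])
        show "(\<lambda>t. F z t) \<in> borel_measurable borel" unfolding F_def by measurable
        show "continuous_on (S z) (A z)" unfolding A_def
          by (intro continuous_intros continuous_on_compose2[OF continuous_on_grad]) (auto simp: S_def)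
        fix x assume x: "x \<in> S z"
        have "((\<lambda>x. \<phi> x - \<phi> (x - z $ i)) has_derivative (\<lambda>v. v \<bullet> grad \<phi> x - v \<bullet> grad \<phi> (x - z $ i))) (at x)" for i
        proof (intro has_derivative_diff has_derivative_phi)
          show "x \<in> \<Omega>" using x by (simp add: S_def)
          have "((\<lambda>x. x - z $ i) has_derivative (\<lambda>v. v)) (at x)" by (auto intro!: derivative_eq_intros)
          moreover have "(\<phi> has_derivative (\<lambda>v. v \<bullet> grad \<phi> (x - z $ i))) (at (x - z $ i))"
            using x by (intro has_derivative_phi) (simp add: S_def)
          ultimately show "((\<lambda>x. \<phi> (x - z $ i)) has_derivative (\<lambda>v. v \<bullet> grad \<phi> (x - z $ i))) (at x)"
            by (rule has_derivative_compose)
        qed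
        then have "(\<Theta> z has_derivative (\<lambda>v. \<chi> i. v \<bullet> grad \<phi> x - v \<bullet> grad \<phi> (x - z $ i))) (at x)"
          unfolding \<Theta>_def[abs_def] by (intro has_derivative_vec_lambda_real)
        also have "(\<lambda>v. \<chi> i. v \<bullet> grad \<phi> x - v \<bullet> grad \<phi> (x - z $ i)) = (\<lambda>v. A z x *v v)"
          by (simp add: fun_eq_iff vec_eq_iff matrix_vector_nth A_def inner_diff_left inner_diff_right inner_commute)
        finally show "(\<Theta> z has_derivative (\<lambda>v. A z x *v v)) (at x)" .
      qed
    qed
  qed
  also have "\<dots> = of_nat l2 * (\<integral>\<^sup>+z. (\<integral>\<^sup>+t. F z t \<partial>lborel) \<partial>lborel)"
    by (rule nn_integral_cmult) measurable
  also have "(\<integral>\<^sup>+z. (\<integral>\<^sup>+t. F z t \<partial>lborel) \<partial>lborel) = (\<integral>\<^sup>+p. F (fst p) (snd p) \<partial>(lborel \<Otimes>\<^sub>M lborel))"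
    by (subst lborel.nn_integral_fst[symmetric]) simp_all
  also have "\<dots> = (\<integral>\<^sup>+p. (\<Prod>i\<in>UNIV. f ((\<chi> i. (fst p $ i, snd p $ i)) $ i)) \<partial>(lborel :: (((real^'n)^'n) \<times> (real^'n)) measure))"
    by (simp add: lborel_prod F_def)
  also have "\<dots> = (\<integral>\<^sup>+v. (\<Prod>i\<in>UNIV. f (v $ i)) \<partial>(lborel :: (((real^'n) \<times> real)^'n) measure))"
    by (subst lborel_eq_distr_zip, subst nn_integral_distr) (simp_all add: zip_measurable)
  also have "\<dots> = (\<integral>\<^sup>+p. f p \<partial>lborel) ^ CARD('n)"
    by (subst nn_integral_prod_vec) simp_all
  finally show ?thesis unfolding K_def .
qed

end

section \<open>The fibre estimate\<close>

text \<open>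
  The constants of the successive estimates, in terms of the dimension \<open>n = d - 1\<close> and of the two
  multiplicities \<open>l1\<close> and \<open>l2\<close>. They stand outside the locale of a fixed surface because the constant
  of the theorem is chosen before the surface.
\<close>

definition weight_const :: "nat \<Rightarrow> nat \<Rightarrow> real" where
  "weight_const n l1 = 1 + real l1 * 2 ^ n * (4 + 2 ^ Suc n)"

definition fibre_const :: "nat \<Rightarrow> nat \<Rightarrow> real" where
  "fibre_const n l1 = (real n * weight_const n l1) ^ n"

definition energy_const :: "nat \<Rightarrow> nat \<Rightarrow> nat \<Rightarrow> real" where
  "energy_const n l1 l2 = root n (4 ^ n * fibre_const n l1 * real l2)"

definition extension_const :: "nat \<Rightarrow> nat \<Rightarrow> nat \<Rightarrow> real" where
  "extension_const n l1 l2 = (2 * pi) ^ (n + 1) * (energy_const n l1 l2 + 1)"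

definition restriction_const :: "nat \<Rightarrow> nat \<Rightarrow> nat \<Rightarrow> real" where
  "restriction_const n l1 l2 = extension_const n l1 l2 powr (1/4)"

lemma weight_const_pos: "0 < weight_const n l1"
  unfolding weight_const_def by (intro add_pos_nonneg) auto

lemma energy_const_nonneg: "0 \<le> energy_const n l1 l2"
  unfolding energy_const_def fibre_const_def using less_imp_le[OF weight_const_pos[of n l1]]
  by (intro real_root_ge_zero mult_nonneg_nonneg zero_le_power) auto

lemma extension_const_pos: "0 < extension_const n l1 l2"
  unfolding extension_const_def using energy_const_nonneg[of n l1 l2]
  by (intro mult_pos_pos zero_less_power add_nonneg_pos) auto

lemma restriction_const_pos: "0 < restriction_const n l1 l2"
  using extension_const_pos[of n l1 l2] by (simp add: restriction_const_def)

text \<open>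
  Three regimes for \<open>w^2 / g\<close>. If \<open>w / g \<le> \<tau>\<close>, it is at most \<open>\<tau> w\<close>, to be integrated against the surface
  measure. Otherwise a power of a ratio that is at least 1 is inserted, \<open>(w / w0)^n\<close> for small \<open>g\<close> and
  \<open>(w / (\<tau> g))^n\<close> for large \<open>g\<close>, which produces the Jacobian factor \<open>w^(n+2)\<close>. For \<open>g = 0\<close> the quotient
  is 0 by convention.
\<close>

lemma split_weight:
  fixes w w0 \<tau> g :: real
  assumes w: "0 < w0" "w0 \<le> w" and \<tau>: "0 < \<tau>" and g: "0 \<le> g"
  shows "w\<^sup>2 / g \<le> \<tau> * w + 1 / w0 ^ n * (w ^ (n + 2) * (if g \<le> w0 / \<tau> then 1 / g else 0))
     + 1 / \<tau> ^ n * (w ^ (n + 2) * (if g \<le> w0 / \<tau> then 0 else 1 / g ^ Suc n))"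
proof (cases "g = 0")
  case True
  then show ?thesis using w \<tau> by simp
next
  case False
  then have g: "0 < g" using g by simp
  have w': "0 < w" using w by simp
  let ?b = "1 / w0 ^ n * (w ^ (n + 2) * (if g \<le> w0 / \<tau> then 1 / g else 0))"
  let ?c = "1 / \<tau> ^ n * (w ^ (n + 2) * (if g \<le> w0 / \<tau> then 0 else 1 / g ^ Suc n))"
  have nn: "0 \<le> \<tau> * w" "0 \<le> ?b" "0 \<le> ?c" using w w' \<tau> g by simp_all
  consider "w / g \<le> \<tau>" | "\<tau> < w / g" "g \<le> w0 / \<tau>" | "\<tau> < w / g" "\<not> g \<le> w0 / \<tau>" by linarith
  then show ?thesis
  proof cases
    case 1
    then have "w * (w / g) \<le> w * \<tau>" using w' by (intro mult_left_mono) auto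
    then show ?thesis using nn by (simp add: power2_eq_square mult.commute)
  next
    case 2
    have "w\<^sup>2 / g * 1 \<le> w\<^sup>2 / g * (w / w0) ^ n"
      using w g by (intro mult_left_mono one_le_power) auto
    also have "\<dots> = ?b" using 2 w g by (simp add: power_divide power_add power2_eq_square field_simps)
    finally show ?thesis using nn by simp
  next
    case 3
    have "1 \<le> w / (\<tau> * g)" using 3(1) \<tau> g by (simp add: field_simps)
    then have "w\<^sup>2 / g * 1 \<le> w\<^sup>2 / g * (w / (\<tau> * g)) ^ n"
      using w g by (intro mult_left_mono one_le_power) auto
    also have "\<dots> = ?c" using 3 w g \<tau> by (simp add: power_divide power_mult_distrib power_add power2_eq_square field_simps)
    finally show ?thesis using nn by simp
  qed
qed

lemma ennreal_combination':
  assumes "0 \<le> a" "0 \<le> b" "0 \<le> c" "0 \<le> d" "0 \<le> e" "0 \<le> f"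
  shows "ennreal (a * b + c * d + e * f) = ennreal a * ennreal b + ennreal c * ennreal d + ennreal e * ennreal f"
  using assms by (simp add: ennreal_plus ennreal_mult del: ennreal_plus[symmetric])

lemma ennreal_combination:
  assumes "0 \<le> a" "0 \<le> b" "0 \<le> c" "0 \<le> d" "0 \<le> d'" "0 \<le> e" "0 \<le> f" "0 \<le> f'"
  shows "ennreal (a * b + c * (d * d') + e * (f * f'))
    = ennreal a * ennreal b + ennreal c * (ennreal d * ennreal d') + ennreal e * (ennreal f * ennreal f')"
  using assms by (subst ennreal_combination') (simp_all add: ennreal_mult)

context hypersurface
begin

lemma emeasure_grad_sublevel:
  assumes L: "det L = 1" and t: "0 < t" and [measurable]: "E \<in> sets borel"
  shows "emeasure (density lborel (\<lambda>y. ennreal (indicator E y * w y ^ (CARD('n) + 2))))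
      {y \<in> space (density lborel (\<lambda>y. ennreal (indicator E y * w y ^ (CARD('n) + 2)))). (\<Sum>i\<in>UNIV. \<bar>(L *v (G y - c)) $ i\<bar>) \<le> t}
    \<le> ennreal (real l1 * 2 ^ CARD('n) * t ^ CARD('n))"
proof -
  let ?Z = "{x. \<forall>i. \<bar>(L *v (x - c)) $ i\<bar> \<le> t}"
  let ?g = "\<lambda>y. \<Sum>i\<in>UNIV. \<bar>(L *v (G y - c)) $ i\<bar>"
  have [measurable]: "?g \<in> borel_measurable borel" unfolding matrix_vector_nth by measurable
  have Z[measurable]: "?Z \<in> sets borel"
    unfolding matrix_vector_nth
    by (intro borel_closed closed_Collect_all closed_Collect_le continuous_intros)
  have "emeasure (density lborel (\<lambda>y. ennreal (indicator E y * w y ^ (CARD('n) + 2)))) {y. ?g y \<le> t}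
     = (\<integral>\<^sup>+y. ennreal (indicator E y * w y ^ (CARD('n) + 2)) * indicator {y. ?g y \<le> t} y \<partial>lborel)"
    by (rule emeasure_density) measurable
  also have "\<dots> \<le> (\<integral>\<^sup>+y. indicator ?Z (G y) * ennreal (w y ^ (CARD('n) + 2)) \<partial>lborel)"
  proof (rule nn_integral_mono)
    fix y
    have "\<bar>(L *v (G y - c)) $ i\<bar> \<le> ?g y" for i by (rule member_le_sum) auto
    then have "?g y \<le> t \<Longrightarrow> G y \<in> ?Z" by (auto intro: order_trans)
    then show "ennreal (indicator E y * w y ^ (CARD('n) + 2)) * indicator {y. ?g y \<le> t} y
        \<le> indicator ?Z (G y) * ennreal (w y ^ (CARD('n) + 2))"
      by (auto simp: indicator_def)
  qed
  also have "\<dots> \<le> of_nat l1 * (\<integral>\<^sup>+z. indicator ?Z z \<partial>lborel)"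
    by (rule nn_integral_grad) measurable
  also have "\<dots> = of_nat l1 * emeasure lborel ?Z" using Z by simp
  also have "\<dots> \<le> of_nat l1 * ennreal ((2 * t) ^ CARD('n))"
    using L t by (intro mult_left_mono emeasure_unimodular_sublevel) auto
  also have "\<dots> = ennreal (real l1 * 2 ^ CARD('n) * t ^ CARD('n))"
    using t by (simp add: power_mult_distrib ennreal_mult ennreal_of_nat_eq_real_of_nat mult.assoc)
  finally show ?thesis by (simp add: space_density)
qed

text \<open>
  The terms of \<open>split_weight\<close> are integrated by means of the sublevel bound for the gradient. The
  hypothesis on \<open>\<tau>\<close> is the choice that makes the three contributions comparable.
\<close>

lemma weight_integral_bound:
  assumes n: "2 \<le> CARD('n)" and E[measurable]: "E \<in> sets borel"
    and lam: "(\<integral>\<^sup>+y. ennreal (indicator E y * w y) \<partial>lborel) = ennreal lam" "0 < lam"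
    and w0: "0 < w0" and L: "det L = 1" and \<tau>: "0 < \<tau>" "\<tau> ^ CARD('n) * (w0 * lam) = 1"
  shows "(\<integral>\<^sup>+y. ennreal (indicator E y * (if w0 \<le> w y then (w y)\<^sup>2 / (\<Sum>i\<in>UNIV. \<bar>(L *v (G y - c)) $ i\<bar>) else 0)) \<partial>lborel)
     \<le> ennreal (weight_const CARD('n) l1 * \<tau> * lam)"
proof -
  let ?n = "CARD('n)"
  let ?g = "\<lambda>y. \<Sum>i\<in>UNIV. \<bar>(L *v (G y - c)) $ i\<bar>"
  have gm[measurable]: "?g \<in> borel_measurable borel" unfolding matrix_vector_nth by measurable
  have g0: "0 \<le> ?g y" for y by (intro sum_nonneg) auto
  define r where "r = w0 / \<tau>"
  have r: "0 < r" using w0 \<tau> by (simp add: r_def)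
  define cc where "cc = real l1 * 2 ^ ?n"
  have cc: "0 \<le> cc" by (simp add: cc_def)
  let ?h = "\<lambda>y. indicator E y * w y ^ (?n + 2)"
  let ?M = "density lborel (\<lambda>y. ennreal (?h y))"
  let ?a = "\<lambda>y. if ?g y \<le> r then 1 / ?g y else 0"
  let ?b = "\<lambda>y. if ?g y \<le> r then 0 else 1 / ?g y ^ Suc ?n"
  have gM: "?g \<in> borel_measurable ?M" by simp
  have sub: "emeasure ?M {x \<in> space ?M. ?g x \<le> t} \<le> ennreal (cc * t ^ ?n)" if "0 < t" for t
    unfolding cc_def using L that E by (rule emeasure_grad_sublevel)
  have Ia: "(\<integral>\<^sup>+y. ennreal (?h y) * ennreal (?a y) \<partial>lborel) \<le> ennreal (4 * cc * r ^ (?n - 1))"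
  proof -
    have "(\<integral>\<^sup>+y. ennreal (?h y) * ennreal (?a y) \<partial>lborel) = (\<integral>\<^sup>+y. ennreal (?a y) \<partial>?M)"
      by (rule nn_integral_density[symmetric]) measurable
    also have "\<dots> \<le> ennreal (4 * cc * r ^ (?n - 1))"
      by (rule nn_integral_inverse_near[OF gM g0 _ n r cc]) (rule sub)
    finally show ?thesis .
  qed
  have Ib: "(\<integral>\<^sup>+y. ennreal (?h y) * ennreal (?b y) \<partial>lborel) \<le> ennreal (2 ^ Suc ?n * cc / r)"
  proof -
    have "(\<integral>\<^sup>+y. ennreal (?h y) * ennreal (?b y) \<partial>lborel) = (\<integral>\<^sup>+y. ennreal (?b y) \<partial>?M)"
      by (rule nn_integral_density[symmetric]) measurable
    also have "\<dots> \<le> ennreal (2 ^ Suc ?n * cc / r)"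
      by (rule nn_integral_inverse_far[OF gM _ r cc]) (rule sub)
    finally show ?thesis .
  qed
  have "(\<integral>\<^sup>+y. ennreal (indicator E y * (if w0 \<le> w y then (w y)\<^sup>2 / ?g y else 0)) \<partial>lborel)
     \<le> (\<integral>\<^sup>+y. ennreal \<tau> * ennreal (indicator E y * w y) + ennreal (1 / w0 ^ ?n) * (ennreal (?h y) * ennreal (?a y))
         + ennreal (1 / \<tau> ^ ?n) * (ennreal (?h y) * ennreal (?b y)) \<partial>lborel)"
  proof (rule nn_integral_mono)
    fix y
    have a0: "0 \<le> ?a y" "0 \<le> ?b y" using g0[of y] by simp_all
    have h0: "0 \<le> ?h y" using w_nonneg[of y] by simp
    have "indicator E y * (if w0 \<le> w y then (w y)\<^sup>2 / ?g y else 0)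
       \<le> \<tau> * (indicator E y * w y) + 1 / w0 ^ ?n * (?h y * ?a y) + 1 / \<tau> ^ ?n * (?h y * ?b y)"
    proof (cases "y \<in> E \<and> w0 \<le> w y")
      case True
      then show ?thesis using split_weight[OF w0 _ \<tau>(1) g0[of y], of "w y" ?n] by (simp add: r_def)
    next
      case False
      then have "indicator E y * (if w0 \<le> w y then (w y)\<^sup>2 / ?g y else 0) = 0" by auto
      also have "0 \<le> \<tau> * (indicator E y * w y) + 1 / w0 ^ ?n * (?h y * ?a y) + 1 / \<tau> ^ ?n * (?h y * ?b y)"
        using w0 \<tau> h0 a0 w_nonneg[of y] by (intro add_nonneg_nonneg mult_nonneg_nonneg) auto
      finally show ?thesis .
    qed
    then have "ennreal (indicator E y * (if w0 \<le> w y then (w y)\<^sup>2 / ?g y else 0))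
       \<le> ennreal (\<tau> * (indicator E y * w y) + 1 / w0 ^ ?n * (?h y * ?a y) + 1 / \<tau> ^ ?n * (?h y * ?b y))"
      by (rule ennreal_leI)
    also have "\<dots> = ennreal \<tau> * ennreal (indicator E y * w y) + ennreal (1 / w0 ^ ?n) * (ennreal (?h y) * ennreal (?a y))
         + ennreal (1 / \<tau> ^ ?n) * (ennreal (?h y) * ennreal (?b y))"
      by (rule ennreal_combination) (use w0 \<tau> h0 a0 w_nonneg[of y] in auto)
    finally show "ennreal (indicator E y * (if w0 \<le> w y then (w y)\<^sup>2 / ?g y else 0)) \<le> \<dots>" .
  qed
  also have "\<dots> = ennreal \<tau> * ennreal lam + ennreal (1 / w0 ^ ?n) * (\<integral>\<^sup>+y. ennreal (?h y) * ennreal (?a y) \<partial>lborel)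
         + ennreal (1 / \<tau> ^ ?n) * (\<integral>\<^sup>+y. ennreal (?h y) * ennreal (?b y) \<partial>lborel)"
    by (simp add: nn_integral_add nn_integral_cmult lam(1))
  also have "\<dots> \<le> ennreal \<tau> * ennreal lam + ennreal (1 / w0 ^ ?n) * ennreal (4 * cc * r ^ (?n - 1))
         + ennreal (1 / \<tau> ^ ?n) * ennreal (2 ^ Suc ?n * cc / r)"
    by (intro add_mono mult_left_mono Ia Ib order_refl) auto
  also have "\<dots> = ennreal (\<tau> * lam + 1 / w0 ^ ?n * (4 * cc * r ^ (?n - 1)) + 1 / \<tau> ^ ?n * (2 ^ Suc ?n * cc / r))"
    by (rule ennreal_combination'[symmetric]) (use w0 \<tau>(1) r cc lam(2) in auto)
  also have "\<tau> * lam + 1 / w0 ^ ?n * (4 * cc * r ^ (?n - 1)) + 1 / \<tau> ^ ?n * (2 ^ Suc ?n * cc / r) = weight_const CARD('n) l1 * \<tau> * lam"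
  proof -
    obtain m where m: "?n = Suc m" by (metis Suc_pred zero_less_card_finite)
    have \<tau>': "1 / (w0 * \<tau> ^ ?n) = lam" using \<tau> w0 lam(2) by (simp add: field_simps)
    have "1 / w0 ^ ?n * r ^ (?n - 1) = \<tau> * (1 / (w0 * \<tau> ^ ?n))"
      using w0 \<tau>(1) unfolding m by (simp add: r_def power_divide)
    then have 1: "1 / w0 ^ ?n * r ^ (?n - 1) = \<tau> * lam" unfolding \<tau>' .
    have "1 / \<tau> ^ ?n * (1 / r) = \<tau> * (1 / (w0 * \<tau> ^ ?n))"
      using w0 \<tau>(1) by (simp add: r_def)
    then have 2: "1 / \<tau> ^ ?n * (1 / r) = \<tau> * lam" unfolding \<tau>' .
    have "\<tau> * lam + 1 / w0 ^ ?n * (4 * cc * r ^ (?n - 1)) + 1 / \<tau> ^ ?n * (2 ^ Suc ?n * cc / r)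
       = \<tau> * lam + 4 * cc * (1 / w0 ^ ?n * r ^ (?n - 1)) + 2 ^ Suc ?n * cc * (1 / \<tau> ^ ?n * (1 / r))"
      by simp
    also have "\<dots> = weight_const CARD('n) l1 * \<tau> * lam" unfolding 1 2 by (simp add: weight_const_def cc_def algebra_simps)
    finally show ?thesis .
  qed
  finally show ?thesis .
qed

text \<open>
  The weight \<open>g = \<Sum>_i |(L \<psi>)_i|\<close> of the unimodular normalisation splits the inner integral by
  Cauchy-Schwarz: one factor is \<open>n m\<close> with \<open>m^n \<le> N(x)\<close>, the other one is bounded by
  \<open>weight_integral_bound\<close> with \<open>w0 = w(x)\<close>. The factor \<open>w(x)\<close> on the left-hand side compensates
  exactly the power of \<open>w0\<close> which that bound loses.
\<close>

lemma fibre_bound: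
  fixes f :: "(real^'n) \<times> real \<Rightarrow> real"
  assumes n: "2 \<le> CARD('n)" and E[measurable]: "E \<in> sets borel" and Eb: "bounded E"
    and EG: "\<And>y. y \<in> E \<Longrightarrow> norm (G y) \<le> K" and Ew: "\<And>y. y \<in> E \<Longrightarrow> 0 < w y"
    and lam: "(\<integral>\<^sup>+y. ennreal (indicator E y * w y) \<partial>lborel) = ennreal lam" "0 < lam"
    and f[measurable]: "f \<in> borel_measurable borel" and f0: "\<And>p. 0 \<le> f p" and fb: "\<And>p. f p \<le> B"
    and x: "x \<in> E"
  shows "ennreal (w x) * (\<integral>\<^sup>+y. ennreal (indicator E y * (if w x \<le> w y then w y * f (\<gamma> x - \<gamma> y) else 0)) \<partial>lborel) ^ (2 * CARD('n))
     \<le> ennreal ((real CARD('n) * weight_const CARD('n) l1) ^ CARD('n) * lam ^ (CARD('n) - 1)) *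
       (\<integral>\<^sup>+y. (\<Prod>i\<in>UNIV. ennreal (indicator E (y $ i) * (if w x \<le> w (y $ i) then (f (\<gamma> x - \<gamma> (y $ i)))\<^sup>2 else 0)))
          * ennreal \<bar>det (\<chi> i. G (y $ i) - G x)\<bar> \<partial>lborel)"
proof -
  let ?n = "CARD('n)"
  have n0: "0 < ?n" by simp
  define T where "T = (\<integral>\<^sup>+y. ennreal (indicator E y * (if w x \<le> w y then w y * f (\<gamma> x - \<gamma> y) else 0)) \<partial>lborel)"
  define \<kappa> where "\<kappa> y = indicator E y * (if w x \<le> w y then (f (\<gamma> x - \<gamma> y))\<^sup>2 else 0)" for y
  define \<psi> where "\<psi> y = G y - G x" for y
  have \<kappa>m[measurable]: "\<kappa> \<in> borel_measurable borel" unfolding \<kappa>_def[abs_def] by measurable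
  have \<psi>m[measurable]: "\<psi> \<in> borel_measurable borel" unfolding \<psi>_def[abs_def] by measurable
  have \<kappa>0: "0 \<le> \<kappa> y" for y by (simp add: \<kappa>_def)
  have \<kappa>E: "\<kappa> y \<noteq> 0 \<Longrightarrow> y \<in> E" for y by (auto simp: \<kappa>_def indicator_def split: if_splits)
  have B0: "0 \<le> B" using f0[of 0] fb[of 0] by simp
  have K0: "0 \<le> K" using EG[OF x] norm_ge_zero order_trans by blast
  have w0: "0 < w x" using Ew x .
  show ?thesis
  proof (cases "AE y in lborel. \<kappa> y = 0")
    case True
    then have "AE y in lborel. ennreal (indicator E y * (if w x \<le> w y then w y * f (\<gamma> x - \<gamma> y) else 0)) = 0"
      by eventually_elim (auto simp: \<kappa>_def indicator_def split: if_splits)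
    then have "T = 0" unfolding T_def by (subst nn_integral_0_iff_AE) auto
    then show ?thesis unfolding T_def[symmetric] using n0 by (simp add: zero_power)
  next
    case False
    have fin: "emeasure lborel E < \<infinity>" using Eb by (rule emeasure_bounded_finite)
    have int: "integrable lborel (\<lambda>y. \<kappa> y * norm (\<psi> y))"
    proof (rule Bochner_Integration.integrable_bound[of _ "\<lambda>y. indicator E y * (B\<^sup>2 * (2 * K))"])
      show "integrable lborel (\<lambda>y. indicator E y * (B\<^sup>2 * (2 * K)))"
        using E fin by (simp add: less_top)
      show "AE y in lborel. norm (\<kappa> y * norm (\<psi> y)) \<le> norm (indicator E y * (B\<^sup>2 * (2 * K)))"
      proof (rule AE_I2)
        fix y
        show "norm (\<kappa> y * norm (\<psi> y)) \<le> norm (indicator E y * (B\<^sup>2 * (2 * K)))"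
        proof (cases "y \<in> E")
          case True
          have "norm (\<psi> y) \<le> 2 * K" unfolding \<psi>_def using norm_triangle_ineq4[of "G y" "G x"] EG[OF True] EG[OF x] by linarith
          moreover have "\<kappa> y \<le> B\<^sup>2" using power_mono[OF fb f0, of _ 2] by (simp add: \<kappa>_def indicator_def)
          ultimately have "\<kappa> y * norm (\<psi> y) \<le> B\<^sup>2 * (2 * K)" using \<kappa>0 by (intro mult_mono) auto
          then show ?thesis using True \<kappa>0[of y] K0 by simp
        qed (simp add: \<kappa>_def)
      qed
    qed measurable
    have nondeg: "AE y in lborel. y \<in> E \<longrightarrow> l \<bullet> \<psi> y \<noteq> 0" if "l \<noteq> 0" for l
      using AE_grad_hyperplane[OF that, of "G x"] by eventually_elim (auto simp: \<psi>_def Ew)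
    have nondeg': "AE y in lborel. \<kappa> y \<noteq> 0 \<longrightarrow> l \<bullet> \<psi> y \<noteq> 0" if "l \<noteq> 0" for l
      using nondeg[OF that] by eventually_elim (auto dest: \<kappa>E)
    obtain L m where L: "det L = 1" "m > 0"
      "\<And>i. integrable lborel (\<lambda>y. \<kappa> y * \<bar>(L *v \<psi> y) $ i\<bar>)"
      "\<And>i. (LINT y|lborel. \<kappa> y * \<bar>(L *v \<psi> y) $ i\<bar>) = m"
      "ennreal (m ^ ?n) \<le> (\<integral>\<^sup>+y. (\<Prod>i\<in>UNIV. ennreal (\<kappa> (y $ i))) * ennreal \<bar>det (\<chi> i. \<psi> (y $ i))\<bar> \<partial>lborel)"
      using unimodular_normalisation[OF \<kappa>0 \<kappa>m \<psi>m int nondeg' False] by blast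
    define g where "g y = (\<Sum>i\<in>UNIV. \<bar>(L *v (G y - G x)) $ i\<bar>)" for y
    have gm[measurable]: "g \<in> borel_measurable borel" unfolding g_def[abs_def] matrix_vector_nth by measurable
    have g0: "0 \<le> g y" for y unfolding g_def by (intro sum_nonneg) auto
    have gpos: "AE y in lborel. y \<in> E \<longrightarrow> 0 < g y"
    proof -
      fix i0 :: 'n
      have "L $ i0 \<noteq> 0"
      proof
        assume "L $ i0 = 0"
        then have "det L = 0" by (intro det_zero_row[of i0]) (simp add: row_def vec_eq_iff)
        then show False using L(1) by simp
      qed
      from nondeg[OF this] show ?thesis
      proof eventually_elim
        case (elim y)
        have "\<bar>(L *v (G y - G x)) $ i0\<bar> \<le> g y" unfolding g_def by (rule member_le_sum) auto
        then show ?case using elim by (auto simp: matrix_vector_nth \<psi>_def)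
      qed
    qed
    \<comment> \<open>The threshold at which the regimes of the weight balance.\<close>
    define \<tau> where "\<tau> = root ?n (1 / (w x * lam))"
    have \<tau>: "0 < \<tau>" "\<tau> ^ ?n * (w x * lam) = 1"
    proof -
      have "0 < 1 / (w x * lam)" using w0 lam(2) by simp
      then show "0 < \<tau>" "\<tau> ^ ?n * (w x * lam) = 1"
        using w0 lam(2) by (simp_all add: \<tau>_def real_root_pow_pos2 less_imp_le)
    qed
    let ?b = "\<lambda>y. indicator E y * (if w x \<le> w y then w y / sqrt (g y) else 0)"
    have Teq: "T = (\<integral>\<^sup>+y. ennreal (sqrt (\<kappa> y * g y)) * ennreal (?b y) \<partial>lborel)"
      unfolding T_def
    proof (rule nn_integral_cong_AE)
      show "AE y in lborel. ennreal (indicator E y * (if w x \<le> w y then w y * f (\<gamma> x - \<gamma> y) else 0))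
          = ennreal (sqrt (\<kappa> y * g y)) * ennreal (?b y)"
        using gpos
      proof eventually_elim
        case (elim y)
        show ?case
        proof (cases "y \<in> E \<and> w x \<le> w y")
          case True
          then have "sqrt (\<kappa> y * g y) * ?b y = w y * f (\<gamma> x - \<gamma> y)"
            using elim f0 by (simp add: \<kappa>_def real_sqrt_mult)
          moreover have "0 \<le> ?b y" using w_nonneg[of y] g0[of y] by simp
          ultimately show ?thesis using True \<kappa>0[of y] g0[of y] by (simp flip: ennreal_mult)
        qed auto
      qed
    qed
    have "T\<^sup>2 \<le> (\<integral>\<^sup>+y. (ennreal (sqrt (\<kappa> y * g y)))\<^sup>2 \<partial>lborel) * (\<integral>\<^sup>+y. (ennreal (?b y))\<^sup>2 \<partial>lborel)"
      unfolding Teq by (rule Cauchy_Schwarz_nn_integral) measurable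
    also have "(\<integral>\<^sup>+y. (ennreal (sqrt (\<kappa> y * g y)))\<^sup>2 \<partial>lborel) = ennreal (real ?n * m)"
    proof -
      have "(\<integral>\<^sup>+y. (ennreal (sqrt (\<kappa> y * g y)))\<^sup>2 \<partial>lborel) = (\<integral>\<^sup>+y. ennreal (\<Sum>i\<in>UNIV. \<kappa> y * \<bar>(L *v \<psi> y) $ i\<bar>) \<partial>lborel)"
        using \<kappa>0 g0 by (intro nn_integral_cong) (simp add: ennreal_power g_def \<psi>_def sum_distrib_left sum_nonneg)
      also have "\<dots> = ennreal (LINT y|lborel. (\<Sum>i\<in>UNIV. \<kappa> y * \<bar>(L *v \<psi> y) $ i\<bar>))"
        using L(3) \<kappa>0 by (intro nn_integral_eq_integral) (auto intro!: sum_nonneg)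
      also have "(LINT y|lborel. (\<Sum>i\<in>UNIV. \<kappa> y * \<bar>(L *v \<psi> y) $ i\<bar>)) = real ?n * m"
        using L(3) by (subst Bochner_Integration.integral_sum) (auto simp: L(4))
      finally show ?thesis .
    qed
    also have "(\<integral>\<^sup>+y. (ennreal (?b y))\<^sup>2 \<partial>lborel) \<le> ennreal (weight_const CARD('n) l1 * \<tau> * lam)"
    proof -
      have "(\<integral>\<^sup>+y. (ennreal (?b y))\<^sup>2 \<partial>lborel) = (\<integral>\<^sup>+y. ennreal (indicator E y * (if w x \<le> w y then (w y)\<^sup>2 / g y else 0)) \<partial>lborel)"
        using g0 w_nonneg by (intro nn_integral_cong) (simp add: ennreal_power power_divide indicator_def)
      also have "\<dots> \<le> ennreal (weight_const CARD('n) l1 * \<tau> * lam)"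
        unfolding g_def by (rule weight_integral_bound[OF n E lam w0 L(1) \<tau>])
      finally show ?thesis .
    qed
    finally have T2: "T\<^sup>2 \<le> ennreal (real ?n * m) * ennreal (weight_const CARD('n) l1 * \<tau> * lam)" by (simp add: mult_left_mono)
    have "ennreal (w x) * T ^ (2 * ?n) = ennreal (w x) * (T\<^sup>2) ^ ?n" by (simp add: power_mult)
    also have "\<dots> \<le> ennreal (w x) * (ennreal (real ?n * m) * ennreal (weight_const CARD('n) l1 * \<tau> * lam)) ^ ?n"
      by (intro mult_left_mono power_mono T2) auto
    also have "\<dots> = ennreal (w x * (real ?n * m * (weight_const CARD('n) l1 * \<tau> * lam)) ^ ?n)"
    proof -
      have p: "0 \<le> real ?n * m" "0 \<le> weight_const CARD('n) l1 * \<tau> * lam" using L(2) weight_const_pos[of "CARD('n)" l1] \<tau>(1) lam(2) by simp_all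
      then have "ennreal (real ?n * m) * ennreal (weight_const CARD('n) l1 * \<tau> * lam) = ennreal (real ?n * m * (weight_const CARD('n) l1 * \<tau> * lam))"
        by (rule ennreal_mult[symmetric])
      moreover have "0 \<le> real ?n * m * (weight_const CARD('n) l1 * \<tau> * lam)" using p by (rule mult_nonneg_nonneg)
      ultimately show ?thesis using w0 by (simp only: ennreal_power ennreal_mult zero_le_power less_imp_le)
    qed
    also have "w x * (real ?n * m * (weight_const CARD('n) l1 * \<tau> * lam)) ^ ?n = (real ?n * weight_const CARD('n) l1) ^ ?n * lam ^ (?n - 1) * m ^ ?n * (\<tau> ^ ?n * (w x * lam))"
    proof -
      have "lam ^ ?n = lam ^ (?n - 1) * lam" using n0 by (metis power_minus_mult)
      then show ?thesis by (simp add: power_mult_distrib mult_ac)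
    qed
    also have "\<dots> = (real ?n * weight_const CARD('n) l1) ^ ?n * lam ^ (?n - 1) * m ^ ?n" by (simp add: \<tau>(2))
    also have "ennreal \<dots> = ennreal ((real ?n * weight_const CARD('n) l1) ^ ?n * lam ^ (?n - 1)) * ennreal (m ^ ?n)"
      using weight_const_pos[of "CARD('n)" l1] lam(2) L(2) by (intro ennreal_mult) auto
    also have "\<dots> \<le> ennreal ((real ?n * weight_const CARD('n) l1) ^ ?n * lam ^ (?n - 1)) *
        (\<integral>\<^sup>+y. (\<Prod>i\<in>UNIV. ennreal (\<kappa> (y $ i))) * ennreal \<bar>det (\<chi> i. \<psi> (y $ i))\<bar> \<partial>lborel)"
      by (intro mult_left_mono L(5)) auto
    finally show ?thesis unfolding T_def \<kappa>_def \<psi>_def .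
  qed
qed

end

section \<open>The energy estimate\<close>

lemma ennreal_power_root_le:
  assumes "(a::ennreal) ^ (2 * n) \<le> ennreal X * b ^ n" and n: "0 < n" and X: "0 \<le> X"
  shows "a\<^sup>2 \<le> ennreal (root n X) * b"
proof (cases "X = 0")
  case True
  then have "a ^ (2 * n) = 0" using assms(1) by simp
  then show ?thesis using n by simp
next
  case False
  then have X0: "0 < X" using X by simp
  then have R0: "0 < root n X" using n by simp
  show ?thesis
  proof (cases "b = \<infinity>")
    case True
    then show ?thesis using R0 by (simp add: ennreal_mult_top)
  next
    case False
    then obtain b' where b: "b = ennreal b'" "0 \<le> b'" by (cases b) auto
    have R: "ennreal X * b ^ n = ennreal ((root n X * b') ^ n)"
      using b X0 n by (simp add: ennreal_power ennreal_mult power_mult_distrib flip: ennreal_mult)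
    have "a ^ (2 * n) < \<infinity>" using assms(1) unfolding R by (rule le_less_trans) simp
    then have "a \<noteq> \<infinity>" using n by (auto simp: power_eq_top_ennreal)
    then obtain a' where a: "a = ennreal a'" "0 \<le> a'" by (cases a) auto
    have "(a'\<^sup>2) ^ n \<le> (root n X * b') ^ n"
      using assms(1) b(2) R0 a(2) unfolding R a(1) by (simp add: ennreal_power power_mult)
    then have "a'\<^sup>2 \<le> root n X * b'"
      using b(2) R0 n by (subst (asm) power_mono_iff) auto
    then show ?thesis using a b R0 by (simp add: ennreal_power ennreal_leI flip: ennreal_mult)
  qed
qed

lemma ennreal_power2_le_imp_le:
  assumes le: "(x::ennreal)\<^sup>2 \<le> y\<^sup>2"
  shows "x \<le> y"
proof (cases y)
  case y: (real b)
  show ?thesis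
  proof (cases x)
    case x: (real a)
    have "ennreal (a\<^sup>2) \<le> ennreal (b\<^sup>2)" using le x y by (simp only: ennreal_power)
    then have "a\<^sup>2 \<le> b\<^sup>2" using x y by simp
    then have "a \<le> b" using y(1) by (rule power2_le_imp_le)
    then show ?thesis unfolding x(2) y(2) by (rule ennreal_leI)
  next
    case top
    then have "x\<^sup>2 = top" by (simp add: power2_eq_square ennreal_top_mult)
    moreover have "y\<^sup>2 = ennreal (b\<^sup>2)" using y by (simp add: ennreal_power)
    ultimately show ?thesis using le by (simp add: top_unique)
  qed
qed simp

lemma SUP_min_of_nat_ennreal: "(SUP k::nat. min (a::ennreal) (of_nat k)) = a"
proof -
  have "(SUP k::nat. inf a (of_nat k)) = inf a (SUP k::nat. of_nat k)" by (rule inf_SUP[symmetric])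
  then show ?thesis by (simp add: inf_min ennreal_SUP_of_nat_eq_top)
qed

lemma ennreal_add_power_le:
  fixes a b :: ennreal
  assumes "a ^ k \<le> D" "b ^ k \<le> D"
  shows "(a + b) ^ k \<le> 2 ^ k * D"
proof -
  have "a + b \<le> 2 * max a b" unfolding mult_2 by (intro add_mono) auto
  then have "(a + b) ^ k \<le> (2 * max a b) ^ k" by (rule power_mono) simp
  also have "\<dots> = 2 ^ k * max a b ^ k" by (rule power_mult_distrib)
  also have "\<dots> \<le> 2 ^ k * D" using assms by (intro mult_left_mono) (auto simp: max_def)
  finally show ?thesis .
qed

context hypersurface
begin

text \<open>
  A piece of the surface of positive and finite measure \<open>lam\<close> on which all the integrals converge;
  every set of finite measure is, up to a null set, an increasing union of such pieces.
\<close>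

definition bounded_piece :: "(real^'n) set \<Rightarrow> real \<Rightarrow> bool" where
  "bounded_piece E lam \<longleftrightarrow> E \<in> sets borel \<and> E \<subseteq> \<Omega> \<and> bounded E \<and> (\<exists>K. \<forall>y\<in>E. norm (G y) \<le> K) \<and> (\<forall>y\<in>E. 0 < w y) \<and>
     (\<integral>\<^sup>+y. ennreal (indicator E y * w y) \<partial>lborel) = ennreal lam \<and> 0 < lam"

lemma fibre_const_pos: "0 < fibre_const CARD('n) l1"
  unfolding fibre_const_def using weight_const_pos by (intro zero_less_power mult_pos_pos) auto

text \<open>
  The fibre estimate is integrated over \<open>x\<close>, after Jensen's inequality with respect to the surface
  measure has moved the power \<open>2n\<close> inside.
\<close>

lemma half_energy_bound:
  fixes f :: "(real^'n) \<times> real \<Rightarrow> real"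
  assumes n: "2 \<le> CARD('n)" and bounded_piece: "bounded_piece E lam"
    and f[measurable]: "f \<in> borel_measurable borel" and f0: "\<And>p. 0 \<le> f p" and fb: "\<And>p. f p \<le> B"
  shows "(\<integral>\<^sup>+x. ennreal (indicator E x * w x) * (\<integral>\<^sup>+y. ennreal (indicator E y * (if w x \<le> w y then w y * f (\<gamma> x - \<gamma> y) else 0)) \<partial>lborel) \<partial>lborel) ^ (2 * CARD('n))
    \<le> ennreal (lam ^ (3 * CARD('n) - 2) * fibre_const CARD('n) l1 * real l2) * (\<integral>\<^sup>+p. ennreal ((f p)\<^sup>2) \<partial>lborel) ^ CARD('n)"
proof -
  let ?n = "CARD('n)"
  obtain K where E[measurable]: "E \<in> sets borel" and E\<Omega>: "E \<subseteq> \<Omega>" and Eb: "bounded E" and EG: "\<And>y. y \<in> E \<Longrightarrow> norm (G y) \<le> K"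
    and Ew: "\<And>y. y \<in> E \<Longrightarrow> 0 < w y" and lam: "(\<integral>\<^sup>+y. ennreal (indicator E y * w y) \<partial>lborel) = ennreal lam" "0 < lam"
    using bounded_piece unfolding bounded_piece_def by (elim conjE exE) auto
  define T where "T x = (\<integral>\<^sup>+y. ennreal (indicator E y * (if w x \<le> w y then w y * f (\<gamma> x - \<gamma> y) else 0)) \<partial>lborel)" for x
  have Tm[measurable]: "T \<in> borel_measurable borel" unfolding T_def[abs_def] by measurable
  let ?M = "density lborel (\<lambda>x. ennreal (indicator E x * w x))"
  have A: "(\<integral>\<^sup>+x. ennreal (indicator E x * w x) * F x \<partial>lborel) = (\<integral>\<^sup>+x. F x \<partial>?M)"
    if [measurable]: "F \<in> borel_measurable borel" for F
    by (rule nn_integral_density[symmetric]) measurable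
  have mass: "emeasure ?M (space ?M) = ennreal lam"
    using lam(1) by (simp add: emeasure_density space_density)
  have B0: "0 \<le> B" using f0[of 0] fb[of 0] by simp
  have TB: "T x \<le> ennreal (B * lam)" for x
  proof -
    have "T x \<le> (\<integral>\<^sup>+y. ennreal B * ennreal (indicator E y * w y) \<partial>lborel)"
      unfolding T_def
    proof (rule nn_integral_mono)
      fix y
      have "w y * f (\<gamma> x - \<gamma> y) \<le> w y * B" using w_nonneg fb by (intro mult_left_mono) auto
      then have "indicator E y * (if w x \<le> w y then w y * f (\<gamma> x - \<gamma> y) else 0) \<le> B * (indicator E y * w y)"
        using w_nonneg[of y] B0 by (auto simp: indicator_def mult.commute)
      then show "ennreal (indicator E y * (if w x \<le> w y then w y * f (\<gamma> x - \<gamma> y) else 0)) \<le> ennreal B * ennreal (indicator E y * w y)"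
        using w_nonneg[of y] B0 by (subst ennreal_mult[symmetric]) (auto intro: ennreal_leI)
    qed
    also have "\<dots> = ennreal (B * lam)"
      using B0 lam(2) by (simp add: nn_integral_cmult lam(1) ennreal_mult)
    finally show ?thesis .
  qed
  have fin: "(\<integral>\<^sup>+x. T x \<partial>?M) < \<infinity>"
  proof -
    have "(\<integral>\<^sup>+x. T x \<partial>?M) \<le> (\<integral>\<^sup>+x. ennreal (B * lam) \<partial>?M)" by (intro nn_integral_mono TB)
    also have "\<dots> = ennreal (B * lam) * ennreal lam" unfolding nn_integral_const mass ..
    also have "\<dots> < \<infinity>" by (simp add: ennreal_mult_less_top)
    finally show ?thesis .
  qed
  have pow: "(\<integral>\<^sup>+x. T x \<partial>?M) ^ Suc (2 * ?n - 1) \<le> ennreal (lam ^ (2 * ?n - 1)) * (\<integral>\<^sup>+x. T x ^ Suc (2 * ?n - 1) \<partial>?M)"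
    by (rule nn_integral_power_le[OF _ fin mass lam(2)]) measurable
  have Suc: "Suc (2 * ?n - 1) = 2 * ?n" by simp
  let ?N = "\<lambda>x. \<integral>\<^sup>+y. indicator \<Omega> x * (\<Prod>i\<in>UNIV. indicator \<Omega> (y $ i) * ennreal ((f (\<gamma> x - \<gamma> (y $ i)))\<^sup>2))
           * ennreal \<bar>det (\<chi> i. G (y $ i) - G x)\<bar> \<partial>lborel"
  let ?C = "ennreal (fibre_const CARD('n) l1 * lam ^ (?n - 1))"
  have "(\<integral>\<^sup>+x. T x ^ (2 * ?n) \<partial>?M) = (\<integral>\<^sup>+x. ennreal (indicator E x * w x) * T x ^ (2 * ?n) \<partial>lborel)"
    by (rule A[symmetric]) measurable
  also have "\<dots> \<le> (\<integral>\<^sup>+x. ?C * ?N x \<partial>lborel)"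
  proof (rule nn_integral_mono)
    fix x
    show "ennreal (indicator E x * w x) * T x ^ (2 * ?n) \<le> ?C * ?N x"
    proof (cases "x \<in> E")
      case True
      have "ennreal (w x) * T x ^ (2 * ?n) \<le> ?C * (\<integral>\<^sup>+y. (\<Prod>i\<in>UNIV. ennreal (indicator E (y $ i) * (if w x \<le> w (y $ i) then (f (\<gamma> x - \<gamma> (y $ i)))\<^sup>2 else 0)))
          * ennreal \<bar>det (\<chi> i. G (y $ i) - G x)\<bar> \<partial>lborel)"
        unfolding T_def fibre_const_def by (rule fibre_bound[OF n E Eb EG Ew lam f f0 fb True])
      also have "\<dots> \<le> ?C * ?N x"
      proof (intro mult_left_mono nn_integral_mono)
        fix y :: "(real^'n)^'n"
        have "(\<Prod>i\<in>UNIV. ennreal (indicator E (y $ i) * (if w x \<le> w (y $ i) then (f (\<gamma> x - \<gamma> (y $ i)))\<^sup>2 else 0)))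
            \<le> (\<Prod>i\<in>UNIV. indicator \<Omega> (y $ i) * ennreal ((f (\<gamma> x - \<gamma> (y $ i)))\<^sup>2))"
        proof -
          have "indicator \<Omega> (y $ i) * ennreal ((f (\<gamma> x - \<gamma> (y $ i)))\<^sup>2) = ennreal (indicator \<Omega> (y $ i) * (f (\<gamma> x - \<gamma> (y $ i)))\<^sup>2)" for i
            by (simp add: indicator_def)
          moreover have "(\<Prod>i\<in>UNIV. indicator E (y $ i) * (if w x \<le> w (y $ i) then (f (\<gamma> x - \<gamma> (y $ i)))\<^sup>2 else 0))
              \<le> (\<Prod>i\<in>UNIV. indicator \<Omega> (y $ i) * (f (\<gamma> x - \<gamma> (y $ i)))\<^sup>2)"
            using E\<Omega> by (intro prod_mono) (auto simp: indicator_def)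
          ultimately show ?thesis by (simp add: prod_ennreal ennreal_leI)
        qed
        moreover have "indicator \<Omega> x = (1::ennreal)" using True E\<Omega> by auto
        ultimately show "(\<Prod>i\<in>UNIV. ennreal (indicator E (y $ i) * (if w x \<le> w (y $ i) then (f (\<gamma> x - \<gamma> (y $ i)))\<^sup>2 else 0)))
          * ennreal \<bar>det (\<chi> i. G (y $ i) - G x)\<bar>
           \<le> indicator \<Omega> x * (\<Prod>i\<in>UNIV. indicator \<Omega> (y $ i) * ennreal ((f (\<gamma> x - \<gamma> (y $ i)))\<^sup>2))
           * ennreal \<bar>det (\<chi> i. G (y $ i) - G x)\<bar>"
          by (simp add: mult_right_mono)
      qed simp
      finally show ?thesis using True by simp
    qed simp
  qed
  also have "\<dots> = ?C * (\<integral>\<^sup>+x. ?N x \<partial>lborel)" by (rule nn_integral_cmult) measurable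
  also have "\<dots> \<le> ?C * (of_nat l2 * (\<integral>\<^sup>+p. ennreal ((f p)\<^sup>2) \<partial>lborel) ^ ?n)"
    by (intro mult_left_mono nn_integral_Psi) auto
  finally have X: "(\<integral>\<^sup>+x. T x ^ (2 * ?n) \<partial>?M) \<le> ?C * (of_nat l2 * (\<integral>\<^sup>+p. ennreal ((f p)\<^sup>2) \<partial>lborel) ^ ?n)" .
  have "(\<integral>\<^sup>+x. ennreal (indicator E x * w x) * T x \<partial>lborel) ^ (2 * ?n) = (\<integral>\<^sup>+x. T x \<partial>?M) ^ (2 * ?n)"
    by (subst A) measurable
  also have "\<dots> \<le> ennreal (lam ^ (2 * ?n - 1)) * (\<integral>\<^sup>+x. T x ^ (2 * ?n) \<partial>?M)"
    using pow unfolding Suc .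
  also have "\<dots> \<le> ennreal (lam ^ (2 * ?n - 1)) * (?C * (of_nat l2 * (\<integral>\<^sup>+p. ennreal ((f p)\<^sup>2) \<partial>lborel) ^ ?n))"
    by (intro mult_left_mono X) auto
  also have "\<dots> = ennreal (lam ^ (2 * ?n - 1)) * (ennreal (fibre_const CARD('n) l1 * lam ^ (?n - 1)) * ennreal (real l2)) * (\<integral>\<^sup>+p. ennreal ((f p)\<^sup>2) \<partial>lborel) ^ ?n"
    by (simp add: ennreal_of_nat_eq_real_of_nat mult.assoc)
  also have "ennreal (lam ^ (2 * ?n - 1)) * (ennreal (fibre_const CARD('n) l1 * lam ^ (?n - 1)) * ennreal (real l2)) = ennreal (lam ^ (2 * ?n - 1) * (fibre_const CARD('n) l1 * lam ^ (?n - 1) * real l2))"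
    using lam(2) fibre_const_pos by (simp only: ennreal_mult zero_le_power mult_nonneg_nonneg less_imp_le of_nat_0_le_iff)
  also have "lam ^ (2 * ?n - 1) * (fibre_const CARD('n) l1 * lam ^ (?n - 1) * real l2) = lam ^ (3 * ?n - 2) * fibre_const CARD('n) l1 * real l2"
  proof -
    have "3 * ?n - 2 = (2 * ?n - 1) + (?n - 1)" using n by simp
    then have "lam ^ (3 * ?n - 2) = lam ^ (2 * ?n - 1) * lam ^ (?n - 1)" by (simp only: power_add)
    then show ?thesis by simp
  qed
  finally show ?thesis unfolding T_def .
qed

text \<open>
  The half of the domain where \<open>w(y) \<le> w(x)\<close> becomes the other half upon exchanging \<open>x\<close> and \<open>y\<close> and
  replacing \<open>f\<close> by its reflection.
\<close>

lemma energy_bound_bounded: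
  fixes f :: "(real^'n) \<times> real \<Rightarrow> real"
  assumes n: "2 \<le> CARD('n)" and bounded_piece: "bounded_piece E lam"
    and f[measurable]: "f \<in> borel_measurable borel" and f0: "\<And>p. 0 \<le> f p" and fb: "\<And>p. f p \<le> B"
  shows "(\<integral>\<^sup>+x. (\<integral>\<^sup>+y. ennreal (indicator E x * w x) * ennreal (indicator E y * w y) * ennreal (f (\<gamma> x - \<gamma> y)) \<partial>lborel) \<partial>lborel)\<^sup>2
    \<le> ennreal (energy_const CARD('n) l1 l2 * root CARD('n) (lam ^ (3 * CARD('n) - 2))) * (\<integral>\<^sup>+p. ennreal ((f p)\<^sup>2) \<partial>lborel)"
proof -
  let ?n = "CARD('n)"
  have [measurable]: "E \<in> sets borel" and lam: "0 < lam" using bounded_piece unfolding bounded_piece_def by auto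
  define a where "a g x y = ennreal (indicator E x * w x) * ennreal (indicator E y * (if w x \<le> w y then w y * g (\<gamma> x - \<gamma> y) else 0))"
    for g :: "(real^'n) \<times> real \<Rightarrow> real" and x y
  define D where "D = ennreal (lam ^ (3 * ?n - 2) * fibre_const CARD('n) l1 * real l2) * (\<integral>\<^sup>+p. ennreal ((f p)\<^sup>2) \<partial>lborel) ^ ?n"
  have am: "(\<lambda>(x, y). a g x y) \<in> borel_measurable (lborel \<Otimes>\<^sub>M lborel)" if [measurable]: "g \<in> borel_measurable borel" for g
    unfolding a_def by measurable
  have aI: "(\<integral>\<^sup>+x. (\<integral>\<^sup>+y. a g x y \<partial>lborel) \<partial>lborel) = (\<integral>\<^sup>+x. ennreal (indicator E x * w x) * (\<integral>\<^sup>+y. ennreal (indicator E y * (if w x \<le> w y then w y * g (\<gamma> x - \<gamma> y) else 0)) \<partial>lborel) \<partial>lborel)"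
    if [measurable]: "g \<in> borel_measurable borel" for g
    unfolding a_def by (intro nn_integral_cong nn_integral_cmult) measurable
  let ?f' = "\<lambda>p. f (- p)"
  have f'm[measurable]: "?f' \<in> borel_measurable borel" by measurable
  have 1: "(\<integral>\<^sup>+x. (\<integral>\<^sup>+y. a f x y \<partial>lborel) \<partial>lborel) ^ (2 * ?n) \<le> D"
    unfolding aI[OF f] D_def by (rule half_energy_bound[OF n bounded_piece f f0 fb])
  have 2: "(\<integral>\<^sup>+x. (\<integral>\<^sup>+y. a ?f' x y \<partial>lborel) \<partial>lborel) ^ (2 * ?n) \<le> D"
  proof -
    have "(\<integral>\<^sup>+p. ennreal ((f (- p))\<^sup>2) \<partial>lborel) = (\<integral>\<^sup>+p. ennreal ((f p)\<^sup>2) \<partial>lborel)"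
      using nn_integral_lborel_reflect[of "\<lambda>p. ennreal ((f p)\<^sup>2)" 0] by simp
    then show ?thesis
      unfolding aI[OF f'm] D_def using half_energy_bound[OF n bounded_piece f'm f0 fb] by simp
  qed
  have "(\<integral>\<^sup>+x. (\<integral>\<^sup>+y. ennreal (indicator E x * w x) * ennreal (indicator E y * w y) * ennreal (f (\<gamma> x - \<gamma> y)) \<partial>lborel) \<partial>lborel)
     \<le> (\<integral>\<^sup>+x. (\<integral>\<^sup>+y. a f x y + a ?f' y x \<partial>lborel) \<partial>lborel)"
  proof (intro nn_integral_mono)
    fix x y
    have e: "ennreal (indicator E x * w x) * ennreal (indicator E y * w y) * ennreal (f (\<gamma> x - \<gamma> y))
      = ennreal (indicator E x * w x * (indicator E y * w y) * f (\<gamma> x - \<gamma> y))"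
      using w_nonneg f0 by (simp add: ennreal_mult)
    have "a f x y = ennreal (indicator E x * w x * (indicator E y * w y) * f (\<gamma> x - \<gamma> y))" if "w x \<le> w y"
      using w_nonneg f0 that by (simp add: a_def mult_ac flip: ennreal_mult)
    moreover have "a ?f' y x = ennreal (indicator E x * w x * (indicator E y * w y) * f (\<gamma> x - \<gamma> y))" if "w y \<le> w x"
      using w_nonneg f0 that by (simp add: a_def mult_ac flip: ennreal_mult)
    ultimately show "ennreal (indicator E x * w x) * ennreal (indicator E y * w y) * ennreal (f (\<gamma> x - \<gamma> y)) \<le> a f x y + a ?f' y x"
      unfolding e using linear[of "w x" "w y"] by (auto simp: add_increasing add_increasing2)
  qed
  also have "\<dots> = (\<integral>\<^sup>+x. (\<integral>\<^sup>+y. a f x y \<partial>lborel) + (\<integral>\<^sup>+y. a ?f' y x \<partial>lborel) \<partial>lborel)"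
    unfolding a_def by (intro nn_integral_cong nn_integral_add) measurable
  also have "\<dots> = (\<integral>\<^sup>+x. (\<integral>\<^sup>+y. a f x y \<partial>lborel) \<partial>lborel) + (\<integral>\<^sup>+x. (\<integral>\<^sup>+y. a ?f' y x \<partial>lborel) \<partial>lborel)"
    unfolding a_def by (rule nn_integral_add) measurable
  also have "(\<integral>\<^sup>+x. (\<integral>\<^sup>+y. a ?f' y x \<partial>lborel) \<partial>lborel) = (\<integral>\<^sup>+y. (\<integral>\<^sup>+x. a ?f' y x \<partial>lborel) \<partial>lborel)"
    by (rule lborel_pair.Fubini'[OF am[OF f'm]])
  finally have le: "(\<integral>\<^sup>+x. (\<integral>\<^sup>+y. ennreal (indicator E x * w x) * ennreal (indicator E y * w y) * ennreal (f (\<gamma> x - \<gamma> y)) \<partial>lborel) \<partial>lborel)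
     \<le> (\<integral>\<^sup>+x. (\<integral>\<^sup>+y. a f x y \<partial>lborel) \<partial>lborel) + (\<integral>\<^sup>+x. (\<integral>\<^sup>+y. a ?f' x y \<partial>lborel) \<partial>lborel)" (is "?I \<le> _") .
  have "?I ^ (2 * ?n) \<le> ((\<integral>\<^sup>+x. (\<integral>\<^sup>+y. a f x y \<partial>lborel) \<partial>lborel) + (\<integral>\<^sup>+x. (\<integral>\<^sup>+y. a ?f' x y \<partial>lborel) \<partial>lborel)) ^ (2 * ?n)"
    using le by (rule power_mono) simp
  also have "\<dots> \<le> 2 ^ (2 * ?n) * D" by (rule ennreal_add_power_le[OF 1 2])
  also have "\<dots> = ennreal (4 ^ ?n * fibre_const CARD('n) l1 * real l2 * lam ^ (3 * ?n - 2)) * (\<integral>\<^sup>+p. ennreal ((f p)\<^sup>2) \<partial>lborel) ^ ?n"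
  proof -
    have "(2::ennreal) ^ (2 * ?n) = ennreal (4 ^ ?n)" by (simp add: power_mult flip: ennreal_power)
    moreover have "ennreal (4 ^ ?n) * ennreal (lam ^ (3 * ?n - 2) * fibre_const CARD('n) l1 * real l2) = ennreal (4 ^ ?n * (lam ^ (3 * ?n - 2) * fibre_const CARD('n) l1 * real l2))"
      using lam fibre_const_pos by (intro ennreal_mult[symmetric]) auto
    moreover have "4 ^ ?n * (lam ^ (3 * ?n - 2) * fibre_const CARD('n) l1 * real l2) = 4 ^ ?n * fibre_const CARD('n) l1 * real l2 * lam ^ (3 * ?n - 2)"
      by simp
    ultimately show ?thesis unfolding D_def mult.assoc[symmetric] by simp
  qed
  finally have "?I\<^sup>2 \<le> ennreal (root ?n (4 ^ ?n * fibre_const CARD('n) l1 * real l2 * lam ^ (3 * ?n - 2))) * (\<integral>\<^sup>+p. ennreal ((f p)\<^sup>2) \<partial>lborel)"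
    by (rule ennreal_power_root_le) (use lam fibre_const_pos in auto)
  then show ?thesis by (simp add: energy_const_def real_root_mult)
qed

lemma energy_bound:
  fixes f :: "(real^'n) \<times> real \<Rightarrow> ennreal"
  assumes n: "2 \<le> CARD('n)" and bounded_piece: "bounded_piece E lam" and f[measurable]: "f \<in> borel_measurable borel"
  shows "(\<integral>\<^sup>+x. (\<integral>\<^sup>+y. ennreal (indicator E x * w x) * ennreal (indicator E y * w y) * f (\<gamma> x - \<gamma> y) \<partial>lborel) \<partial>lborel)\<^sup>2
    \<le> ennreal (energy_const CARD('n) l1 l2 * root CARD('n) (lam ^ (3 * CARD('n) - 2))) * (\<integral>\<^sup>+p. (f p)\<^sup>2 \<partial>lborel)"
proof (cases "ennreal (energy_const CARD('n) l1 l2 * root CARD('n) (lam ^ (3 * CARD('n) - 2))) * (\<integral>\<^sup>+p. (f p)\<^sup>2 \<partial>lborel) = \<infinity>")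
  case False
  have [measurable]: "E \<in> sets borel" using bounded_piece unfolding bounded_piece_def by auto
  define R where "R = enn2real (ennreal (energy_const CARD('n) l1 l2 * root CARD('n) (lam ^ (3 * CARD('n) - 2))) * (\<integral>\<^sup>+p. (f p)\<^sup>2 \<partial>lborel))"
  have R: "ennreal (energy_const CARD('n) l1 l2 * root CARD('n) (lam ^ (3 * CARD('n) - 2))) * (\<integral>\<^sup>+p. (f p)\<^sup>2 \<partial>lborel) = ennreal R" "0 \<le> R"
    using False by (simp_all add: R_def less_top)
  define fk where "fk k p = enn2real (min (f p) (of_nat k))" for k :: nat and p
  have fk: "ennreal (fk k p) = min (f p) (of_nat k)" for k p
    unfolding fk_def by (rule ennreal_enn2real) (simp add: min_less_iff_disj of_nat_less_top)
  let ?I = "\<lambda>g. \<integral>\<^sup>+x. (\<integral>\<^sup>+y. ennreal (indicator E x * w x) * ennreal (indicator E y * w y) * g (\<gamma> x - \<gamma> y) \<partial>lborel) \<partial>lborel"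
  have Ik: "?I (\<lambda>p. min (f p) (of_nat k)) \<le> ennreal (sqrt R)" for k :: nat
  proof -
    have m: "fk k \<in> borel_measurable borel" unfolding fk_def[abs_def] by measurable
    have b: "fk k p \<le> real k" for p
    proof -
      have "ennreal (fk k p) \<le> ennreal (real k)" unfolding fk by (simp add: ennreal_of_nat_eq_real_of_nat)
      then show ?thesis by simp
    qed
    have z: "0 \<le> fk k p" for p by (simp add: fk_def)
    have "(?I (\<lambda>p. ennreal (fk k p)))\<^sup>2 \<le> ennreal (energy_const CARD('n) l1 l2 * root CARD('n) (lam ^ (3 * CARD('n) - 2))) * (\<integral>\<^sup>+p. ennreal ((fk k p)\<^sup>2) \<partial>lborel)"
      by (rule energy_bound_bounded[OF n bounded_piece m z b])
    also have "\<dots> \<le> ennreal (energy_const CARD('n) l1 l2 * root CARD('n) (lam ^ (3 * CARD('n) - 2))) * (\<integral>\<^sup>+p. (f p)\<^sup>2 \<partial>lborel)"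
      using z by (intro mult_left_mono nn_integral_mono) (auto simp: fk power_mono simp flip: ennreal_power)
    also have "\<dots> = (ennreal (sqrt R))\<^sup>2" using R by (simp add: ennreal_power)
    finally have le: "(?I (\<lambda>p. ennreal (fk k p)))\<^sup>2 \<le> (ennreal (sqrt R))\<^sup>2" .
    have "?I (\<lambda>p. ennreal (fk k p)) \<le> ennreal (sqrt R)"
      using le by (rule ennreal_power2_le_imp_le)
    then show ?thesis by (simp add: fk)
  qed
  have "?I f = (SUP k::nat. ?I (\<lambda>p. min (f p) (of_nat k)))"
  proof -
    have "?I f = (\<integral>\<^sup>+x. (SUP k::nat. \<integral>\<^sup>+y. ennreal (indicator E x * w x) * ennreal (indicator E y * w y) * min (f (\<gamma> x - \<gamma> y)) (of_nat k) \<partial>lborel) \<partial>lborel)"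
    proof (rule nn_integral_cong)
      fix x
      have "(\<integral>\<^sup>+y. ennreal (indicator E x * w x) * ennreal (indicator E y * w y) * f (\<gamma> x - \<gamma> y) \<partial>lborel)
          = (\<integral>\<^sup>+y. (SUP k::nat. ennreal (indicator E x * w x) * ennreal (indicator E y * w y) * min (f (\<gamma> x - \<gamma> y)) (of_nat k)) \<partial>lborel)"
        by (simp only: SUP_mult_left_ennreal[symmetric] SUP_min_of_nat_ennreal)
      also have "\<dots> = (SUP k::nat. \<integral>\<^sup>+y. ennreal (indicator E x * w x) * ennreal (indicator E y * w y) * min (f (\<gamma> x - \<gamma> y)) (of_nat k) \<partial>lborel)"
        by (rule nn_integral_monotone_convergence_SUP)
           (auto intro!: monoI le_funI mult_left_mono min.mono)
      finally show "(\<integral>\<^sup>+y. ennreal (indicator E x * w x) * ennreal (indicator E y * w y) * f (\<gamma> x - \<gamma> y) \<partial>lborel) = \<dots>" .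
    qed
    also have "\<dots> = (SUP k::nat. ?I (\<lambda>p. min (f p) (of_nat k)))"
      by (rule nn_integral_monotone_convergence_SUP)
         (auto intro!: monoI le_funI nn_integral_mono mult_left_mono min.mono)
    finally show ?thesis .
  qed
  also have "\<dots> \<le> ennreal (sqrt R)" by (intro SUP_least Ik)
  finally have "(?I f)\<^sup>2 \<le> (ennreal (sqrt R))\<^sup>2" by (rule power_mono) simp
  then show ?thesis using R by (simp add: ennreal_power)
qed simp

end

section \<open>Gaussian regularisation of the Fourier transform\<close>

lemma gaussian_fourier_real:
  fixes t \<epsilon> :: real
  assumes e: "0 < \<epsilon>"
  shows "integrable lborel (\<lambda>u. cis (- (t * u)) * complex_of_real (exp (- (\<epsilon> * u\<^sup>2 / 2))))"
    and "(LINT u|lborel. cis (- (t * u)) * complex_of_real (exp (- (\<epsilon> * u\<^sup>2 / 2))))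
        = complex_of_real (sqrt (2 * pi / \<epsilon>) * exp (- (t\<^sup>2 / (2 * \<epsilon>))))"
proof -
  \<comment> \<open>The frequency left after the Gaussian is scaled to the standard normal density.\<close>
  define s where "s = - t / sqrt \<epsilon>"
  have se: "sqrt \<epsilon> > 0" using e by simp
  define f where "f x = std_normal_density x *\<^sub>R iexp (s * x)" for x
  interpret prob_space std_normal_distribution by (rule prob_space_normal_density) simp
  have i: "integrable std_normal_distribution (\<lambda>x. iexp (s * x))"
    by (rule integrable_const_bound[of _ 1]) auto
  have fi: "integrable lborel f"
    using i unfolding f_def by (subst (asm) integrable_density) auto
  have "(LINT x|lborel. f x) = (LINT x|std_normal_distribution. iexp (s * x))"
    unfolding f_def by (rule integral_density[symmetric]) auto
  also have "\<dots> = char std_normal_distribution s" by (simp add: char_def)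
  also have "\<dots> = complex_of_real (exp (- (s\<^sup>2) / 2))" by (simp add: char_std_normal_distribution)
  finally have If: "(LINT x|lborel. f x) = complex_of_real (exp (- (s\<^sup>2) / 2))" .
  have eq: "cis (- (t * u)) * complex_of_real (exp (- (\<epsilon> * u\<^sup>2 / 2))) = complex_of_real (sqrt (2 * pi)) * f (0 + sqrt \<epsilon> * u)" for u
  proof -
    have "s * (sqrt \<epsilon> * u) = - (t * u)" using se by (simp add: s_def)
    moreover have "(sqrt \<epsilon> * u)\<^sup>2 = \<epsilon> * u\<^sup>2" using e by (simp add: power_mult_distrib)
    ultimately have "f (sqrt \<epsilon> * u) = complex_of_real (1 / sqrt (2 * pi) * exp (- (\<epsilon> * u\<^sup>2) / 2)) * cis (- (t * u))"
      by (simp only: f_def std_normal_density_def scaleR_conv_of_real cis_conv_exp)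
    then show ?thesis by (simp add: mult_ac)
  qed
  show "integrable lborel (\<lambda>u. cis (- (t * u)) * complex_of_real (exp (- (\<epsilon> * u\<^sup>2 / 2))))"
    unfolding eq using se by (intro integrable_mult_right lborel_integrable_real_affine fi) simp
  have "(LINT x|lborel. f x) = \<bar>sqrt \<epsilon>\<bar> *\<^sub>R (LINT u|lborel. f (0 + sqrt \<epsilon> * u))"
    using se by (intro lborel_integral_real_affine) simp
  then have "(LINT u|lborel. f (0 + sqrt \<epsilon> * u)) = complex_of_real (exp (- (s\<^sup>2) / 2) / sqrt \<epsilon>)"
    using se unfolding If by (simp add: scaleR_conv_of_real field_simps)
  then have "(LINT u|lborel. cis (- (t * u)) * complex_of_real (exp (- (\<epsilon> * u\<^sup>2 / 2))))
      = complex_of_real (sqrt (2 * pi)) * complex_of_real (exp (- (s\<^sup>2) / 2) / sqrt \<epsilon>)"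
    unfolding eq by simp
  also have "\<dots> = complex_of_real (sqrt (2 * pi / \<epsilon>) * exp (- (t\<^sup>2 / (2 * \<epsilon>))))"
  proof -
    have "s\<^sup>2 / 2 = t\<^sup>2 / (2 * \<epsilon>)" using e by (simp add: s_def power_divide)
    then show ?thesis by (simp add: real_sqrt_divide)
  qed
  finally show "(LINT u|lborel. cis (- (t * u)) * complex_of_real (exp (- (\<epsilon> * u\<^sup>2 / 2))))
        = complex_of_real (sqrt (2 * pi / \<epsilon>) * exp (- (t\<^sup>2 / (2 * \<epsilon>))))" .
qed

lemma
  fixes F :: "'a::euclidean_space \<Rightarrow> real \<Rightarrow> 'b::{real_normed_field, banach, second_countable_topology}"
  assumes int: "\<And>b. b \<in> Basis \<Longrightarrow> integrable lborel (F b)"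
  shows integrable_prod_Basis: "integrable lborel (\<lambda>x. \<Prod>b\<in>Basis. F b (x \<bullet> b))"
    and integral_prod_Basis: "(LINT x|lborel. (\<Prod>b\<in>Basis. F b (x \<bullet> b))) = (\<Prod>b\<in>Basis. LINT u|lborel. F b u)"
proof -
  interpret product_sigma_finite "\<lambda>_::'a. lborel :: real measure" ..
  have [measurable]: "b \<in> Basis \<Longrightarrow> F b \<in> borel_measurable borel" for b
    using borel_measurable_integrable[OF int] by simp
  have m: "(\<lambda>x. \<Prod>b\<in>Basis. F b (x \<bullet> b)) \<in> borel_measurable borel"
    by (intro borel_measurable_prod) measurable
  have T: "(\<lambda>f. \<Sum>b\<in>Basis. f b *\<^sub>R b) \<in> (\<Pi>\<^sub>M b\<in>(Basis::'a set). (lborel :: real measure)) \<rightarrow>\<^sub>M borel"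
    by measurable
  have eq: "(\<Prod>b\<in>Basis. F b ((\<Sum>c\<in>Basis. f c *\<^sub>R c) \<bullet> b)) = (\<Prod>b\<in>Basis. F b (f b))" for f
    by (intro prod.cong refl) simp
  show "integrable lborel (\<lambda>x. \<Prod>b\<in>Basis. F b (x \<bullet> b))"
    by (subst lborel_eq, subst integrable_distr_eq[OF T m]) (simp only: eq, intro product_integrable_prod int, auto)
  show "(LINT x|lborel. (\<Prod>b\<in>Basis. F b (x \<bullet> b))) = (\<Prod>b\<in>Basis. LINT u|lborel. F b u)"
    by (subst lborel_eq, subst integral_distr[OF T m]) (simp only: eq, intro product_integral_prod int, auto)
qed

text \<open>
  The Fourier transform of the Gaussian \<open>exp (- \<epsilon> |x|^2 / 2)\<close>.
\<close>

definition gauss_ft :: "real \<Rightarrow> 'a::euclidean_space \<Rightarrow> real" where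
  "gauss_ft \<epsilon> \<xi> = (\<Prod>b\<in>Basis. sqrt (2 * pi / \<epsilon>) * exp (- ((\<xi> \<bullet> b)\<^sup>2 / (2 * \<epsilon>))))"

lemma cis_sum: "finite A \<Longrightarrow> cis (\<Sum>a\<in>A. f a) = (\<Prod>a\<in>A. cis (f a))"
  by (induction A rule: finite_induct) (simp_all add: cis_mult[symmetric])

lemma
  fixes \<xi> :: "'a::euclidean_space"
  assumes e: "0 < \<epsilon>"
  shows integrable_gaussian: "integrable lborel (\<lambda>x. cis (- (\<xi> \<bullet> x)) * complex_of_real (exp (- (\<epsilon> * (x \<bullet> x) / 2))))"
    and gaussian_fourier: "(LINT x|lborel. cis (- (\<xi> \<bullet> x)) * complex_of_real (exp (- (\<epsilon> * (x \<bullet> x) / 2)))) = complex_of_real (gauss_ft \<epsilon> \<xi>)"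
proof -
  have eq: "cis (- (\<xi> \<bullet> x)) * complex_of_real (exp (- (\<epsilon> * (x \<bullet> x) / 2)))
     = (\<Prod>b\<in>Basis. cis (- ((\<xi> \<bullet> b) * (x \<bullet> b))) * complex_of_real (exp (- (\<epsilon> * (x \<bullet> b)\<^sup>2 / 2))))" for x
  proof -
    have 1: "- (\<xi> \<bullet> x) = (\<Sum>b\<in>Basis. - ((\<xi> \<bullet> b) * (x \<bullet> b)))"
      unfolding sum_negf by (simp only: euclidean_inner[of \<xi> x])
    have "x \<bullet> x = (\<Sum>b\<in>Basis. (x \<bullet> b)\<^sup>2)"
      unfolding power2_eq_square by (rule euclidean_inner)
    then have 2: "- (\<epsilon> * (x \<bullet> x) / 2) = (\<Sum>b\<in>Basis. - (\<epsilon> * (x \<bullet> b)\<^sup>2 / 2))"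
      by (simp add: sum_negf sum_distrib_left sum_divide_distrib)
    show ?thesis unfolding 1 2 by (simp add: cis_sum exp_sum prod.distrib)
  qed
  show "integrable lborel (\<lambda>x. cis (- (\<xi> \<bullet> x)) * complex_of_real (exp (- (\<epsilon> * (x \<bullet> x) / 2))))"
    unfolding eq by (rule integrable_prod_Basis) (rule gaussian_fourier_real[OF e])
  show "(LINT x|lborel. cis (- (\<xi> \<bullet> x)) * complex_of_real (exp (- (\<epsilon> * (x \<bullet> x) / 2)))) = complex_of_real (gauss_ft \<epsilon> \<xi>)"
    unfolding eq by (subst integral_prod_Basis) (simp_all add: gaussian_fourier_real[OF e] gauss_ft_def)
qed

lemma gauss_ft_nonneg: "0 < \<epsilon> \<Longrightarrow> 0 \<le> gauss_ft \<epsilon> \<xi>"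
  unfolding gauss_ft_def by (intro prod_nonneg) auto

lemma gauss_ft_minus: "gauss_ft \<epsilon> (a - b) = gauss_ft \<epsilon> (b - a)"
  unfolding gauss_ft_def by (intro prod.cong refl) (simp add: inner_diff_left power2_commute)

lemma gauss_ft_le:
  fixes \<xi> :: "'a::euclidean_space"
  assumes "0 < \<epsilon>"
  shows "gauss_ft \<epsilon> \<xi> \<le> sqrt (2 * pi / \<epsilon>) ^ DIM('a)"
proof -
  have "gauss_ft \<epsilon> \<xi> \<le> (\<Prod>b\<in>(Basis::'a set). sqrt (2 * pi / \<epsilon>) * 1)"
    unfolding gauss_ft_def using assms by (intro prod_mono conjI mult_left_mono) auto
  then show ?thesis by simp
qed

lemma gauss_ft_measurable[measurable]: "gauss_ft \<epsilon> \<in> borel_measurable borel"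
  unfolding gauss_ft_def[abs_def] by measurable

lemma nn_integral_gauss_ft:
  assumes e: "0 < \<epsilon>"
  shows "(\<integral>\<^sup>+x. ennreal (gauss_ft \<epsilon> (x :: 'a::euclidean_space)) \<partial>lborel) = ennreal ((2 * pi) ^ DIM('a))"
proof -
  let ?h = "\<lambda>u::real. sqrt (2 * pi / \<epsilon>) * exp (- (u\<^sup>2 / (2 * \<epsilon>)))"
  have eq: "cis (- (0 * u)) * complex_of_real (exp (- ((1 / \<epsilon>) * u\<^sup>2 / 2))) = complex_of_real (exp (- (u\<^sup>2 / (2 * \<epsilon>))))" for u
    by (simp add: mult.commute)
  have p: "0 < 1 / \<epsilon>" using e by simp
  have i0: "integrable lborel (\<lambda>u. complex_of_real (exp (- (u\<^sup>2 / (2 * \<epsilon>)))))"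
    using gaussian_fourier_real(1)[OF p, of 0] unfolding eq .
  have I0: "(LINT u|lborel. complex_of_real (exp (- (u\<^sup>2 / (2 * \<epsilon>))))) = complex_of_real (sqrt (2 * pi * \<epsilon>))"
    using gaussian_fourier_real(2)[OF p, of 0] unfolding eq by simp
  have i: "integrable lborel (\<lambda>u. exp (- (u\<^sup>2 / (2 * \<epsilon>))))"
    using i0 by (simp only: complex_of_real_integrable_eq)
  have I: "(LINT u|lborel. exp (- (u\<^sup>2 / (2 * \<epsilon>)))) = sqrt (2 * pi * \<epsilon>)"
    using I0 by (simp only: integral_complex_of_real of_real_eq_iff)
  have hi: "integrable lborel ?h" using i by (rule integrable_mult_right)
  have hI: "(LINT u|lborel. ?h u) = 2 * pi"
  proof -
    have "(LINT u|lborel. ?h u) = sqrt (2 * pi / \<epsilon>) * sqrt (2 * pi * \<epsilon>)" by (simp add: I)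
    also have "\<dots> = sqrt ((2 * pi)\<^sup>2)" using e by (simp add: power2_eq_square flip: real_sqrt_mult)
    also have "\<dots> = \<bar>2 * pi\<bar>" by (rule real_sqrt_abs)
    finally show ?thesis by (simp only: abs_of_nonneg pi_ge_zero mult_nonneg_nonneg zero_le_numeral)
  qed
  have "(\<integral>\<^sup>+x. ennreal (gauss_ft \<epsilon> (x :: 'a)) \<partial>lborel) = ennreal (LINT x|lborel. gauss_ft \<epsilon> (x::'a))"
    by (rule nn_integral_eq_integral) (auto simp: gauss_ft_nonneg[OF e], simp only: gauss_ft_def integrable_prod_Basis[of "\<lambda>_. ?h", OF hi])
  also have "(LINT x|lborel. gauss_ft \<epsilon> (x::'a)) = (2 * pi) ^ DIM('a)"
    unfolding gauss_ft_def by (subst integral_prod_Basis[of "\<lambda>_. ?h", OF hi]) (simp only: hI prod_constant)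
  finally show ?thesis .
qed

lemma borel_measurable_cis[measurable (raw)]:
  assumes "f \<in> borel_measurable N"
  shows "(\<lambda>x. cis (f x)) \<in> borel_measurable N"
  by (rule borel_measurable_continuous_on[OF continuous_on_cis[OF continuous_on_id] assms])

lemma borel_measurable_cnj[measurable (raw)]:
  assumes "f \<in> borel_measurable N"
  shows "(\<lambda>x. cnj (f x)) \<in> borel_measurable N"
  by (rule borel_measurable_continuous_on[OF continuous_on_cnj[OF continuous_on_id] assms])

lemma norm_fourier_square:
  fixes Z :: "'p \<Rightarrow> 'a::euclidean_space" and s :: "'p \<Rightarrow> complex"
  assumes "finite_measure M" and Z[measurable]: "Z \<in> borel_measurable M" and s[measurable]: "s \<in> borel_measurable M"
    and s1: "\<And>p. norm (s p) \<le> 1"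
  shows "complex_of_real ((norm (LINT p|M. s p * cis (- (Z p \<bullet> x))))\<^sup>2)
    = (LINT q|(M \<Otimes>\<^sub>M M). s (fst q) * cnj (s (snd q)) * cis (- ((Z (fst q) - Z (snd q)) \<bullet> x)))"
proof -
  interpret finite_measure M by fact
  interpret MM: pair_sigma_finite M M ..
  let ?Q = "M \<Otimes>\<^sub>M M"
  interpret Q: finite_measure ?Q by (rule finite_measure_pair_measure) fact+
  define H where "H x = (LINT p|M. s p * cis (- (Z p \<bullet> x)))" for x
  define z where "z q = Z (fst q) - Z (snd q)" for q
  define S where "S q = s (fst q) * cnj (s (snd q))" for q
  have zm[measurable]: "z \<in> borel_measurable ?Q" unfolding z_def[abs_def] by measurable
  have Sm[measurable]: "S \<in> borel_measurable ?Q" unfolding S_def[abs_def] by measurable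
  have S1: "norm (S q) \<le> 1" for q
    unfolding S_def norm_mult using s1 by (simp add: mult_le_one)
  have Si: "integrable ?Q (\<lambda>q. S q * cis (- (z q \<bullet> x)))" for x
    by (rule Q.integrable_const_bound[of _ 1]) (use S1 in \<open>auto simp: norm_mult\<close>)
  have "(LINT q|?Q. S q * cis (- (z q \<bullet> x))) = (LINT p|M. (LINT p'|M. S (p, p') * cis (- (z (p, p') \<bullet> x))))"
    by (rule MM.integral_fst'[OF Si, symmetric])
  also have "\<dots> = (LINT p|M. (LINT p'|M. (s p * cis (- (Z p \<bullet> x))) * cnj (s p' * cis (- (Z p' \<bullet> x)))))"
    by (intro Bochner_Integration.integral_cong refl)
       (simp add: S_def z_def cis_cnj cis_mult inner_diff_left mult_ac)
  also have "\<dots> = (LINT p|M. (s p * cis (- (Z p \<bullet> x))) * cnj (H x))"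
  proof -
    have "(LINT p'|M. cnj (s p' * cis (- (Z p' \<bullet> x)))) = cnj (H x)"
      unfolding H_def by (rule Bochner_Integration.integral_cnj)
    then show ?thesis by (simp only: integral_mult_right_zero)
  qed
  also have "\<dots> = H x * cnj (H x)" unfolding H_def by (rule integral_mult_left_zero)
  also have "\<dots> = complex_of_real ((norm (H x))\<^sup>2)" by (rule complex_norm_square[symmetric])
  finally show ?thesis unfolding H_def S_def z_def ..
qed

text \<open>
  The square of the transform is the transform of the autocorrelation. Integrated against a
  Gaussian it becomes, by Fubini, an integral of the transform of the Gaussian, which is positive,
  so that the phases \<open>s\<close> may be discarded.
\<close>

lemma gaussian_energy:
  fixes Z :: "'p \<Rightarrow> 'a::euclidean_space" and s :: "'p \<Rightarrow> complex"
  assumes "finite_measure M" and Z[measurable]: "Z \<in> borel_measurable M" and s[measurable]: "s \<in> borel_measurable M"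
    and s1: "\<And>p. norm (s p) \<le> 1" and e: "0 < \<epsilon>"
  shows "(\<integral>\<^sup>+x. ennreal ((norm (LINT p|M. s p * cis (- (Z p \<bullet> x))))\<^sup>2 * exp (- (\<epsilon> * (x \<bullet> x) / 2))) \<partial>lborel)
      \<le> (\<integral>\<^sup>+p. (\<integral>\<^sup>+p'. ennreal (gauss_ft \<epsilon> (Z p - Z p')) \<partial>M) \<partial>M)"
proof -
  interpret finite_measure M by fact
  interpret MM: pair_sigma_finite M M ..
  let ?Q = "M \<Otimes>\<^sub>M M"
  interpret Q: finite_measure ?Q by (rule finite_measure_pair_measure) fact+
  interpret QL: pair_sigma_finite ?Q "lborel :: 'a measure" ..
  define H where "H x = (LINT p|M. s p * cis (- (Z p \<bullet> x)))" for x
  define ee where "ee x = exp (- (\<epsilon> * (x \<bullet> x) / 2))" for x :: 'a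
  define z where "z q = Z (fst q) - Z (snd q)" for q
  define S where "S q = s (fst q) * cnj (s (snd q))" for q
  have zm[measurable]: "z \<in> borel_measurable ?Q" unfolding z_def[abs_def] by measurable
  have Sm[measurable]: "S \<in> borel_measurable ?Q" unfolding S_def[abs_def] by measurable
  have S1: "norm (S q) \<le> 1" for q
    unfolding S_def norm_mult using s1 by (simp add: mult_le_one)
  have HH: "complex_of_real ((norm (H x))\<^sup>2) = (LINT q|?Q. S q * cis (- (z q \<bullet> x)))" for x
    unfolding H_def S_def z_def by (rule norm_fourier_square[OF assms(1) Z s s1])
  have eei: "integrable lborel ee"
  proof -
    have "integrable lborel (\<lambda>x::'a. complex_of_real (ee x))"
      using integrable_gaussian[OF e, of 0] by (simp add: ee_def)
    then show ?thesis by (simp only: complex_of_real_integrable_eq)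
  qed
  have eem[measurable]: "ee \<in> borel_measurable borel" using eei by auto
  have ee0: "0 \<le> ee x" for x by (simp add: ee_def)
  let ?F = "\<lambda>q x. S q * cis (- (z q \<bullet> x)) * complex_of_real (ee x)"
  have Fi: "integrable (?Q \<Otimes>\<^sub>M lborel) (case_prod ?F)"
  proof (rule integrableI_bounded)
    show "case_prod ?F \<in> borel_measurable (?Q \<Otimes>\<^sub>M lborel)" by measurable
    have "(\<integral>\<^sup>+r. ennreal (norm (case r of (q, x) \<Rightarrow> ?F q x)) \<partial>(?Q \<Otimes>\<^sub>M lborel)) \<le> (\<integral>\<^sup>+r. ennreal (ee (snd r)) \<partial>(?Q \<Otimes>\<^sub>M lborel))"
    proof (rule nn_integral_mono)
      fix r :: "('p \<times> 'p) \<times> 'a"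
      have "norm (S (fst r)) * ee (snd r) \<le> 1 * ee (snd r)" using S1 ee0 by (intro mult_right_mono) auto
      then show "ennreal (norm (case r of (q, x) \<Rightarrow> ?F q x)) \<le> ennreal (ee (snd r))"
        using ee0[of "snd r"] by (auto simp: case_prod_unfold norm_mult intro!: ennreal_leI)
    qed
    also have "\<dots> = (\<integral>\<^sup>+q. (\<integral>\<^sup>+x. ennreal (ee x) \<partial>lborel) \<partial>?Q)"
      by (subst lborel.nn_integral_fst[symmetric]) simp_all
    also have "\<dots> < \<infinity>"
    proof -
      have "(\<integral>\<^sup>+x. ennreal (ee x) \<partial>lborel) = ennreal (LINT x|lborel. ee x)"
        using eei ee0 by (intro nn_integral_eq_integral) auto
      moreover have "emeasure ?Q (space ?Q) < \<infinity>" using Q.emeasure_finite by (simp only: less_top[symmetric] infinity_ennreal_def) simp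
      ultimately show ?thesis unfolding nn_integral_const by (auto simp: ennreal_mult_less_top)
    qed
    finally show "(\<integral>\<^sup>+r. ennreal (norm (case r of (q, x) \<Rightarrow> ?F q x)) \<partial>(?Q \<Otimes>\<^sub>M lborel)) < \<infinity>" .
  qed
  have gf: "(LINT x|lborel. cis (- (\<zeta> \<bullet> x)) * complex_of_real (ee x)) = complex_of_real (gauss_ft \<epsilon> \<zeta>)" for \<zeta>
    unfolding ee_def by (rule gaussian_fourier[OF e])
  have HF: "complex_of_real ((norm (H x))\<^sup>2 * ee x) = (LINT q|?Q. ?F q x)" for x
    unfolding of_real_mult HH by (rule integral_mult_left_zero[symmetric])
  have Hi: "integrable lborel (\<lambda>x. complex_of_real ((norm (H x))\<^sup>2 * ee x))"
    unfolding HF by (rule QL.integrable_snd[OF Fi])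
  have gi: "integrable ?Q (\<lambda>q. gauss_ft \<epsilon> (z q))"
    by (rule Q.integrable_const_bound[of _ "sqrt (2 * pi / \<epsilon>) ^ DIM('a)"])
       (auto simp: gauss_ft_nonneg[OF e] gauss_ft_le[OF e])
  have "complex_of_real (LINT x|lborel. (norm (H x))\<^sup>2 * ee x) = (LINT x|lborel. complex_of_real ((norm (H x))\<^sup>2 * ee x))"
    by (rule integral_complex_of_real[symmetric])
  also have "\<dots> = (LINT x|lborel. (LINT q|?Q. ?F q x))" unfolding HF ..
  also have "\<dots> = (LINT q|?Q. (LINT x|lborel. ?F q x))" by (rule QL.Fubini_integral[OF Fi])
  also have "\<dots> = (LINT q|?Q. S q * complex_of_real (gauss_ft \<epsilon> (z q)))"
    unfolding mult.assoc by (simp only: integral_mult_right_zero gf)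
  finally have "norm (complex_of_real (LINT x|lborel. (norm (H x))\<^sup>2 * ee x)) \<le> (LINT q|?Q. norm (S q * complex_of_real (gauss_ft \<epsilon> (z q))))"
    by (simp only: integral_norm_bound)
  also have "\<dots> \<le> (LINT q|?Q. gauss_ft \<epsilon> (z q))"
  proof (rule integral_mono_AE')
    show "integrable ?Q (\<lambda>q. gauss_ft \<epsilon> (z q))" by fact
    show "AE q in ?Q. norm (S q * complex_of_real (gauss_ft \<epsilon> (z q))) \<le> gauss_ft \<epsilon> (z q)"
    proof (rule AE_I2)
      fix q
      have "norm (S q) * gauss_ft \<epsilon> (z q) \<le> 1 * gauss_ft \<epsilon> (z q)"
        using S1 gauss_ft_nonneg[OF e] by (intro mult_right_mono) auto
      then show "norm (S q * complex_of_real (gauss_ft \<epsilon> (z q))) \<le> gauss_ft \<epsilon> (z q)"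
        using gauss_ft_nonneg[OF e, of "z q"] by (simp add: norm_mult)
    qed
  qed (simp add: gauss_ft_nonneg[OF e])
  finally have le: "(LINT x|lborel. (norm (H x))\<^sup>2 * ee x) \<le> (LINT q|?Q. gauss_ft \<epsilon> (z q))"
    by simp
  have "(\<integral>\<^sup>+x. ennreal ((norm (H x))\<^sup>2 * ee x) \<partial>lborel) = ennreal (LINT x|lborel. (norm (H x))\<^sup>2 * ee x)"
    using Hi ee0 by (intro nn_integral_eq_integral) (simp_all only: complex_of_real_integrable_eq, simp_all)
  also have "\<dots> \<le> ennreal (LINT q|?Q. gauss_ft \<epsilon> (z q))" using le by (rule ennreal_leI)
  also have "\<dots> = (\<integral>\<^sup>+q. ennreal (gauss_ft \<epsilon> (z q)) \<partial>?Q)"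
    by (rule nn_integral_eq_integral[OF gi, symmetric]) (simp add: gauss_ft_nonneg[OF e])
  also have "\<dots> = (\<integral>\<^sup>+p. (\<integral>\<^sup>+p'. ennreal (gauss_ft \<epsilon> (Z p - Z p')) \<partial>M) \<partial>M)"
    by (subst nn_integral_fst[symmetric]) (simp_all add: z_def)
  finally show ?thesis unfolding H_def ee_def .
qed

text \<open>
  Young's inequality for the convolution of an \<open>L^1\<close> with an \<open>L^2\<close> function: Cauchy-Schwarz with the
  kernel divided evenly between both factors, followed by Fubini.
\<close>

lemma gauss_convolution_L2:
  fixes f :: "'a::euclidean_space \<Rightarrow> ennreal"
  assumes e: "0 < \<epsilon>" and f[measurable]: "f \<in> borel_measurable borel"
  shows "(\<integral>\<^sup>+z. (\<integral>\<^sup>+x. f x * ennreal (gauss_ft \<epsilon> (x - z)) \<partial>lborel)\<^sup>2 \<partial>lborel)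
    \<le> (ennreal ((2 * pi) ^ DIM('a)))\<^sup>2 * (\<integral>\<^sup>+x. (f x)\<^sup>2 \<partial>lborel)"
proof -
  let ?g = "gauss_ft \<epsilon> :: 'a \<Rightarrow> real"
  let ?c = "ennreal ((2 * pi) ^ DIM('a))"
  have g1: "(\<integral>\<^sup>+z. ennreal (?g (x - z)) \<partial>lborel) = ?c" for x
    by (subst nn_integral_lborel_reflect[of "\<lambda>z. ennreal (?g z)" x]) (simp_all add: nn_integral_gauss_ft[OF e])
  have g2: "(\<integral>\<^sup>+x. ennreal (?g (x - z)) \<partial>lborel) = ?c" for z
    unfolding gauss_ft_minus[of \<epsilon> _ z] by (rule g1)
  have sq: "(ennreal (sqrt (?g u)))\<^sup>2 = ennreal (?g u)" for u
    using gauss_ft_nonneg[OF e, of u] by (simp add: ennreal_power)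
  have "(\<integral>\<^sup>+x. f x * ennreal (?g (x - z)) \<partial>lborel)\<^sup>2 \<le> (\<integral>\<^sup>+x. (f x)\<^sup>2 * ennreal (?g (x - z)) \<partial>lborel) * ?c" for z
  proof -
    have "(\<integral>\<^sup>+x. f x * ennreal (?g (x - z)) \<partial>lborel)
       = (\<integral>\<^sup>+x. (f x * ennreal (sqrt (?g (x - z)))) * ennreal (sqrt (?g (x - z))) \<partial>lborel)"
      by (intro nn_integral_cong) (simp add: mult.assoc power2_eq_square[symmetric] sq)
    then have "(\<integral>\<^sup>+x. f x * ennreal (?g (x - z)) \<partial>lborel)\<^sup>2
       \<le> (\<integral>\<^sup>+x. (f x * ennreal (sqrt (?g (x - z))))\<^sup>2 \<partial>lborel) * (\<integral>\<^sup>+x. (ennreal (sqrt (?g (x - z))))\<^sup>2 \<partial>lborel)"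
      by (simp only:) (rule Cauchy_Schwarz_nn_integral, measurable)
    then show ?thesis by (simp only: power_mult_distrib sq g2)
  qed
  then have "(\<integral>\<^sup>+z. (\<integral>\<^sup>+x. f x * ennreal (?g (x - z)) \<partial>lborel)\<^sup>2 \<partial>lborel)
      \<le> (\<integral>\<^sup>+z. (\<integral>\<^sup>+x. (f x)\<^sup>2 * ennreal (?g (x - z)) \<partial>lborel) * ?c \<partial>lborel)"
    by (rule nn_integral_mono)
  also have "\<dots> = (\<integral>\<^sup>+z. (\<integral>\<^sup>+x. (f x)\<^sup>2 * ennreal (?g (x - z)) \<partial>lborel) \<partial>lborel) * ?c"
    by (rule nn_integral_multc) measurable
  also have "(\<integral>\<^sup>+z. (\<integral>\<^sup>+x. (f x)\<^sup>2 * ennreal (?g (x - z)) \<partial>lborel) \<partial>lborel)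
      = (\<integral>\<^sup>+x. (\<integral>\<^sup>+z. (f x)\<^sup>2 * ennreal (?g (x - z)) \<partial>lborel) \<partial>lborel)"
    by (rule lborel_pair.Fubini') measurable
  also have "\<dots> = (\<integral>\<^sup>+x. (f x)\<^sup>2 * ?c \<partial>lborel)"
    by (intro nn_integral_cong) (simp add: nn_integral_cmult g1)
  also have "\<dots> = (\<integral>\<^sup>+x. (f x)\<^sup>2 \<partial>lborel) * ?c"
    by (rule nn_integral_multc) measurable
  finally show ?thesis by (simp add: power2_eq_square mult_ac)
qed

lemma ennreal_square_le_imp_le:
  assumes "(R::ennreal)\<^sup>2 \<le> c * R" "R < \<infinity>"
  shows "R \<le> c"
proof (cases "R = 0")
  case False
  have "R * R \<le> R * c" using assms(1) by (simp add: power2_eq_square mult.commute)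
  then show ?thesis using False assms(2) by (simp add: ennreal_mult_le_mult_iff)
qed simp

text \<open>
  Let \<open>f\<close> be the Gaussian smoothing of the image of \<open>M\<close> under \<open>Z\<close>. The hypothesis applied to a second
  smoothing of \<open>f\<close> gives \<open>\<integral> f^2 \<le> B (2 pi)^(2 DIM)\<close>, and applied to \<open>f\<close> itself it bounds \<open>\<integral> f(Z) dM\<close>,
  which dominates the Gaussian-weighted square of the transform. No step depends on \<open>\<epsilon>\<close>, which may
  therefore tend to 0.
\<close>

lemma fourier_L2_bound:
  fixes Z :: "'p \<Rightarrow> 'a::euclidean_space" and s :: "'p \<Rightarrow> complex"
  assumes fin: "finite_measure M" and Z[measurable]: "Z \<in> borel_measurable M" and s[measurable]: "s \<in> borel_measurable M"
    and s1: "\<And>p. norm (s p) \<le> 1" and B: "0 \<le> B"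
    and bd: "\<And>f :: 'a \<Rightarrow> ennreal. f \<in> borel_measurable borel \<Longrightarrow> (\<integral>\<^sup>+p. f (Z p) \<partial>M)\<^sup>2 \<le> ennreal B * (\<integral>\<^sup>+x. (f x)\<^sup>2 \<partial>lborel)"
  shows "(\<integral>\<^sup>+x. ennreal ((norm (LINT p|M. s p * cis (- (Z p \<bullet> x))))\<^sup>2) \<partial>lborel) \<le> ennreal ((2 * pi) ^ DIM('a) * B)"
proof -
  interpret finite_measure M by fact
  let ?c = "ennreal ((2 * pi) ^ DIM('a))"
  let ?H = "\<lambda>x. LINT p|M. s p * cis (- (Z p \<bullet> x))"
  have Hm[measurable]: "?H \<in> borel_measurable borel" by measurable
  have step: "(\<integral>\<^sup>+x. ennreal ((norm (?H x))\<^sup>2 * exp (- (\<epsilon> * (x \<bullet> x) / 2))) \<partial>lborel) \<le> ?c * ennreal B" if e: "0 < \<epsilon>" for \<epsilon> :: real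
  proof -
    interpret PL: pair_sigma_finite M "lborel :: 'a measure" ..
    let ?g = "gauss_ft \<epsilon> :: 'a \<Rightarrow> real"
    define f where "f x = (\<integral>\<^sup>+p'. ennreal (?g (x - Z p')) \<partial>M)" for x
    have fm[measurable]: "f \<in> borel_measurable borel" unfolding f_def[abs_def] by measurable
    let ?R = "\<integral>\<^sup>+x. (f x)\<^sup>2 \<partial>lborel"
    let ?J = "\<integral>\<^sup>+p. f (Z p) \<partial>M"
    have R: "?R = (\<integral>\<^sup>+p. (\<integral>\<^sup>+x. f x * ennreal (?g (x - Z p)) \<partial>lborel) \<partial>M)"
    proof -
      have "?R = (\<integral>\<^sup>+x. (\<integral>\<^sup>+p. f x * ennreal (?g (x - Z p)) \<partial>M) \<partial>lborel)"
        by (intro nn_integral_cong) (simp add: power2_eq_square nn_integral_cmult, simp add: f_def)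
      also have "\<dots> = (\<integral>\<^sup>+p. (\<integral>\<^sup>+x. f x * ennreal (?g (x - Z p)) \<partial>lborel) \<partial>M)"
        by (rule PL.Fubini') measurable
      finally show ?thesis .
    qed
    have cf: "?c < \<infinity>" by simp
    have Rfin: "?R < \<infinity>"
    proof -
      let ?k = "ennreal (sqrt (2 * pi / \<epsilon>) ^ DIM('a)) * emeasure M (space M)"
      have "f x \<le> ?k" for x
      proof -
        have "f x \<le> (\<integral>\<^sup>+p'. ennreal (sqrt (2 * pi / \<epsilon>) ^ DIM('a)) \<partial>M)"
          unfolding f_def by (intro nn_integral_mono ennreal_leI gauss_ft_le[OF e])
        then show ?thesis by simp
      qed
      then have "?R \<le> (\<integral>\<^sup>+p. (\<integral>\<^sup>+x. ?k * ennreal (?g (x - Z p)) \<partial>lborel) \<partial>M)"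
        unfolding R by (intro nn_integral_mono mult_right_mono) auto
      also have "\<dots> = (\<integral>\<^sup>+p. ?k * ?c \<partial>M)"
      proof (intro nn_integral_cong)
        fix p
        have "(\<integral>\<^sup>+x. ennreal (?g (x - Z p)) \<partial>lborel) = ?c"
          unfolding gauss_ft_minus[of \<epsilon> _ "Z p"]
          by (subst nn_integral_lborel_reflect[of "\<lambda>z. ennreal (?g z)" "Z p"]) (simp_all add: nn_integral_gauss_ft[OF e])
        then show "(\<integral>\<^sup>+x. ?k * ennreal (?g (x - Z p)) \<partial>lborel) = ?k * ?c"
          by (subst nn_integral_cmult) simp_all
      qed
      also have "\<dots> < \<infinity>"
      proof -
        have m: "emeasure M (space M) < top" by (simp add: less_top[symmetric])
        have "?k * ?c < top" using m by (simp add: ennreal_mult_less_top)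
        then show ?thesis using m unfolding nn_integral_const by (auto simp: ennreal_mult_less_top)
      qed
      finally show ?thesis .
    qed
    have "?R\<^sup>2 \<le> ennreal B * (\<integral>\<^sup>+z. (\<integral>\<^sup>+x. f x * ennreal (?g (x - z)) \<partial>lborel)\<^sup>2 \<partial>lborel)"
      unfolding R by (rule bd) measurable
    also have "\<dots> \<le> ennreal B * (?c\<^sup>2 * ?R)"
      by (intro mult_left_mono gauss_convolution_L2[OF e fm]) simp
    finally have "?R\<^sup>2 \<le> (ennreal B * ?c\<^sup>2) * ?R" by (simp only: mult.assoc)
    then have Rle: "?R \<le> ennreal B * ?c\<^sup>2" using Rfin by (rule ennreal_square_le_imp_le)
    have "?J\<^sup>2 \<le> ennreal B * ?R" by (rule bd[OF fm])
    also have "\<dots> \<le> ennreal B * (ennreal B * ?c\<^sup>2)" by (intro mult_left_mono Rle) simp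
    also have "\<dots> = (?c * ennreal B)\<^sup>2" by (simp only: power2_eq_square mult_ac)
    finally have J: "?J \<le> ?c * ennreal B" by (rule ennreal_power2_le_imp_le)
    have "(\<integral>\<^sup>+x. ennreal ((norm (?H x))\<^sup>2 * exp (- (\<epsilon> * (x \<bullet> x) / 2))) \<partial>lborel) \<le> ?J"
      unfolding f_def by (rule gaussian_energy[OF fin Z s s1 e])
    with J show ?thesis by (rule order_trans[rotated])
  qed
  define ek where "ek k = inverse (real (Suc k))" for k
  have ek: "0 < ek k" for k by (simp add: ek_def)
  have lim: "(\<lambda>k. ennreal ((norm (?H x))\<^sup>2 * exp (- (ek k * (x \<bullet> x) / 2)))) \<longlonglongrightarrow> ennreal ((norm (?H x))\<^sup>2)" for x
  proof -
    have "(\<lambda>k. (norm (?H x))\<^sup>2 * exp (- (ek k * (x \<bullet> x) / 2))) \<longlonglongrightarrow> (norm (?H x))\<^sup>2 * exp (- (0 * (x \<bullet> x) / 2))"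
      unfolding ek_def by (intro tendsto_intros LIMSEQ_inverse_real_of_nat) auto
    then show ?thesis by (intro tendsto_ennrealI) simp
  qed
  have "(\<integral>\<^sup>+x. ennreal ((norm (?H x))\<^sup>2) \<partial>lborel)
     = (\<integral>\<^sup>+x. liminf (\<lambda>k. ennreal ((norm (?H x))\<^sup>2 * exp (- (ek k * (x \<bullet> x) / 2)))) \<partial>lborel)"
    by (intro nn_integral_cong) (simp add: lim_imp_Liminf[OF trivial_limit_sequentially lim])
  also have "\<dots> \<le> liminf (\<lambda>k. \<integral>\<^sup>+x. ennreal ((norm (?H x))\<^sup>2 * exp (- (ek k * (x \<bullet> x) / 2))) \<partial>lborel)"
    by (rule nn_integral_liminf) measurable
  also have "\<dots> \<le> liminf (\<lambda>k. ?c * ennreal B)"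
    by (intro Liminf_mono always_eventually allI step ek)
  also have "\<dots> = ?c * ennreal B" by (simp add: Liminf_const)
  also have "\<dots> = ennreal ((2 * pi) ^ DIM('a) * B)" using B by (intro ennreal_mult[symmetric]) auto
  finally show ?thesis .
qed

section \<open>Level sets of the Fourier transform\<close>

text \<open>
  Hoelder's inequality with exponents \<open>4/3\<close> and \<open>4\<close>, from Young's inequality for the normalised factors.
\<close>

lemma Hoelder_4_3:
  fixes f g :: "'a \<Rightarrow> real"
  assumes [measurable]: "f \<in> borel_measurable M" "g \<in> borel_measurable M"
    and f0: "\<And>x. 0 \<le> f x" and g0: "\<And>x. 0 \<le> g x"
    and A: "(\<integral>\<^sup>+x. ennreal (f x powr (4/3)) \<partial>M) = ennreal A" "0 \<le> A"
    and D: "(\<integral>\<^sup>+x. ennreal (g x ^ 4) \<partial>M) \<le> ennreal D" "0 < D"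
  shows "(\<integral>\<^sup>+x. ennreal (f x * g x) \<partial>M) \<le> ennreal (A powr (3/4) * D powr (1/4))"
proof (cases "A = 0")
  case True
  then have "AE x in M. ennreal (f x powr (4/3)) = 0"
    using A(1) nn_integral_0_iff_AE[of "\<lambda>x. ennreal (f x powr (4/3))" M] by simp
  then have "AE x in M. ennreal (f x * g x) = 0"
    by eventually_elim (use f0 in \<open>auto simp: ennreal_eq_0_iff powr_def split: if_splits\<close>)
  then have "(\<integral>\<^sup>+x. ennreal (f x * g x) \<partial>M) = 0" by (subst nn_integral_0_iff_AE) auto
  then show ?thesis by simp
next
  case False
  then have A0: "0 < A" using A(2) by simp
  define P where "P = A powr (3/4) * D powr (1/4)"
  have P: "0 < P" using A0 D(2) by (simp add: P_def)
  have pt: "f x * g x \<le> (P * (3/4) / A) * f x powr (4/3) + (P * (1/4) / D) * g x ^ 4" for x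
  proof -
    define a where "a = f x powr (4/3) / A"
    define b where "b = g x ^ 4 / D"
    have ab: "0 \<le> a" "0 \<le> b" using A0 D(2) g0 by (simp_all add: a_def b_def)
    have "a powr (3/4) * b powr (1/4) \<le> (3/4) * a + (1/4) * b"
    proof (cases "a = 0 \<or> b = 0")
      case False
      then show ?thesis using ab by (intro Youngs_inequality_0) auto
    qed (use ab in auto)
    moreover have "a powr (3/4) = f x / A powr (3/4)"
      using f0[of x] A0 by (simp add: a_def powr_divide powr_powr)
    moreover have "b powr (1/4) = g x / D powr (1/4)"
    proof -
      have "(g x ^ 4) powr (1/4) = g x"
      proof (cases "g x = 0")
        case False
        then have gp: "0 < g x" using g0[of x] by simp
        then have "g x ^ 4 = g x powr 4" by (simp add: powr_numeral)
        then have "(g x ^ 4) powr (1/4) = g x powr (4 * (1/4))" by (simp only: powr_powr)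
        then show ?thesis using gp by simp
      qed simp
      then show ?thesis using g0[of x] D(2) by (simp add: b_def powr_divide)
    qed
    ultimately have "f x * g x / P \<le> (3/4) * a + (1/4) * b" by (simp add: P_def)
    then have "f x * g x \<le> P * ((3/4) * a + (1/4) * b)" using P by (simp add: divide_le_eq mult.commute)
    then show ?thesis by (simp add: a_def b_def algebra_simps)
  qed
  have "(\<integral>\<^sup>+x. ennreal (f x * g x) \<partial>M) \<le> (\<integral>\<^sup>+x. ennreal (P * (3/4) / A) * ennreal (f x powr (4/3)) + ennreal (P * (1/4) / D) * ennreal (g x ^ 4) \<partial>M)"
  proof (rule nn_integral_mono)
    fix x
    have "ennreal (f x * g x) \<le> ennreal ((P * (3/4) / A) * f x powr (4/3) + (P * (1/4) / D) * g x ^ 4)"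
      by (rule ennreal_leI[OF pt])
    also have "\<dots> = ennreal (P * (3/4) / A) * ennreal (f x powr (4/3)) + ennreal (P * (1/4) / D) * ennreal (g x ^ 4)"
    proof -
      have "0 \<le> P * (3/4) / A" "0 \<le> P * (1/4) / D" "0 \<le> f x powr (4/3)" "0 \<le> g x ^ 4"
        using P A0 D(2) g0[of x] by simp_all
      then show ?thesis by (simp only: ennreal_plus ennreal_mult mult_nonneg_nonneg)
    qed
    finally show "ennreal (f x * g x) \<le> \<dots>" .
  qed
  also have "\<dots> = ennreal (P * (3/4) / A) * ennreal A + ennreal (P * (1/4) / D) * (\<integral>\<^sup>+x. ennreal (g x ^ 4) \<partial>M)"
    by (simp add: nn_integral_add nn_integral_cmult A(1))
  also have "\<dots> \<le> ennreal (P * (3/4) / A) * ennreal A + ennreal (P * (1/4) / D) * ennreal D"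
    by (intro add_left_mono mult_left_mono D(1)) simp
  also have "\<dots> = ennreal (P * (3/4) / A * A + P * (1/4) / D * D)"
    using P A0 D(2) by (simp only: ennreal_plus ennreal_mult mult_nonneg_nonneg divide_nonneg_pos less_imp_le zero_le_numeral zero_le_one divide_nonneg_nonneg)
  also have "P * (3/4) / A * A + P * (1/4) / D * D = P" using A0 D(2) by simp
  finally show ?thesis by (simp add: P_def)
qed

context hypersurface
begin

text \<open>
  The fourth power of the transform is the square of the transform of the law of \<open>\<gamma>(x) - \<gamma>(y)\<close> on
  pairs of points, for which the energy estimate is the hypothesis of \<open>fourier_L2_bound\<close>. The
  constant is enlarged by 1 to be positive even if \<open>l2 = 0\<close>.
\<close>

lemma extension_L4:
  assumes n: "2 \<le> CARD('n)" and bounded_piece: "bounded_piece E lam"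
    and s[measurable]: "s \<in> borel_measurable borel" and s1: "\<And>y. norm (s y) \<le> 1"
  shows "(\<integral>\<^sup>+x. ennreal ((norm (LINT y|density lborel (\<lambda>y. ennreal (indicator E y * w y)). s y * cis (- (\<gamma> y \<bullet> x)))) ^ 4) \<partial>lborel)
    \<le> ennreal (extension_const CARD('n) l1 l2 * root CARD('n) (lam ^ (3 * CARD('n) - 2)))"
proof -
  have E[measurable]: "E \<in> sets borel" and lam: "(\<integral>\<^sup>+y. ennreal (indicator E y * w y) \<partial>lborel) = ennreal lam" "0 < lam"
    using bounded_piece unfolding bounded_piece_def by auto
  let ?M = "density lborel (\<lambda>y. ennreal (indicator E y * w y))"
  let ?Q = "?M \<Otimes>\<^sub>M ?M"
  let ?B = "energy_const CARD('n) l1 l2 * root CARD('n) (lam ^ (3 * CARD('n) - 2))"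
  have fin: "finite_measure ?M"
    by (rule finite_measureI) (simp add: emeasure_density space_density lam)
  have finQ: "finite_measure ?Q" by (rule finite_measure_pair_measure[OF fin fin])
  interpret finite_measure ?M by fact
  have r0: "0 \<le> root CARD('n) (lam ^ (3 * CARD('n) - 2))" using lam(2) by simp
  then have B0: "0 \<le> ?B" using energy_const_nonneg[of "CARD('n)" l1 l2] by simp
  have gm: "\<gamma> \<in> borel_measurable ?M" and sm: "s \<in> borel_measurable ?M" by simp_all
  note gm[measurable] sm[measurable]
  have bd: "(\<integral>\<^sup>+q. f (\<gamma> (fst q) - \<gamma> (snd q)) \<partial>?Q)\<^sup>2 \<le> ennreal ?B * (\<integral>\<^sup>+x. (f x)\<^sup>2 \<partial>lborel)"
    if f[measurable]: "f \<in> borel_measurable borel" for f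
  proof -
    have "(\<integral>\<^sup>+q. f (\<gamma> (fst q) - \<gamma> (snd q)) \<partial>?Q) = (\<integral>\<^sup>+x. (\<integral>\<^sup>+y. f (\<gamma> x - \<gamma> y) \<partial>?M) \<partial>?M)"
      by (subst nn_integral_fst[symmetric]) simp_all
    also have "\<dots> = (\<integral>\<^sup>+x. ennreal (indicator E x * w x) * (\<integral>\<^sup>+y. ennreal (indicator E y * w y) * f (\<gamma> x - \<gamma> y) \<partial>lborel) \<partial>lborel)"
      by (subst nn_integral_density, simp, measurable) (simp add: nn_integral_density)
    also have "\<dots> = (\<integral>\<^sup>+x. (\<integral>\<^sup>+y. ennreal (indicator E x * w x) * ennreal (indicator E y * w y) * f (\<gamma> x - \<gamma> y) \<partial>lborel) \<partial>lborel)"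
      unfolding mult.assoc by (intro nn_integral_cong nn_integral_cmult[symmetric]) measurable
    also have "\<dots>\<^sup>2 \<le> ennreal ?B * (\<integral>\<^sup>+x. (f x)\<^sup>2 \<partial>lborel)"
      by (rule energy_bound[OF n bounded_piece f])
    finally show ?thesis .
  qed
  have Zm: "(\<lambda>q. \<gamma> (fst q) - \<gamma> (snd q)) \<in> borel_measurable ?Q" by measurable
  have Sm: "(\<lambda>q. s (fst q) * cnj (s (snd q))) \<in> borel_measurable ?Q" by measurable
  have S1: "norm (s (fst q) * cnj (s (snd q))) \<le> 1" for q
    unfolding norm_mult using s1 by (simp add: mult_le_one)
  have "(\<integral>\<^sup>+x. ennreal ((norm (LINT y|?M. s y * cis (- (\<gamma> y \<bullet> x)))) ^ 4) \<partial>lborel)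
     = (\<integral>\<^sup>+x. ennreal ((norm (LINT q|?Q. s (fst q) * cnj (s (snd q)) * cis (- ((\<gamma> (fst q) - \<gamma> (snd q)) \<bullet> x))))\<^sup>2) \<partial>lborel)"
    unfolding norm_fourier_square[OF fin gm sm s1, symmetric] norm_of_real
    by (simp add: power_mult[symmetric])
  also have "\<dots> \<le> ennreal ((2 * pi) ^ DIM((real^'n) \<times> real) * ?B)"
    by (rule fourier_L2_bound[OF finQ Zm Sm S1 B0 bd])
  also have "\<dots> \<le> ennreal (extension_const CARD('n) l1 l2 * root CARD('n) (lam ^ (3 * CARD('n) - 2)))"
  proof (rule ennreal_leI)
    have "(2 * pi) ^ (CARD('n) + 1) * (energy_const CARD('n) l1 l2 * root CARD('n) (lam ^ (3 * CARD('n) - 2)))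
        \<le> (2 * pi) ^ (CARD('n) + 1) * ((energy_const CARD('n) l1 l2 + 1) * root CARD('n) (lam ^ (3 * CARD('n) - 2)))"
      using r0 by (intro mult_left_mono mult_right_mono) auto
    then show "(2 * pi) ^ DIM((real^'n) \<times> real) * ?B \<le> extension_const CARD('n) l1 l2 * root CARD('n) (lam ^ (3 * CARD('n) - 2))"
      by (simp add: extension_const_def mult.assoc)
  qed
  finally show ?thesis .
qed

text \<open>
  The Fourier integral with respect to Borel measure, for Borel representatives of functions.
\<close>

definition FT :: "((real^'n) \<times> real \<Rightarrow> complex) \<Rightarrow> (real^'n) \<times> real \<Rightarrow> complex" where
  "FT f \<xi> = (LINT x|lborel. cis (- (\<xi> \<bullet> x)) * f x)"

lemma FT_measurable:
  assumes [measurable]: "f \<in> borel_measurable borel"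
  shows "FT f \<in> borel_measurable borel"
  unfolding FT_def[abs_def] by measurable

text \<open>
  Duality: on \<open>E\<close> the modulus of the transform is its product with a unimodular function \<open>s\<close>, and
  Fubini moves the integral over \<open>E\<close> to the transform of \<open>s\<close>.
\<close>

lemma level_set_piece_bound:
  fixes f :: "(real^'n) \<times> real \<Rightarrow> complex"
  assumes n: "2 \<le> CARD('n)" and bounded_piece: "bounded_piece E lam"
    and fi: "integrable lborel f" and A: "(\<integral>\<^sup>+x. ennreal (norm (f x) powr (4/3)) \<partial>lborel) = ennreal A" "0 \<le> A"
    and t: "0 \<le> t" and level: "\<And>y. y \<in> E \<Longrightarrow> t \<le> norm (FT f (\<gamma> y))"
  shows "t * lam \<le> A powr (3/4) * (extension_const CARD('n) l1 l2 * root CARD('n) (lam ^ (3 * CARD('n) - 2))) powr (1/4)"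
proof -
  have E[measurable]: "E \<in> sets borel" and lam: "(\<integral>\<^sup>+y. ennreal (indicator E y * w y) \<partial>lborel) = ennreal lam" "0 < lam"
    using bounded_piece unfolding bounded_piece_def by auto
  have fm[measurable]: "f \<in> borel_measurable borel" using fi by auto
  let ?M = "density lborel (\<lambda>y. ennreal (indicator E y * w y))"
  have mass: "emeasure ?M (space ?M) = ennreal lam" by (simp add: emeasure_density space_density lam)
  have fin: "finite_measure ?M" by (rule finite_measureI) (simp only: mass, simp)
  interpret M: finite_measure ?M by fact
  interpret PL: pair_sigma_finite ?M "lborel :: ((real^'n) \<times> real) measure" ..
  have Fm[measurable]: "FT f \<in> borel_measurable borel" by (rule FT_measurable[OF fm])
  \<comment> \<open>Division by zero makes \<open>s\<close> vanish where the transform does.\<close>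
  define s where "s y = cnj (FT f (\<gamma> y)) / complex_of_real (norm (FT f (\<gamma> y)))" for y
  have sm[measurable]: "s \<in> borel_measurable borel" unfolding s_def[abs_def] by measurable
  have s1: "norm (s y) \<le> 1" for y by (simp add: s_def norm_divide)
  have sF: "s y * FT f (\<gamma> y) = complex_of_real (norm (FT f (\<gamma> y)))" for y
  proof (cases "FT f (\<gamma> y) = 0")
    case False
    have "cnj (FT f (\<gamma> y)) * FT f (\<gamma> y) = (complex_of_real (norm (FT f (\<gamma> y))))\<^sup>2"
      by (simp only: complex_norm_square of_real_power[symmetric] mult.commute)
    then show ?thesis using False by (simp add: s_def power2_eq_square)
  qed (simp add: s_def)
  define H where "H x = (LINT y|?M. s y * cis (- (\<gamma> y \<bullet> x)))" for x
  have gm: "\<gamma> \<in> borel_measurable ?M" and sm': "s \<in> borel_measurable ?M" by simp_all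
  note gm[measurable] sm'[measurable]
  have Hm[measurable]: "H \<in> borel_measurable borel" unfolding H_def[abs_def] by measurable
  let ?F = "\<lambda>y x. s y * cis (- (\<gamma> y \<bullet> x)) * f x"
  have Fi: "integrable (?M \<Otimes>\<^sub>M lborel) (case_prod ?F)"
  proof (rule integrableI_bounded)
    show "case_prod ?F \<in> borel_measurable (?M \<Otimes>\<^sub>M lborel)" by measurable
    have "(\<integral>\<^sup>+r. ennreal (norm (case r of (q, x) \<Rightarrow> ?F q x)) \<partial>(?M \<Otimes>\<^sub>M lborel)) \<le> (\<integral>\<^sup>+r. ennreal (norm (f (snd r))) \<partial>(?M \<Otimes>\<^sub>M lborel))"
    proof (rule nn_integral_mono)
      fix r :: "(real^'n) \<times> ((real^'n) \<times> real)"
      have "norm (s (fst r)) * norm (f (snd r)) \<le> 1 * norm (f (snd r))" using s1 by (intro mult_right_mono) auto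
      then show "ennreal (norm (case r of (q, x) \<Rightarrow> ?F q x)) \<le> ennreal (norm (f (snd r)))"
        by (auto simp: case_prod_unfold norm_mult intro!: ennreal_leI)
    qed
    also have "\<dots> = (\<integral>\<^sup>+q. (\<integral>\<^sup>+x. ennreal (norm (f x)) \<partial>lborel) \<partial>?M)"
      by (subst lborel.nn_integral_fst[symmetric]) simp_all
    also have "\<dots> = ennreal (LINT x|lborel. norm (f x)) * ennreal lam"
      using fi by (simp only: nn_integral_const mass) (simp add: nn_integral_eq_integral)
    also have "\<dots> < \<infinity>" by (simp add: ennreal_mult_less_top)
    finally show "(\<integral>\<^sup>+r. ennreal (norm (case r of (q, x) \<Rightarrow> ?F q x)) \<partial>(?M \<Otimes>\<^sub>M lborel)) < \<infinity>" .
  qed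
  have FTb: "norm (FT f \<xi>) \<le> (LINT x|lborel. norm (f x))" for \<xi>
    unfolding FT_def by (rule order_trans[OF integral_norm_bound]) (simp add: norm_mult)
  have ni: "integrable ?M (\<lambda>y. norm (FT f (\<gamma> y)))"
    by (rule M.integrable_const_bound[of _ "LINT x|lborel. norm (f x)"]) (auto simp: FTb)
  have "t * lam = (LINT y|?M. t)"
  proof -
    have "measure ?M (space ?M) = lam" unfolding measure_def mass using lam(2) by simp
    then show ?thesis unfolding lebesgue_integral_const by (simp only: real_scaleR_def mult.commute)
  qed
  also have "\<dots> \<le> (LINT y|?M. norm (FT f (\<gamma> y)))"
  proof (rule integral_mono_AE)
    show "AE y in ?M. t \<le> norm (FT f (\<gamma> y))"
      using level by (subst AE_density) (auto simp: indicator_def)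
  qed (use ni in auto)
  also have "\<dots> = norm (complex_of_real (LINT y|?M. norm (FT f (\<gamma> y))))"
    by (simp only: norm_of_real) (simp add: abs_of_nonneg)
  also have "complex_of_real (LINT y|?M. norm (FT f (\<gamma> y))) = (LINT y|?M. s y * FT f (\<gamma> y))"
    unfolding sF by (rule integral_complex_of_real[symmetric])
  also have "\<dots> = (LINT y|?M. (LINT x|lborel. ?F y x))"
    unfolding FT_def by (simp only: integral_mult_right_zero mult.assoc)
  also have "\<dots> = (LINT x|lborel. (LINT y|?M. ?F y x))" by (rule PL.Fubini_integral[OF Fi, symmetric])
  also have "\<dots> = (LINT x|lborel. H x * f x)" unfolding H_def by (simp only: integral_mult_left_zero)
  finally have 1: "t * lam \<le> norm (LINT x|lborel. H x * f x)" .
  have Hfi: "integrable lborel (\<lambda>x. H x * f x)"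
    using PL.integrable_snd[OF Fi] unfolding H_def by (simp only: integral_mult_left_zero)
  have D: "(\<integral>\<^sup>+x. ennreal (norm (H x) ^ 4) \<partial>lborel) \<le> ennreal (extension_const CARD('n) l1 l2 * root CARD('n) (lam ^ (3 * CARD('n) - 2)))"
    unfolding H_def by (rule extension_L4[OF n bounded_piece sm s1])
  have D0: "0 < extension_const CARD('n) l1 l2 * root CARD('n) (lam ^ (3 * CARD('n) - 2))" using extension_const_pos[of "CARD('n)" l1 l2] lam(2) by simp
  have "ennreal (t * lam) \<le> ennreal (LINT x|lborel. norm (H x * f x))"
    using 1 integral_norm_bound[of lborel "\<lambda>x. H x * f x"] by (intro ennreal_leI) linarith
  also have "\<dots> = (\<integral>\<^sup>+x. ennreal (norm (f x) * norm (H x)) \<partial>lborel)"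
    by (subst nn_integral_eq_integral[OF integrable_norm[OF Hfi], symmetric]) (simp_all add: norm_mult mult.commute)
  also have "\<dots> \<le> ennreal (A powr (3/4) * (extension_const CARD('n) l1 l2 * root CARD('n) (lam ^ (3 * CARD('n) - 2))) powr (1/4))"
    by (rule Hoelder_4_3[OF _ _ _ _ A D D0]) auto
  finally show ?thesis by (subst (asm) ennreal_le_iff) auto
qed

end

section \<open>Weak norms\<close>

lemma powr_superadditive:
  fixes x y :: real
  assumes "0 \<le> x" "0 \<le> y" "1 \<le> q"
  shows "x powr q + y powr q \<le> (x + y) powr q"
proof -
  have *: "u powr q \<le> u * (x + y) powr (q - 1)" if "0 \<le> u" "u \<le> x + y" for u
  proof (cases "u = 0")
    case False
    then have "u powr q = u * u powr (q - 1)" using that by (simp add: powr_mult_base)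
    also have "\<dots> \<le> u * (x + y) powr (q - 1)" using that assms by (intro mult_left_mono powr_mono2) auto
    finally show ?thesis .
  qed simp
  have "x powr q + y powr q \<le> x * (x + y) powr (q - 1) + y * (x + y) powr (q - 1)"
    using assms by (intro add_mono *) auto
  also have "\<dots> = (x + y) * (x + y) powr (q - 1)" by (simp add: algebra_simps)
  also have "\<dots> = (x + y) powr q" using assms by (cases "x + y = 0") (simp_all add: powr_mult_base)
  finally show ?thesis .
qed

lemma powr_subadditive:
  fixes x y :: real
  assumes "0 \<le> x" "0 \<le> y" "0 < r" "r \<le> 1"
  shows "(x + y) powr r \<le> x powr r + y powr r"
proof -
  have "(x powr r) powr (1/r) + (y powr r) powr (1/r) \<le> (x powr r + y powr r) powr (1/r)"
    using assms by (intro powr_superadditive) auto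
  then have "x + y \<le> (x powr r + y powr r) powr (1/r)" using assms by (simp add: powr_powr)
  then have "(x + y) powr r \<le> ((x powr r + y powr r) powr (1/r)) powr r"
    using assms by (intro powr_mono2) auto
  then show ?thesis using assms by (simp add: powr_powr)
qed

text \<open>
  In terms of distribution functions the weak norm needs no roots of extended reals; all estimates
  below are made in this form.
\<close>

lemma weak_norm_le_iff:
  assumes q: "0 < q" and c: "0 \<le> c"
  shows "weak_norm M q g \<le> ennreal c \<longleftrightarrow> (\<forall>t>0. emeasure M {x \<in> space M. t < norm (g x)} \<le> ennreal ((c / t) powr q))"
proof -
  have "ennreal t * ennreal_powr a (1 / q) \<le> ennreal c \<longleftrightarrow> a \<le> ennreal ((c / t) powr q)" if t: "0 < t" for t a
  proof (cases a)
    case a: (real a')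
    have "ennreal t * ennreal_powr a (1 / q) = ennreal (t * a' powr (1 / q))"
      using a t by (simp add: ennreal_powr_def ennreal_mult)
    then have "ennreal t * ennreal_powr a (1 / q) \<le> ennreal c \<longleftrightarrow> a' powr (1 / q) \<le> c / t"
      using t c by (simp add: le_divide_eq mult.commute)
    also have "\<dots> \<longleftrightarrow> a' \<le> (c / t) powr q"
    proof
      assume "a' powr (1 / q) \<le> c / t"
      then have "(a' powr (1 / q)) powr q \<le> (c / t) powr q" using q by (intro powr_mono2) auto
      then show "a' \<le> (c / t) powr q" using a q by (simp add: powr_powr)
    next
      assume "a' \<le> (c / t) powr q"
      then have "a' powr (1 / q) \<le> ((c / t) powr q) powr (1 / q)" using a q by (intro powr_mono2) auto
      then show "a' powr (1 / q) \<le> c / t" using q c t by (simp add: powr_powr)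
    qed
    also have "\<dots> \<longleftrightarrow> a \<le> ennreal ((c / t) powr q)" using a by simp
    finally show ?thesis .
  next
    case top
    then have "ennreal t * ennreal_powr a (1 / q) = top"
      using t by (simp add: ennreal_powr_def ennreal_mult_top)
    then show ?thesis using top by (simp add: top_unique)
  qed
  then show ?thesis unfolding weak_norm_def SUP_le_iff by auto
qed

lemma weak_norm_triangle:
  assumes q: "1 \<le> q" and c: "0 \<le> c" "0 \<le> d"
    and [measurable]: "g \<in> borel_measurable M" "h \<in> borel_measurable M"
    and g: "weak_norm M q (\<lambda>x. h x - g x) \<le> ennreal c" and h: "weak_norm M q h \<le> ennreal d"
  shows "weak_norm M q g \<le> ennreal (2 * c + 2 * d)"
proof -
  have q0: "0 < q" using q by simp
  have "emeasure M {x \<in> space M. t < norm (g x)} \<le> ennreal (((2 * c + 2 * d) / t) powr q)" if t: "0 < t" for t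
  proof -
    have "{x \<in> space M. t < norm (g x)} \<subseteq> {x \<in> space M. t / 2 < norm (h x - g x)} \<union> {x \<in> space M. t / 2 < norm (h x)}"
    proof
      fix x assume x: "x \<in> {x \<in> space M. t < norm (g x)}"
      have "norm (g x) \<le> norm (h x) + norm (h x - g x)" using norm_triangle_ineq4[of "h x" "h x - g x"] by simp
      then show "x \<in> {x \<in> space M. t / 2 < norm (h x - g x)} \<union> {x \<in> space M. t / 2 < norm (h x)}" using x by auto
    qed
    then have "emeasure M {x \<in> space M. t < norm (g x)}
        \<le> emeasure M ({x \<in> space M. t / 2 < norm (h x - g x)} \<union> {x \<in> space M. t / 2 < norm (h x)})"
      by (rule emeasure_mono) measurable
    also have "\<dots> \<le> emeasure M {x \<in> space M. t / 2 < norm (h x - g x)} + emeasure M {x \<in> space M. t / 2 < norm (h x)}"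
      by (rule emeasure_subadditive) measurable
    also have "\<dots> \<le> ennreal ((c / (t / 2)) powr q) + ennreal ((d / (t / 2)) powr q)"
    proof (rule add_mono)
      show "emeasure M {x \<in> space M. t / 2 < norm (h x - g x)} \<le> ennreal ((c / (t / 2)) powr q)"
        using g half_gt_zero[OF t] unfolding weak_norm_le_iff[OF q0 c(1)] by blast
      show "emeasure M {x \<in> space M. t / 2 < norm (h x)} \<le> ennreal ((d / (t / 2)) powr q)"
        using h half_gt_zero[OF t] unfolding weak_norm_le_iff[OF q0 c(2)] by blast
    qed
    also have "\<dots> = ennreal ((2 * c / t) powr q + (2 * d / t) powr q)" by (simp add: mult.commute)
    also have "\<dots> \<le> ennreal ((2 * c / t + 2 * d / t) powr q)"
      using c t q by (intro ennreal_leI powr_superadditive) auto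
    also have "2 * c / t + 2 * d / t = (2 * c + 2 * d) / t" by (simp add: add_divide_distrib)
    finally show ?thesis .
  qed
  then show ?thesis using c by (subst weak_norm_le_iff[OF q0]) auto
qed

lemma weak_norm_Fatou:
  fixes u :: "nat \<Rightarrow> 'a \<Rightarrow> complex"
  assumes q: "0 < q" and c: "0 \<le> c"
    and um[measurable]: "\<And>k. u k \<in> borel_measurable M" and gm[measurable]: "g \<in> borel_measurable M"
    and lim: "AE x in M. (\<lambda>k. u k x) \<longlonglongrightarrow> g x"
    and ev: "eventually (\<lambda>k. weak_norm M q (u k) \<le> ennreal c) sequentially"
  shows "weak_norm M q g \<le> ennreal c"
proof -
  have "emeasure M {x \<in> space M. t < norm (g x)} \<le> ennreal ((c / t) powr q)" if t: "0 < t" for t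
  proof -
    let ?S = "\<lambda>v. {x \<in> space M. t < norm (v x :: complex)}"
    have "emeasure M (?S g) = (\<integral>\<^sup>+x. indicator (?S g) x \<partial>M)" by simp
    also have "\<dots> \<le> (\<integral>\<^sup>+x. liminf (\<lambda>k. indicator (?S (u k)) x) \<partial>M)"
    proof (rule nn_integral_mono_AE)
      show "AE x in M. indicator (?S g) x \<le> (liminf (\<lambda>k. indicator (?S (u k)) x) :: ennreal)"
        using lim
      proof eventually_elim
        case (elim x)
        show ?case
        proof (cases "x \<in> ?S g")
          case True
          have "(\<lambda>k. norm (u k x)) \<longlonglongrightarrow> norm (g x)" using elim by (rule tendsto_norm)
          then have "eventually (\<lambda>k. t < norm (u k x)) sequentially" using True by (intro order_tendstoD(1)) auto
          then have "eventually (\<lambda>k. 1 \<le> (indicator (?S (u k)) x :: ennreal)) sequentially"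
            by eventually_elim (use True in auto)
          then have "1 \<le> liminf (\<lambda>k. indicator (?S (u k)) x :: ennreal)" by (rule Liminf_bounded)
          then show ?thesis using True by simp
        qed simp
      qed
    qed
    also have "\<dots> \<le> liminf (\<lambda>k. \<integral>\<^sup>+x. indicator (?S (u k)) x \<partial>M)"
      by (rule nn_integral_liminf) measurable
    also have "\<dots> = liminf (\<lambda>k. emeasure M (?S (u k)))" by simp
    also have "\<dots> \<le> liminf (\<lambda>k. ennreal ((c / t) powr q))"
      using ev t by (intro Liminf_mono) (auto elim!: eventually_mono simp: weak_norm_le_iff[OF q c])
    also have "\<dots> = ennreal ((c / t) powr q)" by (simp add: Liminf_const)
    finally show ?thesis .
  qed
  then show ?thesis by (subst weak_norm_le_iff[OF q c]) auto
qed

section \<open>Lebesgue spaces and truncation\<close>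

lemma Lp_norm_nonneg: "0 \<le> Lp_norm p f"
  by (simp add: Lp_norm_def)

lemma norm_diff_powr_le:
  fixes a b :: complex
  assumes "0 \<le> p"
  shows "norm (a - b) powr p \<le> 2 powr p * (norm a powr p + norm b powr p)"
proof -
  have "norm (a - b) powr p \<le> (2 * max (norm a) (norm b)) powr p"
    using norm_triangle_ineq4[of a b] assms by (intro powr_mono2) auto
  also have "\<dots> = 2 powr p * max (norm a) (norm b) powr p" by (rule powr_mult)
  also have "\<dots> \<le> 2 powr p * (norm a powr p + norm b powr p)"
    by (intro mult_left_mono) (auto simp: max_def)
  finally show ?thesis .
qed

lemma Lp_diff:
  assumes f: "f \<in> Lp p" and g: "g \<in> Lp p" and p: "0 \<le> p"
  shows "(\<lambda>x. f x - g x) \<in> Lp p"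
proof -
  have [measurable]: "f \<in> borel_measurable lebesgue" "g \<in> borel_measurable lebesgue"
    and i: "integrable lebesgue (\<lambda>x. norm (f x) powr p)" "integrable lebesgue (\<lambda>x. norm (g x) powr p)"
    using f g by (auto simp: Lp_def)
  have "integrable lebesgue (\<lambda>x. norm (f x - g x) powr p)"
    by (rule Bochner_Integration.integrable_bound[of _ "\<lambda>x. 2 powr p * (norm (f x) powr p + norm (g x) powr p)"])
       (use i norm_diff_powr_le[OF p] in auto)
  then show ?thesis by (simp add: Lp_def)
qed

lemma Lp_norm_diff_le:
  assumes f: "f \<in> Lp p" and g: "g \<in> Lp p" and p: "1 \<le> p"
  shows "Lp_norm p (\<lambda>x. f x - g x) \<le> 2 * (Lp_norm p f + Lp_norm p g)"
proof -
  have i: "integrable lebesgue (\<lambda>x. norm (f x) powr p)" "integrable lebesgue (\<lambda>x. norm (g x) powr p)"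
    using f g by (auto simp: Lp_def)
  have d: "integrable lebesgue (\<lambda>x. norm (f x - g x) powr p)" using Lp_diff[OF f g] p by (simp add: Lp_def)
  let ?I = "\<lambda>f. LINT x|lebesgue. norm (f x) powr p"
  have "?I (\<lambda>x. f x - g x) \<le> (LINT x|lebesgue. 2 powr p * (norm (f x) powr p + norm (g x) powr p))"
    using i d p by (intro integral_mono norm_diff_powr_le) auto
  also have "\<dots> = 2 powr p * (?I f + ?I g)" using i by simp
  finally have "?I (\<lambda>x. f x - g x) powr (1/p) \<le> (2 powr p * (?I f + ?I g)) powr (1/p)"
    using p by (intro powr_mono2) auto
  also have "\<dots> = 2 * (?I f + ?I g) powr (1/p)"
    using p by (subst powr_mult) (auto simp: powr_powr)
  also have "\<dots> \<le> 2 * (?I f powr (1/p) + ?I g powr (1/p))"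
    using p by (intro mult_left_mono powr_subadditive) auto
  finally show ?thesis by (simp add: Lp_norm_def)
qed

text \<open>
  Truncation in space and in height puts a function into every \<^const>\<open>Lp\<close> and never increases it.
\<close>

definition trunc :: "('a::euclidean_space \<Rightarrow> complex) \<Rightarrow> nat \<Rightarrow> 'a \<Rightarrow> complex" where
  "trunc f k x = (if norm x \<le> real k \<and> norm (f x) \<le> real k then f x else 0)"

lemma norm_trunc_le: "norm (trunc f k x) \<le> norm (f x)"
  by (simp add: trunc_def)

lemma trunc_measurable:
  assumes f[measurable]: "f \<in> borel_measurable lebesgue"
  shows "trunc f k \<in> borel_measurable lebesgue"
proof -
  have [measurable]: "(\<lambda>x::'a. norm x) \<in> borel_measurable lebesgue"
    by (rule measurable_completion) simp
  show ?thesis unfolding trunc_def[abs_def] by measurable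
qed

lemma trunc_Lp:
  assumes f: "f \<in> Lp p" and p: "0 \<le> p"
  shows "trunc f k \<in> Lp p"
proof -
  have fm: "f \<in> borel_measurable lebesgue" and i: "integrable lebesgue (\<lambda>x. norm (f x) powr p)" using f by (auto simp: Lp_def)
  note trunc_measurable[OF fm, measurable]
  have "integrable lebesgue (\<lambda>x. norm (trunc f k x) powr p)"
    by (rule Bochner_Integration.integrable_bound[OF i]) (use p norm_trunc_le in \<open>auto intro!: AE_I2 powr_mono2\<close>)
  then show ?thesis by (simp add: Lp_def trunc_measurable[OF fm])
qed

lemma trunc_Lp_1:
  assumes f: "f \<in> borel_measurable lebesgue"
  shows "trunc f k \<in> Lp 1"
proof -
  note trunc_measurable[OF f, measurable]
  have "integrable lebesgue (\<lambda>x::'a. indicator (cball 0 (real k)) x * real k)"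
    using emeasure_bounded_finite[of "cball (0::'a) (real k)"]
    by (intro integrable_mult_left integrable_real_indicator) auto
  then have "integrable lebesgue (\<lambda>x. norm (trunc f k x) powr 1)"
  proof (rule Bochner_Integration.integrable_bound)
    show "AE x in lebesgue. norm (norm (trunc f k x) powr 1) \<le> norm (indicator (cball 0 (real k)) x * real k)"
      by (intro AE_I2) (auto simp: trunc_def indicator_def)
  qed measurable
  then show ?thesis by (simp add: Lp_def trunc_measurable[OF f])
qed

lemma Lp_norm_trunc_le:
  assumes f: "f \<in> Lp p" and p: "0 < p"
  shows "Lp_norm p (trunc f k) \<le> Lp_norm p f"
proof -
  have "(LINT x|lebesgue. norm (trunc f k x) powr p) \<le> (LINT x|lebesgue. norm (f x) powr p)"
    using f trunc_Lp[OF f] p norm_trunc_le by (intro integral_mono) (auto simp: Lp_def intro!: powr_mono2)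
  then show ?thesis unfolding Lp_norm_def using p by (intro powr_mono2) auto
qed

lemma Lp_norm_trunc_tendsto:
  assumes f: "f \<in> Lp p" and p: "0 < p"
  shows "(\<lambda>k. Lp_norm p (\<lambda>x. trunc f k x - f x)) \<longlonglongrightarrow> 0"
proof -
  have fm[measurable]: "f \<in> borel_measurable lebesgue" and i: "integrable lebesgue (\<lambda>x. norm (f x) powr p)" using f by (auto simp: Lp_def)
  note trunc_measurable[OF fm, measurable]
  have "(\<lambda>k. LINT x|lebesgue. norm (trunc f k x - f x) powr p) \<longlonglongrightarrow> (LINT x|(lebesgue :: 'a measure). 0)"
  proof (rule integral_dominated_convergence[where w="\<lambda>x. norm (f x) powr p"])
    show "AE x in lebesgue. (\<lambda>k. norm (trunc f k x - f x) powr p) \<longlonglongrightarrow> 0"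
    proof (rule AE_I2)
      fix x
      obtain N where N: "max (norm x) (norm (f x)) \<le> real N" using real_arch_simple by blast
      have "eventually (\<lambda>k. norm (trunc f k x - f x) powr p = 0) sequentially"
        using eventually_ge_at_top[of N] by eventually_elim (use N in \<open>auto simp: trunc_def\<close>)
      then show "(\<lambda>k. norm (trunc f k x - f x) powr p) \<longlonglongrightarrow> 0" by (rule tendsto_eventually)
    qed
    show "AE x in lebesgue. norm (norm (trunc f k x - f x) powr p) \<le> norm (f x) powr p" for k
      using p by (intro AE_I2) (auto simp: trunc_def)
  qed (use i in auto)
  then have "(\<lambda>k. (LINT x|lebesgue. norm (trunc f k x - f x) powr p) powr (1/p)) \<longlonglongrightarrow> 0 powr (1/p)"
    using p by (intro tendsto_powr') auto
  then show ?thesis using p by (simp add: Lp_norm_def)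
qed

lemma Lp_1_integrable: "f \<in> Lp 1 \<Longrightarrow> integrable lebesgue f"
  unfolding Lp_def by (auto simp: integrable_norm_iff)

lemma integrable_fourier:
  fixes f :: "'a::euclidean_space \<Rightarrow> complex"
  assumes "integrable lebesgue f"
  shows "integrable lebesgue (\<lambda>x. cis (- (\<xi> \<bullet> x)) * f x)"
proof -
  have [measurable]: "(\<lambda>x::'a. cis (- (\<xi> \<bullet> x))) \<in> borel_measurable lebesgue"
    by (rule measurable_completion) measurable
  have [measurable]: "f \<in> borel_measurable lebesgue" using assms by auto
  show ?thesis using assms by (rule Bochner_Integration.integrable_bound) (auto simp: norm_mult)
qed

lemma fourier_diff:
  assumes "f \<in> Lp 1" "g \<in> Lp 1"
  shows "fourier (\<lambda>x. f x - g x) \<xi> = fourier f \<xi> - fourier g \<xi>"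
  unfolding fourier_def right_diff_distrib
  by (intro Bochner_Integration.integral_diff integrable_fourier Lp_1_integrable assms)

lemma lebesgue_borel_representative:
  fixes f :: "'a::euclidean_space \<Rightarrow> complex"
  assumes f[measurable]: "f \<in> borel_measurable lebesgue"
  obtains g where "g \<in> borel_measurable borel" "AE x in lebesgue. f x = g x"
proof -
  obtain u where u: "u \<in> borel_measurable lborel" "AE x in lborel. Re (f x) = u x"
    using completion_ex_borel_measurable_real[of "\<lambda>x. Re (f x)" lborel] by auto
  obtain v where v: "v \<in> borel_measurable lborel" "AE x in lborel. Im (f x) = v x"
    using completion_ex_borel_measurable_real[of "\<lambda>x. Im (f x)" lborel] by auto
  show thesis
  proof (rule that[of "\<lambda>x. Complex (u x) (v x)"])
    have [measurable]: "u \<in> borel_measurable borel" "v \<in> borel_measurable borel" using u v by simp_all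
    have "(\<lambda>x. complex_of_real (u x) + \<i> * complex_of_real (v x)) \<in> borel_measurable borel" by measurable
    then show "(\<lambda>x. Complex (u x) (v x)) \<in> borel_measurable borel" by (simp add: Complex_eq)
    show "AE x in lebesgue. f x = Complex (u x) (v x)"
      using AE_completion[OF u(2)] AE_completion[OF v(2)] by eventually_elim (simp add: complex_eq_iff)
  qed
qed

section \<open>The restriction estimate for integrable functions\<close>

context hypersurface
begin

text \<open>
  The level set is exhausted by bounded pieces. On each of them the bound obtained from duality
  contains a power of the measure of the piece smaller than the first power on the left-hand side, and
  can be solved for this measure.
\<close>

lemma level_set_measure:
  fixes f :: "(real^'n) \<times> real \<Rightarrow> complex"
  assumes n: "2 \<le> CARD('n)" and q: "q = 4 * real CARD('n) / (real CARD('n) + 2)"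
    and fi: "integrable lborel f" and A: "(\<integral>\<^sup>+x. ennreal (norm (f x) powr (4/3)) \<partial>lborel) = ennreal A" "0 \<le> A"
    and t: "0 < t"
  shows "(\<integral>\<^sup>+y. ennreal (w y) * indicator {y. t < norm (FT f (\<gamma> y))} y \<partial>lborel) \<le> ennreal ((restriction_const CARD('n) l1 l2 * A powr (3/4) / t) powr q)"
proof -
  let ?n = "real CARD('n)"
  have fm[measurable]: "f \<in> borel_measurable borel" using fi by auto
  have Fm[measurable]: "FT f \<in> borel_measurable borel" by (rule FT_measurable[OF fm])
  define X where "X = (restriction_const CARD('n) l1 l2 * A powr (3/4) / t) powr q"
  define E where "E j = {y \<in> \<Omega>. t < norm (FT f (\<gamma> y)) \<and> norm y \<le> real j \<and> norm (G y) \<le> real j \<and> 0 < w y \<and> w y \<le> real j}" for j :: nat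
  have Em[measurable]: "E j \<in> sets borel" for j unfolding E_def by measurable
  have Ebd: "bounded (E j)" for j unfolding bounded_iff E_def by auto
  have q0: "0 < q" using q by simp
  have each: "(\<integral>\<^sup>+y. ennreal (indicator (E j) y * w y) \<partial>lborel) \<le> ennreal X" for j
  proof -
    have "(\<integral>\<^sup>+y. ennreal (indicator (E j) y * w y) \<partial>lborel) \<le> (\<integral>\<^sup>+y. ennreal (real j) * indicator (E j) y \<partial>lborel)"
      by (rule nn_integral_mono) (auto simp: indicator_def E_def intro: ennreal_leI)
    also have "\<dots> = ennreal (real j) * emeasure lborel (E j)" by (rule nn_integral_cmult_indicator) simp
    also have "\<dots> < top" using emeasure_bounded_finite[OF Ebd] by (simp add: ennreal_mult_less_top)
    finally obtain lam where lam: "(\<integral>\<^sup>+y. ennreal (indicator (E j) y * w y) \<partial>lborel) = ennreal lam" "0 \<le> lam"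
      by (auto simp: less_top_ennreal)
    have "lam \<le> X"
    proof (cases "lam = 0")
      case True
      then show ?thesis by (simp add: X_def)
    next
      case False
      then have l0: "0 < lam" using lam(2) by simp
      have bounded_piece: "bounded_piece (E j) lam"
        unfolding bounded_piece_def using lam l0 Ebd Em by (auto simp: E_def)
      let ?r = "(?n + 2) / (4 * ?n)" and ?k = "(3 * ?n - 2) / (4 * ?n)"
      have n0: "0 < ?n" by simp
      have "t * lam \<le> A powr (3/4) * (extension_const CARD('n) l1 l2 * root CARD('n) (lam ^ (3 * CARD('n) - 2))) powr (1/4)"
        by (rule level_set_piece_bound[OF n bounded_piece fi A]) (use t in \<open>auto simp: E_def\<close>)
      also have "root CARD('n) (lam ^ (3 * CARD('n) - 2)) = lam powr ((3 * ?n - 2) / ?n)"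
      proof -
        have "real (3 * CARD('n) - 2) = 3 * ?n - 2" using n by simp
        then have "lam ^ (3 * CARD('n) - 2) = lam powr (3 * ?n - 2)" using l0 by (simp only: powr_realpow[symmetric])
        moreover have "root CARD('n) (lam powr (3 * ?n - 2)) = (lam powr (3 * ?n - 2)) powr (1 / ?n)"
          using l0 by (intro root_powr_inverse) auto
        ultimately show ?thesis by (simp add: powr_powr)
      qed
      also have "(extension_const CARD('n) l1 l2 * lam powr ((3 * ?n - 2) / ?n)) powr (1/4) = restriction_const CARD('n) l1 l2 * lam powr ?k"
        unfolding restriction_const_def by (subst powr_mult) (simp add: powr_powr mult.commute)
      finally have "t * lam \<le> restriction_const CARD('n) l1 l2 * A powr (3/4) * lam powr ?k" by (simp add: mult_ac)
      moreover have "lam = lam powr ?r * lam powr ?k"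
      proof -
        have "?r + ?k = 1" using n0 by (simp add: add_divide_distrib[symmetric])
        then show ?thesis using l0 by (simp only: powr_add[symmetric]) simp
      qed
      ultimately have "t * lam powr ?r * lam powr ?k \<le> restriction_const CARD('n) l1 l2 * A powr (3/4) * lam powr ?k"
        by (metis mult.assoc)
      then have "t * lam powr ?r \<le> restriction_const CARD('n) l1 l2 * A powr (3/4)"
        using l0 by (subst (asm) mult_le_cancel_right) auto
      then have "lam powr ?r \<le> restriction_const CARD('n) l1 l2 * A powr (3/4) / t" using t by (simp add: le_divide_eq mult.commute)
      then have "(lam powr ?r) powr q \<le> X" unfolding X_def using q0 by (intro powr_mono2) auto
      moreover have "?r * q = 1"
      proof -
        have "(x + 2) / (4 * x) * (4 * x / (x + 2)) = 1" if "0 < x" for x :: real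
          using that by (auto simp: divide_simps)
        then show ?thesis unfolding q using n0 .
      qed
      ultimately show ?thesis using l0 by (simp only: powr_powr powr_one less_imp_le)
    qed
    then show ?thesis unfolding lam(1) by (rule ennreal_leI)
  qed
  have "(\<integral>\<^sup>+y. ennreal (w y) * indicator {y. t < norm (FT f (\<gamma> y))} y \<partial>lborel)
     = (\<integral>\<^sup>+y. (SUP j. ennreal (indicator (E j) y * w y)) \<partial>lborel)"
  proof (rule nn_integral_cong)
    fix y
    show "ennreal (w y) * indicator {y. t < norm (FT f (\<gamma> y))} y = (SUP j. ennreal (indicator (E j) y * w y))"
    proof (cases "0 < w y \<and> t < norm (FT f (\<gamma> y))")
      case True
      then have y: "y \<in> \<Omega>" by (cases "y \<in> \<Omega>") (auto simp: w_def)
      obtain N where N: "max (norm y) (max (norm (G y)) (w y)) \<le> real N" using real_arch_simple by blast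
      then have "y \<in> E N" using True y by (simp add: E_def)
      then have "ennreal (w y) = ennreal (indicator (E N) y * w y)" by simp
      then have "ennreal (w y) \<le> (SUP j. ennreal (indicator (E j) y * w y))"
        by (simp only:) (rule SUP_upper, simp)
      moreover have "(SUP j. ennreal (indicator (E j) y * w y)) \<le> ennreal (w y)"
        using True by (intro SUP_least ennreal_leI) (auto simp: indicator_def)
      ultimately show ?thesis using True by simp
    next
      case False
      then have "y \<notin> E j" for j by (auto simp: E_def)
      then show ?thesis using False w_nonneg[of y] by (auto simp: less_le indicator_def)
    qed
  qed
  also have "\<dots> = (SUP j. \<integral>\<^sup>+y. ennreal (indicator (E j) y * w y) \<partial>lborel)"
  proof (rule nn_integral_monotone_convergence_SUP)
    show "incseq (\<lambda>j y. ennreal (indicator (E j) y * w y))"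
      using w_nonneg by (auto intro!: monoI le_funI ennreal_leI simp: E_def indicator_def)
  qed measurable
  also have "\<dots> \<le> ennreal X" by (intro SUP_least each)
  finally show ?thesis unfolding X_def .
qed

abbreviation "mu \<equiv> affine_surface_measure \<Omega> \<phi>"

lemma space_mu: "space mu = graph_map \<phi> ` \<Omega>"
  by (simp add: affine_surface_measure_def space_restrict_space)

lemma measurable_mu: "g \<in> borel_measurable borel \<Longrightarrow> g \<in> borel_measurable mu"
  by (simp add: affine_surface_measure_def measurable_restrict_space1)

lemma emeasure_mu:
  assumes B[measurable]: "B \<in> sets borel"
  shows "emeasure mu {\<xi> \<in> space mu. \<xi> \<in> B} = (\<integral>\<^sup>+y. ennreal (w y) * indicator (\<gamma> -` B) y \<partial>lborel)"
proof -
  let ?d = "\<lambda>x. ennreal (\<bar>det (hessian \<phi> x)\<bar> powr (1 / (real CARD('n) + 2)))"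
  have gm: "graph_map \<phi> \<in> restrict_space lborel \<Omega> \<rightarrow>\<^sub>M restrict_space borel (graph_map \<phi> ` \<Omega>)"
  proof (rule measurable_restrict_space2)
    have "graph_map \<phi> \<in> borel_measurable (restrict_space borel \<Omega>)"
      unfolding graph_map_def[abs_def]
      by (intro borel_measurable_continuous_on_restrict continuous_intros continuous_on_phi)
    then show "graph_map \<phi> \<in> restrict_space lborel \<Omega> \<rightarrow>\<^sub>M borel"
      by (simp cong: measurable_cong_sets add: sets_restrict_space)
  qed (auto simp: space_restrict_space)
  have gm': "graph_map \<phi> \<in> density (restrict_space lborel \<Omega>) ?d \<rightarrow>\<^sub>M restrict_space borel (graph_map \<phi> ` \<Omega>)"
    using gm by simp
  have dm: "?d \<in> borel_measurable (restrict_space lborel \<Omega>)"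
  proof -
    have "(\<lambda>x. \<bar>det (hessian \<phi> x)\<bar>) \<in> borel_measurable (restrict_space borel \<Omega>)"
      by (intro borel_measurable_continuous_on_restrict continuous_intros continuous_on_det continuous_on_hessian)
    then have "?d \<in> borel_measurable (restrict_space borel \<Omega>)" by measurable
    then show ?thesis by (simp cong: measurable_cong_sets add: sets_restrict_space)
  qed
  have S: "{\<xi> \<in> space mu. \<xi> \<in> B} \<in> sets (restrict_space borel (graph_map \<phi> ` \<Omega>))"
    unfolding space_mu sets_restrict_space by (auto intro!: image_eqI[of _ _ B])
  have pre: "graph_map \<phi> -` {\<xi> \<in> space mu. \<xi> \<in> B} \<inter> space (density (restrict_space lborel \<Omega>) ?d) = \<Omega> \<inter> \<gamma> -` B"
    unfolding space_mu by (auto simp: space_restrict_space space_density graph_map_def \<gamma>_def ph_def)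
  have gB: "\<gamma> -` B \<in> sets borel" using measurable_sets[OF gamma_measurable B] by simp
  have OB: "\<Omega> \<inter> \<gamma> -` B \<in> sets (restrict_space lborel \<Omega>)"
    using gB by (auto simp: sets_restrict_space intro!: image_eqI[of _ _ "\<gamma> -` B"])
  have "emeasure mu {\<xi> \<in> space mu. \<xi> \<in> B} = emeasure (density (restrict_space lborel \<Omega>) ?d) (\<Omega> \<inter> \<gamma> -` B)"
    unfolding affine_surface_measure_def
    by (subst emeasure_distr[OF gm']) (use S pre in \<open>simp_all add: affine_surface_measure_def\<close>)
  also have "\<dots> = (\<integral>\<^sup>+x. ?d x * indicator (\<Omega> \<inter> \<gamma> -` B) x \<partial>restrict_space lborel \<Omega>)"
    by (rule emeasure_density[OF dm OB])
  also have "\<dots> = (\<integral>\<^sup>+x. ?d x * indicator (\<Omega> \<inter> \<gamma> -` B) x * indicator \<Omega> x \<partial>lborel)"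
    by (rule nn_integral_restrict_space) simp
  also have "\<dots> = (\<integral>\<^sup>+y. ennreal (w y) * indicator (\<gamma> -` B) y \<partial>lborel)"
    by (intro nn_integral_cong) (auto simp: w_def indicator_def)
  finally show ?thesis .
qed

lemma fourier_eq_FT:
  fixes f g :: "(real^'n) \<times> real \<Rightarrow> complex"
  assumes f: "f \<in> borel_measurable lebesgue" and g[measurable]: "g \<in> borel_measurable borel" and ae: "AE x in lebesgue. f x = g x"
  shows "fourier f \<xi> = FT g \<xi>"
proof -
  have c: "(\<lambda>x. cis (- (\<xi> \<bullet> x)) * g x) \<in> borel_measurable lborel" by measurable
  have [measurable]: "(\<lambda>x. cis (- (\<xi> \<bullet> x))) \<in> borel_measurable lebesgue" by (rule measurable_completion) measurable
  have [measurable]: "g \<in> borel_measurable lebesgue" by (rule measurable_completion) simp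
  note f[measurable]
  have "fourier f \<xi> = (LINT x|lebesgue. cis (- (\<xi> \<bullet> x)) * g x)"
    unfolding fourier_def by (rule integral_cong_AE) (use ae in auto)
  also have "\<dots> = FT g \<xi>" unfolding FT_def by (rule integral_completion[OF c])
  finally show ?thesis .
qed

lemma weak_norm_fourier_le:
  assumes n: "2 \<le> CARD('n)" and q: "q = 4 * real CARD('n) / (real CARD('n) + 2)"
    and f1: "f \<in> Lp 1" and f: "f \<in> Lp (4/3)"
  shows "fourier f \<in> borel_measurable mu" and "weak_norm mu q (fourier f) \<le> ennreal (restriction_const CARD('n) l1 l2 * Lp_norm (4/3) f)"
proof -
  have fm: "f \<in> borel_measurable lebesgue" using f by (simp add: Lp_def)
  obtain g where g[measurable]: "g \<in> borel_measurable borel" and ae: "AE x in lebesgue. f x = g x"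
    using lebesgue_borel_representative[OF fm] by blast
  have gl[measurable]: "g \<in> borel_measurable lebesgue" by (rule measurable_completion) simp
  have F: "fourier f = FT g" by (rule ext) (rule fourier_eq_FT[OF fm g ae])
  have Gm: "FT g \<in> borel_measurable borel" by (rule FT_measurable[OF g])
  then show "fourier f \<in> borel_measurable mu" unfolding F by (rule measurable_mu)
  have "integrable lebesgue f" using f1 by (rule Lp_1_integrable)
  then have "integrable lebesgue g" by (rule integrable_cong_AE_imp[OF _ gl]) (use ae in auto)
  then have gi: "integrable lborel g" by (subst (asm) integrable_completion) simp_all
  define A where "A = (LINT x|lebesgue. norm (f x) powr (4/3))"
  have A0: "0 \<le> A" by (simp add: A_def)
  have A: "(\<integral>\<^sup>+x. ennreal (norm (g x) powr (4/3)) \<partial>lborel) = ennreal A"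
  proof -
    have "(\<integral>\<^sup>+x. ennreal (norm (g x) powr (4/3)) \<partial>lborel) = (\<integral>\<^sup>+x. ennreal (norm (g x) powr (4/3)) \<partial>lebesgue)"
      by (rule nn_integral_completion[symmetric])
    also have "\<dots> = (\<integral>\<^sup>+x. ennreal (norm (f x) powr (4/3)) \<partial>lebesgue)"
      by (rule nn_integral_cong_AE) (use ae in auto)
    also have "\<dots> = ennreal A"
      unfolding A_def using f by (intro nn_integral_eq_integral) (auto simp: Lp_def)
    finally show ?thesis .
  qed
  have q0: "0 < q" using q by simp
  have N: "restriction_const CARD('n) l1 l2 * A powr (3/4) = restriction_const CARD('n) l1 l2 * Lp_norm (4/3) f" by (simp add: A_def Lp_norm_def)
  have "emeasure mu {\<xi> \<in> space mu. t < norm (FT g \<xi>)} \<le> ennreal ((restriction_const CARD('n) l1 l2 * A powr (3/4) / t) powr q)" if t: "0 < t" for t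
  proof -
    have B: "{\<xi>. t < norm (FT g \<xi>)} \<in> sets borel" using Gm by measurable
    have "emeasure mu {\<xi> \<in> space mu. t < norm (FT g \<xi>)} = (\<integral>\<^sup>+y. ennreal (w y) * indicator {y. t < norm (FT g (\<gamma> y))} y \<partial>lborel)"
      using emeasure_mu[OF B] by (simp add: vimage_def)
    also have "\<dots> \<le> ennreal ((restriction_const CARD('n) l1 l2 * A powr (3/4) / t) powr q)" by (rule level_set_measure[OF n q gi A A0 t])
    finally show ?thesis .
  qed
  then show "weak_norm mu q (fourier f) \<le> ennreal (restriction_const CARD('n) l1 l2 * Lp_norm (4/3) f)"
    unfolding F N[symmetric] using restriction_const_pos[of "CARD('n)" l1 l2] A0 by (subst weak_norm_le_iff[OF q0]) auto
qed

end

section \<open>Extension by continuity\<close>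

lemma Lp_norm_diff_via:
  assumes a: "a \<in> Lp p" and b: "b \<in> Lp p" and f: "f \<in> Lp p" and p: "1 \<le> p"
  shows "Lp_norm p (\<lambda>x. a x - b x) \<le> 2 * (Lp_norm p (\<lambda>x. a x - f x) + Lp_norm p (\<lambda>x. b x - f x))"
proof -
  have p0: "0 \<le> p" using p by simp
  have "Lp_norm p (\<lambda>x. (a x - f x) - (b x - f x)) \<le> 2 * (Lp_norm p (\<lambda>x. a x - f x) + Lp_norm p (\<lambda>x. b x - f x))"
    by (rule Lp_norm_diff_le[OF Lp_diff[OF a f p0] Lp_diff[OF b f p0] p])
  then show ?thesis by simp
qed

lemma convergent_of_geometric_steps:
  fixes u :: "nat \<Rightarrow> complex"
  assumes "eventually (\<lambda>j. norm (u j - u (Suc j)) \<le> (1/2) ^ j) sequentially"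
  shows "convergent u"
proof -
  have "summable (\<lambda>j. u (Suc j) - u j)"
  proof (rule summable_comparison_test_ev)
    show "eventually (\<lambda>j. norm (u (Suc j) - u j) \<le> (1/2) ^ j) sequentially"
      using assms by (simp add: norm_minus_commute)
    show "summable (\<lambda>j. (1/2::real) ^ j)" by (rule summable_geometric) simp
  qed
  then have "convergent (\<lambda>k. \<Sum>j<k. u (Suc j) - u j)" by (simp add: summable_iff_convergent)
  then have "convergent (\<lambda>k. (u k - u 0) + u 0)"
    unfolding sum_lessThan_telescope by (intro convergent_add convergent_const)
  then show ?thesis by simp
qed

context hypersurface
begin

lemma weak_norm_fourier_diff:
  assumes n: "2 \<le> CARD('n)" and q: "q = 4 * real CARD('n) / (real CARD('n) + 2)"
    and F: "F \<in> Lp 1 \<inter> Lp (4/3)" and H: "H \<in> Lp 1 \<inter> Lp (4/3)"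
  shows "weak_norm mu q (\<lambda>\<xi>. fourier F \<xi> - fourier H \<xi>) \<le> ennreal (restriction_const CARD('n) l1 l2 * Lp_norm (4/3) (\<lambda>x. F x - H x))"
proof -
  have "weak_norm mu q (fourier (\<lambda>x. F x - H x)) \<le> ennreal (restriction_const CARD('n) l1 l2 * Lp_norm (4/3) (\<lambda>x. F x - H x))"
    using F H by (intro weak_norm_fourier_le[OF n q] Lp_diff) auto
  moreover have "fourier (\<lambda>x. F x - H x) = (\<lambda>\<xi>. fourier F \<xi> - fourier H \<xi>)"
    using F H by (intro ext fourier_diff) auto
  ultimately show ?thesis by simp
qed

lemma trunc_mem: "f \<in> Lp (4/3) \<Longrightarrow> trunc f k \<in> Lp 1 \<inter> Lp (4/3)"
  using trunc_Lp[of f "4/3" k] trunc_Lp_1[of f k] by (auto simp: Lp_def)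

text \<open>
  Truncations that converge at the rate \<open>4^(-j)\<close> have transforms whose successive differences exceed
  \<open>2^(-j)\<close> only on sets of summable measure, hence the transforms converge almost everywhere by
  Borel-Cantelli. Along any other approximating sequence, Fatou's lemma compares the transforms with
  this limit.
\<close>

lemma fourier_extension_exists:
  fixes f :: "(real^'n) \<times> real \<Rightarrow> complex"
  assumes n: "2 \<le> CARD('n)" and q: "q = 4 * real CARD('n) / (real CARD('n) + 2)" and f: "f \<in> Lp (4/3)"
  shows "\<exists>g. fourier_extension mu (4/3) q f g"
proof -
  have q1: "1 \<le> q" using n unfolding q by (simp add: divide_simps)
  then have q0: "0 < q" by simp
  let ?N = "Lp_norm (4/3) :: ((real^'n) \<times> real \<Rightarrow> complex) \<Rightarrow> real"
  have conv: "(\<lambda>k. ?N (\<lambda>x. trunc f k x - f x)) \<longlonglongrightarrow> 0"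
    by (rule Lp_norm_trunc_tendsto[OF f]) simp
  have "\<exists>k. ?N (\<lambda>x. trunc f k x - f x) < (1/4) ^ j" for j
    using order_tendstoD(2)[OF conv, of "(1/4) ^ j"] by (auto simp: eventually_sequentially)
  then obtain m where m: "\<And>j. ?N (\<lambda>x. trunc f (m j) x - f x) < (1/4) ^ j" by metis
  define h where "h j = trunc f (m j)" for j
  have hL: "h j \<in> Lp 1 \<inter> Lp (4/3)" for j unfolding h_def by (rule trunc_mem[OF f])
  have hf: "?N (\<lambda>x. h j x - f x) < (1/4) ^ j" for j unfolding h_def by (rule m)
  define u where "u j = fourier (h j)" for j
  have um[measurable]: "u j \<in> borel_measurable mu" for j
    unfolding u_def using hL[of j] by (intro weak_norm_fourier_le(1)[OF n q]) auto
  have step: "weak_norm mu q (\<lambda>\<xi>. u j \<xi> - u (Suc j) \<xi>) \<le> ennreal (restriction_const CARD('n) l1 l2 * (4 * (1/4) ^ j))" for j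
  proof -
    have "?N (\<lambda>x. h j x - h (Suc j) x) \<le> 2 * (?N (\<lambda>x. h j x - f x) + ?N (\<lambda>x. h (Suc j) x - f x))"
      using hL f by (intro Lp_norm_diff_via) auto
    also have "\<dots> \<le> 2 * ((1/4) ^ j + (1/4) ^ Suc j)"
      using hf[of j] hf[of "Suc j"] by (intro mult_left_mono add_mono) auto
    also have "\<dots> \<le> 4 * (1/4) ^ j" by simp
    finally have le: "?N (\<lambda>x. h j x - h (Suc j) x) \<le> 4 * (1/4) ^ j" .
    have "weak_norm mu q (\<lambda>\<xi>. u j \<xi> - u (Suc j) \<xi>) \<le> ennreal (restriction_const CARD('n) l1 l2 * ?N (\<lambda>x. h j x - h (Suc j) x))"
      unfolding u_def by (rule weak_norm_fourier_diff[OF n q hL hL])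
    also have "\<dots> \<le> ennreal (restriction_const CARD('n) l1 l2 * (4 * (1/4) ^ j))"
      using le restriction_const_pos[of "CARD('n)" l1 l2] by (intro ennreal_leI mult_left_mono) auto
    finally show ?thesis .
  qed
  let ?A = "\<lambda>j. {\<xi> \<in> space mu. (1/2) ^ j < norm (u j \<xi> - u (Suc j) \<xi>)}"
  have Ab: "emeasure mu (?A j) \<le> ennreal ((4 * restriction_const CARD('n) l1 l2) powr q * (1/2) ^ j)" for j
  proof -
    have "emeasure mu (?A j) \<le> ennreal ((restriction_const CARD('n) l1 l2 * (4 * (1/4) ^ j) / (1/2) ^ j) powr q)"
    proof -
      have c: "0 \<le> restriction_const CARD('n) l1 l2 * (4 * (1/4) ^ j)" using restriction_const_pos[of "CARD('n)" l1 l2] by simp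
      have "(0::real) < (1/2) ^ j" by simp
      then show ?thesis using step[of j] unfolding weak_norm_le_iff[OF q0 c] by blast
    qed
    also have "restriction_const CARD('n) l1 l2 * (4 * (1/4) ^ j) / (1/2) ^ j = 4 * restriction_const CARD('n) l1 l2 * (1/2) ^ j"
    proof -
      have "(1/4::real) ^ j = (1/2) ^ j * (1/2) ^ j" by (simp flip: power_mult_distrib)
      then show ?thesis by simp
    qed
    also have "(4 * restriction_const CARD('n) l1 l2 * (1/2) ^ j) powr q = (4 * restriction_const CARD('n) l1 l2) powr q * ((1/2) ^ j) powr q"
      by (rule powr_mult)
    also have "ennreal \<dots> \<le> ennreal ((4 * restriction_const CARD('n) l1 l2) powr q * (1/2) ^ j)"
    proof (intro ennreal_leI mult_left_mono)
      have "((1/2) ^ j) powr q \<le> ((1/2::real) ^ j) powr 1"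
        using q1 by (intro powr_mono') (auto simp: power_le_one)
      then show "((1/2::real) ^ j) powr q \<le> (1/2) ^ j" by simp
    qed simp
    finally show ?thesis .
  qed
  have AE1: "AE \<xi> in mu. eventually (\<lambda>j. \<xi> \<in> space mu - ?A j) sequentially"
  proof (rule borel_cantelli_AE1)
    show "?A j \<in> sets mu" for j by measurable
    show "emeasure mu (?A j) < \<infinity>" for j using Ab[of j] by (rule le_less_trans) simp
    have mle: "measure mu (?A j) \<le> (4 * restriction_const CARD('n) l1 l2) powr q * (1/2) ^ j" for j
      unfolding measure_def using Ab[of j] by (intro enn2real_leI) auto
    show "summable (\<lambda>j. measure mu (?A j))"
    proof (rule summable_comparison_test')
      show "summable (\<lambda>j. (4 * restriction_const CARD('n) l1 l2) powr q * (1/2) ^ j)" by (intro summable_mult summable_geometric) simp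
      show "norm (measure mu (?A j)) \<le> (4 * restriction_const CARD('n) l1 l2) powr q * (1/2) ^ j" if "0 \<le> j" for j using mle[of j] by simp
    qed
  qed
  define g where "g \<xi> = lim (\<lambda>j. u j \<xi>)" for \<xi>
  have gm[measurable]: "g \<in> borel_measurable mu" unfolding g_def[abs_def] by (rule borel_measurable_lim_metric) measurable
  have lim: "AE \<xi> in mu. (\<lambda>j. u j \<xi>) \<longlonglongrightarrow> g \<xi>"
    using AE1
  proof eventually_elim
    case (elim \<xi>)
    have "convergent (\<lambda>j. u j \<xi>)"
      by (rule convergent_of_geometric_steps) (use elim in \<open>auto elim!: eventually_mono simp: not_less\<close>)
    then show ?case unfolding g_def by (simp add: convergent_LIMSEQ_iff)
  qed
  have "fourier_extension mu (4/3) q f g"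
    unfolding fourier_extension_def
  proof (intro conjI allI impI)
    show "g \<in> borel_measurable mu" by (rule gm)
    fix F assume F: "\<forall>k. F k \<in> Lp 1 \<inter> Lp (4/3)" and Ff: "(\<lambda>k. ?N (\<lambda>x. F k x - f x)) \<longlonglongrightarrow> 0"
    let ?e = "\<lambda>k. restriction_const CARD('n) l1 l2 * (2 * (?N (\<lambda>x. F k x - f x) + inverse (real (Suc k))))"
    have bound: "weak_norm mu q (\<lambda>\<xi>. fourier (F k) \<xi> - g \<xi>) \<le> ennreal (?e k)" for k
    proof (rule weak_norm_Fatou[OF q0])
      have Fk: "F k \<in> Lp 1 \<inter> Lp (4/3)" using F ..
      show "0 \<le> ?e k" using restriction_const_pos[of "CARD('n)" l1 l2] Lp_norm_nonneg by (intro mult_nonneg_nonneg add_nonneg_nonneg) auto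
      have Fm[measurable]: "fourier (F k) \<in> borel_measurable mu" using Fk by (intro weak_norm_fourier_le(1)[OF n q]) auto
      show "(\<lambda>\<xi>. fourier (F k) \<xi> - u j \<xi>) \<in> borel_measurable mu" for j by measurable
      show "(\<lambda>\<xi>. fourier (F k) \<xi> - g \<xi>) \<in> borel_measurable mu" by measurable
      show "AE \<xi> in mu. (\<lambda>j. fourier (F k) \<xi> - u j \<xi>) \<longlonglongrightarrow> fourier (F k) \<xi> - g \<xi>"
        using lim by eventually_elim (intro tendsto_intros)
      have "(\<lambda>j. (1/4::real) ^ j) \<longlonglongrightarrow> 0" by (rule LIMSEQ_power_zero) simp
      then have "eventually (\<lambda>j. (1/4::real) ^ j < inverse (real (Suc k))) sequentially"
        by (rule order_tendstoD(2)) simp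
      then show "eventually (\<lambda>j. weak_norm mu q (\<lambda>\<xi>. fourier (F k) \<xi> - u j \<xi>) \<le> ennreal (?e k)) sequentially"
      proof eventually_elim
        case (elim j)
        have "weak_norm mu q (\<lambda>\<xi>. fourier (F k) \<xi> - u j \<xi>) \<le> ennreal (restriction_const CARD('n) l1 l2 * ?N (\<lambda>x. F k x - h j x))"
          unfolding u_def by (rule weak_norm_fourier_diff[OF n q Fk hL])
        also have "\<dots> \<le> ennreal (?e k)"
        proof (intro ennreal_leI mult_left_mono)
          have "?N (\<lambda>x. F k x - h j x) \<le> 2 * (?N (\<lambda>x. F k x - f x) + ?N (\<lambda>x. h j x - f x))"
            using Fk hL[of j] f by (intro Lp_norm_diff_via) auto
          also have "\<dots> \<le> 2 * (?N (\<lambda>x. F k x - f x) + inverse (real (Suc k)))"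
            using hf[of j] elim by (intro mult_left_mono add_mono) auto
          finally show "?N (\<lambda>x. F k x - h j x) \<le> 2 * (?N (\<lambda>x. F k x - f x) + inverse (real (Suc k)))" .
        qed (use restriction_const_pos[of "CARD('n)" l1 l2] in simp)
        finally show ?case .
      qed
    qed
    have "?e \<longlonglongrightarrow> restriction_const CARD('n) l1 l2 * (2 * (0 + 0))"
      by (intro tendsto_intros Ff LIMSEQ_inverse_real_of_nat)
    then have "(\<lambda>k. ennreal (?e k)) \<longlonglongrightarrow> ennreal 0" by (intro tendsto_ennrealI) simp
    then have e0: "(\<lambda>k. ennreal (?e k)) \<longlonglongrightarrow> 0" by simp
    show "(\<lambda>k. weak_norm mu q (\<lambda>\<xi>. fourier (F k) \<xi> - g \<xi>)) \<longlonglongrightarrow> 0"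
    proof (rule tendsto_sandwich[OF _ _ tendsto_const e0])
      show "eventually (\<lambda>k. weak_norm mu q (\<lambda>\<xi>. fourier (F k) \<xi> - g \<xi>) \<le> ennreal (?e k)) sequentially"
        by (intro always_eventually allI bound)
    qed simp
  qed
  then show ?thesis by blast
qed

text \<open>
  The transforms of the truncations satisfy the bound and converge to \<open>g\<close>; the factor 2 is the
  constant in the triangle inequality of the weak norm.
\<close>

lemma fourier_extension_bound:
  fixes f :: "(real^'n) \<times> real \<Rightarrow> complex"
  assumes n: "2 \<le> CARD('n)" and q: "q = 4 * real CARD('n) / (real CARD('n) + 2)" and f: "f \<in> Lp (4/3)"
    and g: "fourier_extension mu (4/3) q f g"
  shows "weak_norm mu q g \<le> ennreal (2 * restriction_const CARD('n) l1 l2 * Lp_norm (4/3) f)"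
proof (rule ennreal_le_epsilon)
  have q1: "1 \<le> q" using n unfolding q by (simp add: divide_simps)
  fix e :: real assume e: "0 < e"
  have gm: "g \<in> borel_measurable mu" using g by (simp add: fourier_extension_def)
  have "(\<lambda>k. Lp_norm (4/3) (\<lambda>x. trunc f k x - f x)) \<longlonglongrightarrow> 0"
    by (rule Lp_norm_trunc_tendsto[OF f]) simp
  then have "(\<lambda>k. weak_norm mu q (\<lambda>\<xi>. fourier (trunc f k) \<xi> - g \<xi>)) \<longlonglongrightarrow> 0"
    using g trunc_mem[OF f] unfolding fourier_extension_def by blast
  then have "eventually (\<lambda>k. weak_norm mu q (\<lambda>\<xi>. fourier (trunc f k) \<xi> - g \<xi>) < ennreal (e / 2)) sequentially"
    by (rule order_tendstoD(2)) (use e in simp)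
  then obtain k where k: "weak_norm mu q (\<lambda>\<xi>. fourier (trunc f k) \<xi> - g \<xi>) < ennreal (e / 2)"
    by (auto simp: eventually_sequentially)
  have Fm: "fourier (trunc f k) \<in> borel_measurable mu"
    using trunc_mem[OF f, of k] by (intro weak_norm_fourier_le(1)[OF n q]) auto
  have "weak_norm mu q (fourier (trunc f k)) \<le> ennreal (restriction_const CARD('n) l1 l2 * Lp_norm (4/3) (trunc f k))"
    using trunc_mem[OF f, of k] by (intro weak_norm_fourier_le(2)[OF n q]) auto
  also have "\<dots> \<le> ennreal (restriction_const CARD('n) l1 l2 * Lp_norm (4/3) f)"
    using restriction_const_pos[of "CARD('n)" l1 l2] by (intro ennreal_leI mult_left_mono Lp_norm_trunc_le[OF f]) auto
  finally have b: "weak_norm mu q (fourier (trunc f k)) \<le> ennreal (restriction_const CARD('n) l1 l2 * Lp_norm (4/3) f)" .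
  have e2: "0 \<le> e / 2" using e by simp
  have K: "0 \<le> restriction_const CARD('n) l1 l2 * Lp_norm (4/3) f" using restriction_const_pos[of "CARD('n)" l1 l2] Lp_norm_nonneg[of "4/3" f] by simp
  have "weak_norm mu q g \<le> ennreal (2 * (e / 2) + 2 * (restriction_const CARD('n) l1 l2 * Lp_norm (4/3) f))"
    by (rule weak_norm_triangle[OF q1 e2 K gm Fm less_imp_le[OF k] b])
  also have "\<dots> = ennreal (2 * restriction_const CARD('n) l1 l2 * Lp_norm (4/3) f) + ennreal e"
    using e K by (subst ennreal_plus[symmetric]) (auto simp: mult.assoc add.commute)
  finally show "weak_norm mu q g \<le> ennreal (2 * restriction_const CARD('n) l1 l2 * Lp_norm (4/3) f) + ennreal e" .
qed

end

section \<open>The restriction theorem\<close>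

theorem mainTheorem1:
  fixes d l1 l2 :: nat and q :: real
  assumes "d = CARD('n::finite) + 1" and "d \<ge> 3"
    and "q = 4 * (real d - 1) / (real d + 1)"
  shows "\<exists>C>0. \<forall>(\<Omega> :: (real^'n) set) (\<phi> :: real^'n \<Rightarrow> real).
    open \<Omega> \<longrightarrow> C2_on \<Omega> \<phi> \<longrightarrow>
    generic_multiplicity_le \<Omega> (grad \<phi>) l1 \<longrightarrow>
    generic_multiplicity_le (tuples \<Omega>) (Psi \<phi>) l2 \<longrightarrow>
    (\<forall>f \<in> Lp (4/3).
       (f \<in> Lp 1 \<longrightarrow>
          weak_norm (affine_surface_measure \<Omega> \<phi>) q (fourier f) \<le> ennreal (C * Lp_norm (4/3) f)) \<and>
       (\<exists>g. fourier_extension (affine_surface_measure \<Omega> \<phi>) (4/3) q f g) \<and>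
       (\<forall>g. fourier_extension (affine_surface_measure \<Omega> \<phi>) (4/3) q f g \<longrightarrow>
          weak_norm (affine_surface_measure \<Omega> \<phi>) q g \<le> ennreal (C * Lp_norm (4/3) f)))"
proof -
  have n: "2 \<le> CARD('n)" using assms(1,2) by simp
  have q: "q = 4 * real CARD('n) / (real CARD('n) + 2)" using assms(1,3) by (simp add: add.commute)
  let ?C = "2 * restriction_const CARD('n) l1 l2"
  have bounds: "(f \<in> Lp 1 \<longrightarrow>
          weak_norm (affine_surface_measure \<Omega> \<phi>) q (fourier f) \<le> ennreal (?C * Lp_norm (4/3) f)) \<and>
       (\<exists>g. fourier_extension (affine_surface_measure \<Omega> \<phi>) (4/3) q f g) \<and>
       (\<forall>g. fourier_extension (affine_surface_measure \<Omega> \<phi>) (4/3) q f g \<longrightarrow>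
          weak_norm (affine_surface_measure \<Omega> \<phi>) q g \<le> ennreal (?C * Lp_norm (4/3) f))"
    if \<Omega>: "open \<Omega>" "C2_on \<Omega> \<phi>" "generic_multiplicity_le \<Omega> (grad \<phi>) l1" "generic_multiplicity_le (tuples \<Omega>) (Psi \<phi>) l2"
      and f: "f \<in> Lp (4/3)" for \<Omega> :: "(real^'n) set" and \<phi> f
  proof -
    interpret hypersurface \<Omega> \<phi> l1 l2 by unfold_locales (fact \<Omega>)+
    have "weak_norm mu q (fourier f) \<le> ennreal (2 * restriction_const CARD('n) l1 l2 * Lp_norm (4/3) f)" if "f \<in> Lp 1"
    proof -
      have "weak_norm mu q (fourier f) \<le> ennreal (restriction_const CARD('n) l1 l2 * Lp_norm (4/3) f)"
        by (rule weak_norm_fourier_le(2)[OF n q that f])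
      also have "\<dots> \<le> ennreal (2 * restriction_const CARD('n) l1 l2 * Lp_norm (4/3) f)"
        using restriction_const_pos[of "CARD('n)" l1 l2] by (intro ennreal_leI mult_right_mono Lp_norm_nonneg) auto
      finally show ?thesis .
    qed
    then show ?thesis
      using restriction_const_pos[of "CARD('n)" l1 l2] fourier_extension_exists[OF n q f] fourier_extension_bound[OF n q f] by auto
  qed
  show ?thesis
  proof (intro exI[of _ ?C] conjI)
    show "0 < ?C" using restriction_const_pos[of "CARD('n)" l1 l2] by simp
  qed (use bounds in blast)
qed

end
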